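(* Let $\varepsilon>0$ and assume $n\in\Omega\left(\exp\left((1/\varepsilon)^{O(1)}\right)\right)$ is sufficiently large. For any $r\in\Omega(1/\varepsilon)\cap O(n^{1/3})$, there exists an algorithm that, for the problem of maximizing a monotone submodular function $f$ under the cardinality constraint $\mathcal{I}(r)=\{S\subseteq N:|S|\le r\}$ given only the noisy value oracle $\tilde f$, returns a $\left(1-\frac1e-O(\varepsilon)\right)$-approximation with probability at least $1-O\left(\frac{1}{\log n}\right)$, using at most $O\left(r^2\log^2 r\cdot n^{3/2}\varepsilon^{-1}\max\{r,\log n\}\right)$ queries to $\tilde f$.
   Context: $N$ is a ground set with $|N|=n$. $f:2^N\to\mathbb{R}_{\ge0}$ is monotone ($f(A)\le f(B)$ for $A\subseteq B$), submodular ($f(A\cup\{x\})-f(A)\ge f(B\cup\{x\})-f(B)$ for $A\subseteq B$, $x\notin B$) and $f(\varnothing)=0$. A noise distribution $\mathcal{D}$ has a generalized exponential tail if there is $x_0$ such that for every $x>x_0$ its density is $\rho(x)=e^{-g(x)}$ with $g(x)=\sum_i c_ix^{\gamma_i}$ for some reals $\gamma_0\ge\gamma_1\ge\cdots$ with $\gamma_0\ge1$ and $c_0>0$; if $\mathcal{D}$ has bounded support it is only required that $\mathcal{D}$ has an atom at its supremum or that $\rho$ is continuous and nonzero at the supremum. It is assumed $\mathbb{E}[\mathcal{D}]=1$. The noisy value oracle satisfies $\tilde f(S)=\xi_Sf(S)$ for every $S\subseteq N$, where the $\xi_S$ are drawn i.i.d. from a fixed generalized-exponential-tail distribution $\mathcal{D}$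 (one draw per set, so repeated queries return the same value). The algorithm accesses $f$ only through $\tilde f$. A $\beta$-approximation is a feasible $S$ with $f(S)\ge\beta\max_{T\in\mathcal{I}(r)}f(T)$. Constants hidden in $O(\cdot)$, $\Omega(\cdot)$ may depend on $\mathcal{D}$. *)

theory Defs
  imports "HOL-Probability.Probability"
begin

definition submodular_on :: "'a set \<Rightarrow> ('a set \<Rightarrow> real) \<Rightarrow> bool" where
  "submodular_on N f \<longleftrightarrow>
     (\<forall>A B x. A \<subseteq> B \<longrightarrow> B \<subseteq> N \<longrightarrow> x \<in> N - B \<longrightarrow>
        f (insert x A) - f A \<ge> f (insert x B) - f B)"

definition monotone_submodular :: "'a set \<Rightarrow> ('a set \<Rightarrow> real) \<Rightarrow> bool" where
  "monotone_submodular N f \<longleftrightarrow>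
     (\<forall>S \<subseteq> N. 0 \<le> f S) \<and> f {} = 0 \<and> mono_on (Pow N) f \<and> submodular_on N f"

definition cardinality_constraint :: "'a set \<Rightarrow> nat \<Rightarrow> 'a set set" where
  "cardinality_constraint N r = {S. S \<subseteq> N \<and> card S \<le> r}"

definition is_approximation :: "'a set set \<Rightarrow> ('a set \<Rightarrow> real) \<Rightarrow> real \<Rightarrow> 'a set \<Rightarrow> bool" where
  "is_approximation \<I> f \<beta> S \<longleftrightarrow> S \<in> \<I> \<and> f S \<ge> \<beta> * Max (f ` \<I>)"

text \<open>\<^term>\<open>\<rho>\<close> is a Lebesgue density of the part of \<^term>\<open>D\<close> living on \<^term>\<open>X\<close>;
  nothing is said about \<^term>\<open>D\<close> outside \<^term>\<open>X\<close>.\<close>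

definition has_density_on :: "real measure \<Rightarrow> real set \<Rightarrow> (real \<Rightarrow> real) \<Rightarrow> bool" where
  "has_density_on D X \<rho> \<longleftrightarrow>
     \<rho> \<in> borel_measurable borel \<and> (\<forall>x. 0 \<le> \<rho> x) \<and>
     (\<forall>A \<in> sets borel. A \<subseteq> X \<longrightarrow> emeasure D A = (\<integral>\<^sup>+x\<in>A. ennreal (\<rho> x) \<partial>lborel))"

definition support :: "real measure \<Rightarrow> real set" where
  "support D = {x. \<forall>e>0. measure D (ball x e) > 0}"

text \<open>The exponents form an infinite sequence; finite sums are obtained by padding with zero
  coefficients, and infinite ones are required to converge unconditionally (\<^const>\<open>has_sum\<close>).
  Since \<^term>\<open>x\<^sub>0\<close> may always be enlarged, it is taken to be nonnegative so that the real
  powers have their usual meaning. In the bounded case the density vanishes to the right of the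
  supremum, so continuity there is continuity from the left.\<close>

definition generalized_exponential_tail :: "real measure \<Rightarrow> bool" where
  "generalized_exponential_tail D \<longleftrightarrow>
     (if bounded (support D) then
        measure D {Sup (support D)} > 0 \<or>
        (\<exists>\<rho>. \<exists>\<delta>>0. has_density_on D {Sup (support D) - \<delta> .. Sup (support D)} \<rho> \<and>
             (\<rho> \<longlongrightarrow> \<rho> (Sup (support D))) (at_left (Sup (support D))) \<and>
             \<rho> (Sup (support D)) \<noteq> 0)
      else
        (\<exists>x\<^sub>0\<ge>0. \<exists>\<rho> g c \<gamma>. has_density_on D {x\<^sub>0<..} \<rho> \<and>
             antimono (\<gamma> :: nat \<Rightarrow> real) \<and> \<gamma> 0 \<ge> 1 \<and> c 0 > 0 \<and>
             (\<forall>x>x\<^sub>0. \<rho> x = exp (- g x) \<and> ((\<lambda>i. c i * x powr \<gamma> i) has_sum g x) UNIV)))"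

text \<open>Deterministic adaptive algorithms with oracle access are decision trees whose branching is
  indexed by the real number returned by the oracle.\<close>

datatype 'a strategy = Return "'a set" | Query "'a set" "real \<Rightarrow> 'a strategy"

primrec queries_within :: "'a set \<Rightarrow> 'a strategy \<Rightarrow> bool" where
  "queries_within N (Return S) \<longleftrightarrow> True"
| "queries_within N (Query S k) \<longleftrightarrow> S \<subseteq> N \<and> (\<forall>y. queries_within N (k y))"

primrec result :: "'a strategy \<Rightarrow> ('a set \<Rightarrow> real) \<Rightarrow> 'a set" where
  "result (Return S) orc = S"
| "result (Query S k) orc = result (k (orc S)) orc"

primrec num_queries :: "'a strategy \<Rightarrow> ('a set \<Rightarrow> real) \<Rightarrow> nat" where
  "num_queries (Return S) orc = 0"
| "num_queries (Query S k) orc = Suc (num_queries (k (orc S)) orc)"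

text \<open>A randomized algorithm is a distribution over decision trees, the internal randomness being
  independent of the noise. The returned set has to depend measurably on the oracle answers.\<close>

definition algorithm_on :: "'a set \<Rightarrow> 'a strategy pmf \<Rightarrow> bool" where
  "algorithm_on N \<A> \<longleftrightarrow>
     (\<forall>T \<in> set_pmf \<A>. queries_within N T \<and>
        result T \<in> measurable (PiM (Pow N) (\<lambda>_. borel)) (count_space (Pow N)))"

definition noisy_oracle :: "('a set \<Rightarrow> real) \<Rightarrow> ('a set \<Rightarrow> real) \<Rightarrow> 'a set \<Rightarrow> real" where
  "noisy_oracle f \<xi> = (\<lambda>S. \<xi> S * f S)"

text \<open>The product measure makes the multipliers of the subsets of \<^term>\<open>N\<close> i.i.d. with law
  \<^term>\<open>D\<close>; the expectation averages over the internal randomness.\<close>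

definition success_probability ::
    "real measure \<Rightarrow> 'a set \<Rightarrow> 'a set set \<Rightarrow> ('a set \<Rightarrow> real) \<Rightarrow> real \<Rightarrow> 'a strategy pmf \<Rightarrow> real" where
  "success_probability D N \<I> f \<beta> \<A> =
     measure_pmf.expectation \<A> (\<lambda>T.
       measure (PiM (Pow N) (\<lambda>_. D))
         {\<xi> \<in> space (PiM (Pow N) (\<lambda>_. D)). is_approximation \<I> f \<beta> (result T (noisy_oracle f \<xi>))})"

end

theory Submission
  imports Defs "HOL-Real_Asymp.Real_Asymp"
begin

text \<open>Fix \<open>H \<subseteq> N\<close> with about \<open>r \<surd>n\<close> elements. The smoothed function
  \<open>T \<mapsto> \<Sum>x\<in>H. f (T \<union> {x})\<close> is again monotone and submodular, dominates \<open>|H| f\<close>, and can be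
  estimated from the noisy values of the sets \<open>T \<union> {x}\<close>: all of these values are at most the optimum,
  so by Hoeffding's inequality (applied to the truncated noise) the estimates have additive error
  \<open>\<epsilon>/r\<close> times the optimum per element of \<open>H\<close>. This is all that the greedy algorithm needs in order to
  reach a factor \<open>1 - 1/e - O(\<epsilon>)\<close> for the smoothed function after \<open>r - 2\<close> steps. The \<open>i\<close>-th step only
  queries sets of size \<open>i + 1\<close>, hence it meets fresh noise.

  It remains to find one \<open>x \<in> H\<close> for which \<open>f (S \<union> {x})\<close> is not much below the average. At least a
  fraction of about \<open>\<epsilon>\<close> of the \<open>x\<close> have this property, and the one with the largest noisy value works:
  by the tail assumption the maximum of \<open>\<epsilon>m\<close> noise variables is with high probability at least
  \<open>1/(1 + \<epsilon>)\<close> times the maximum of \<open>m\<close> of them.\<close>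

section \<open>The tail of the noise\<close>

text \<open>The size of \<open>H\<close> is a compromise. Each of the r - 2 greedy steps asks at
  most \<open>card N * card H\<close> values, so about r sqrt n elements fit the query bound r^2
  n^(3/2). For noise truncated at l, Hoeffding's exponent is of order (\<open>\<epsilon>\<close> /
  (r l))^2 |H|. With this |H|, r at most of order n^(1/3) and l = n^(1/24) it still grows like
  n^(1/12) up to logarithms, which beats a union bound over all steps and candidates. The obstacle
  is the reuse of noise: a set that was selected for its high noisy value no longer carries unbiased
  noise. A score of T therefore leaves out the terms with x in T, for which inserting x gives T
  itself, a set that may have been asked one step earlier. This gives up at most r times the optimum
  out of a total of order |H| times the optimum, and it is the source of the requirement r^2 <=
  \<open>\<epsilon>\<close> |H|. As n is exponential in a power of 1 / \<open>\<epsilon>\<close>, it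
  satisfies 1 / ln n <= \<open>\<epsilon>\<close>, so that all conditions of largeness can be put on
  n alone.\<close>

text \<open>Unconditional convergence of a real series is absolute. After division by
  \<open>x powr \<gamma> j\<close> the terms from index j on have nonpositive exponents, so their
  values at the left endpoint dominate them for all larger x, as in the Weierstrass M-test.\<close>

lemma powr_series_remainder:
  fixes c \<gamma> :: "nat \<Rightarrow> real"
  assumes "antimono \<gamma>" and "1 \<le> x\<^sub>1"
    and hs: "\<And>x. x\<^sub>1 \<le> x \<Longrightarrow> ((\<lambda>i. c i * x powr \<gamma> i) has_sum g x) UNIV"
  obtains K where "0 \<le> K"
    and "\<And>x. x\<^sub>1 \<le> x \<Longrightarrow> \<bar>g x - (\<Sum>i<j. c i * x powr \<gamma> i)\<bar> \<le> K * x powr \<gamma> j"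
proof -
  define b where "b i = \<bar>c (i + j)\<bar> * x\<^sub>1 powr (\<gamma> (i + j) - \<gamma> j)" for i
  have abs: "summable (\<lambda>i. \<bar>c i * x powr \<gamma> i\<bar>)" if "x\<^sub>1 \<le> x" for x
  proof -
    have "(\<lambda>i. c i * x powr \<gamma> i) summable_on UNIV"
      using hs[OF that] by (auto simp: summable_on_def)
    from summable_on_imp_summable[OF summable_on_iff_abs_summable_on_real[THEN iffD1, OF this]]
    show ?thesis by (simp only: real_norm_def)
  qed
  have sb: "summable b"
  proof -
    have "summable (\<lambda>i. \<bar>c (i + j) * x\<^sub>1 powr \<gamma> (i + j)\<bar> * x\<^sub>1 powr (- \<gamma> j))"
      using abs[of x\<^sub>1] by (intro summable_mult2) (simp add: summable_iff_shift[where f="\<lambda>i. \<bar>c i * x\<^sub>1 powr \<gamma> i\<bar>"])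
    moreover have "(\<lambda>i. \<bar>c (i + j) * x\<^sub>1 powr \<gamma> (i + j)\<bar> * x\<^sub>1 powr (- \<gamma> j)) = b"
      unfolding b_def abs_mult by (simp add: powr_diff powr_minus divide_inverse mult.assoc)
    ultimately show ?thesis by simp
  qed
  have b0: "0 \<le> b i" for i by (simp add: b_def)
  show ?thesis
  proof (rule that[of "suminf b"])
    show "0 \<le> suminf b" using sb b0 by (simp add: suminf_nonneg)
    fix x assume x: "x\<^sub>1 \<le> x"
    let ?u = "\<lambda>i. c (i + j) * x powr \<gamma> (i + j)"
    have "(\<lambda>i. c i * x powr \<gamma> i) sums g x" using hs[OF x] by (rule has_sum_imp_sums)
    then have S: "?u sums (g x - (\<Sum>i<j. c i * x powr \<gamma> i))"
      using sums_iff_shift[of "\<lambda>i. c i * x powr \<gamma> i" j] by simp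
    have le: "\<bar>?u i\<bar> \<le> b i * x powr \<gamma> j" for i
    proof -
      have "\<gamma> (i + j) - \<gamma> j \<le> 0" using assms(1) by (simp add: antimonoD)
      then have "x powr (\<gamma> (i + j) - \<gamma> j) \<le> x\<^sub>1 powr (\<gamma> (i + j) - \<gamma> j)"
        using x assms(2) by (intro powr_mono2') auto
      moreover have "x powr \<gamma> (i + j) = x powr (\<gamma> (i + j) - \<gamma> j) * x powr \<gamma> j"
        using x assms(2) by (simp add: powr_diff)
      ultimately show ?thesis
        by (simp add: b_def abs_mult mult.assoc mult_left_mono mult_right_mono)
    qed
    have s1: "summable (\<lambda>i. b i * x powr \<gamma> j)" using sb by (rule summable_mult2)
    have s2: "summable (\<lambda>i. \<bar>?u i\<bar>)"
      by (rule summable_comparison_test'[OF s1, of 0]) (use le in auto)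
    have "\<bar>g x - (\<Sum>i<j. c i * x powr \<gamma> i)\<bar> = \<bar>suminf ?u\<bar>"
      using sums_unique[OF S] by simp
    also have "\<dots> \<le> (\<Sum>i. \<bar>?u i\<bar>)" using s2 by (rule summable_rabs)
    also have "\<dots> \<le> (\<Sum>i. b i * x powr \<gamma> j)" using le s1 s2 by (intro suminf_le) auto
    also have "\<dots> = suminf b * x powr \<gamma> j" using sb by (simp add: suminf_mult2)
    finally show "\<bar>g x - (\<Sum>i<j. c i * x powr \<gamma> i)\<bar> \<le> suminf b * x powr \<gamma> j" .
  qed
qed

text \<open>The exponents may repeat and their coefficients may cancel, so the leading term need not be
  the first one. Reading the series from the left, every partial sum is a single power times a
  coefficient until a block of equal exponents with nonzero total coefficient ends.\<close>

lemma powr_series_leading_term: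
  fixes c \<gamma> :: "nat \<Rightarrow> real"
  assumes anti: "antimono \<gamma>" and x1: "1 \<le> x\<^sub>1"
    and hs: "\<And>x. x\<^sub>1 \<le> x \<Longrightarrow> ((\<lambda>i. c i * x powr \<gamma> i) has_sum g x) UNIV"
  shows "(\<exists>B. \<forall>x\<ge>x\<^sub>1. \<bar>g x\<bar> \<le> B) \<or>
    (\<exists>d v v' K. d \<noteq> 0 \<and> 0 \<le> v' \<and> v' < v \<and> 0 \<le> K \<and>
       (\<forall>x\<ge>x\<^sub>1. \<bar>g x - d * x powr v\<bar> \<le> K * x powr v'))" (is "?bdd \<or> ?lead")
proof (rule ccontr)
  assume neg: "\<not> (?bdd \<or> ?lead)"
  have rem: "\<exists>K\<ge>0. \<forall>x\<ge>x\<^sub>1. \<bar>g x - (\<Sum>i<j. c i * x powr \<gamma> i)\<bar> \<le> K * x powr \<gamma> j" for j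
    using powr_series_remainder[OF anti x1 hs, of j] by metis
  \<comment> \<open>For x at least 1 a power with nonpositive exponent is at most 1. A monomial
    partial sum with such an exponent and its remainder are therefore bounded, which makes
    \<open>g\<close> bounded against \<open>neg\<close>.\<close>
  have nonpos: False
    if d: "\<forall>x\<ge>x\<^sub>1. (\<Sum>i<Suc j. c i * x powr \<gamma> i) = d * x powr \<gamma> j" and "\<gamma> j \<le> 0" for j d
  proof -
    obtain K where K: "K \<ge> 0" "\<forall>x\<ge>x\<^sub>1. \<bar>g x - (\<Sum>i<Suc j. c i * x powr \<gamma> i)\<bar> \<le> K * x powr \<gamma> (Suc j)"
      using rem by blast
    have small: "\<gamma> (Suc j) \<le> 0" using \<open>\<gamma> j \<le> 0\<close> antimonoD[OF anti, of j "Suc j"] by simp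
    have "\<bar>g x\<bar> \<le> K + \<bar>d\<bar>" if x: "x\<^sub>1 \<le> x" for x
    proof -
      have p: "x powr \<gamma> j \<le> 1" "x powr \<gamma> (Suc j) \<le> 1"
        using x x1 \<open>\<gamma> j \<le> 0\<close> small powr_mono[of _ 0 x] by auto
      have "\<bar>g x\<bar> \<le> K * x powr \<gamma> (Suc j) + \<bar>d * x powr \<gamma> j\<bar>"
        using K(2) d x by (smt (verit))
      also have "\<dots> \<le> K * 1 + \<bar>d\<bar> * 1"
        unfolding abs_mult using p K(1) by (intro add_mono mult_left_mono) auto
      finally show ?thesis by simp
    qed
    then show False using neg by blast
  qed
  \<comment> \<open>A nonzero coefficient followed by a strict drop of the exponent would already be
    a leading term. Under \<open>neg\<close> each step therefore either repeats the exponent or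
    starts from a cancelled coefficient, and the partial sum stays a monomial.\<close>
  have pending: "\<exists>d. \<forall>x\<ge>x\<^sub>1. (\<Sum>i<Suc j. c i * x powr \<gamma> i) = d * x powr \<gamma> j" for j
  proof (induction j)
    case 0
    show ?case by (intro exI[of _ "c 0"]) simp
  next
    case (Suc j)
    then obtain d where d: "\<forall>x\<ge>x\<^sub>1. (\<Sum>i<Suc j. c i * x powr \<gamma> i) = d * x powr \<gamma> j" by blast
    show ?case
    proof (cases "\<gamma> (Suc j) = \<gamma> j \<or> d = 0")
      case True
      then show ?thesis
      proof
        assume "\<gamma> (Suc j) = \<gamma> j"
        then show ?thesis using d by (intro exI[of _ "d + c (Suc j)"]) (auto simp: algebra_simps)
      next
        assume "d = 0"
        then show ?thesis using d by (intro exI[of _ "c (Suc j)"]) auto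
      qed
    next
      case False
      then have lt: "\<gamma> (Suc j) < \<gamma> j" and "d \<noteq> 0"
        using antimonoD[OF anti, of j "Suc j"] by auto
      obtain K where K: "K \<ge> 0" "\<forall>x\<ge>x\<^sub>1. \<bar>g x - (\<Sum>i<Suc j. c i * x powr \<gamma> i)\<bar> \<le> K * x powr \<gamma> (Suc j)"
        using rem by blast
      have pos: "\<gamma> j > 0" using nonpos[OF d] by force
      \<comment> \<open>The error exponent has to be nonnegative; raising a negative one to 0 only
        weakens the bound, since x is at least 1.\<close>
      have "\<bar>g x - d * x powr \<gamma> j\<bar> \<le> K * x powr (max 0 (\<gamma> (Suc j)))" if x: "x\<^sub>1 \<le> x" for x
      proof -
        have "\<bar>g x - d * x powr \<gamma> j\<bar> \<le> K * x powr \<gamma> (Suc j)" using K(2) d x by metis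
        also have "\<dots> \<le> K * x powr (max 0 (\<gamma> (Suc j)))"
          using K(1) x x1 by (intro mult_left_mono powr_mono) auto
        finally show ?thesis .
      qed
      then have ?lead
        using \<open>d \<noteq> 0\<close> lt pos K(1)
        by (intro exI[of _ d] exI[of _ "\<gamma> j"] exI[of _ "max 0 (\<gamma> (Suc j))"] exI[of _ K]) auto
      then show ?thesis using neg by blast
    qed
  qed
  then obtain d where d: "\<And>j x. x\<^sub>1 \<le> x \<Longrightarrow> (\<Sum>i<Suc j. c i * x powr \<gamma> i) = d j * x powr \<gamma> j"
    by metis
  have pos: "\<gamma> j > 0" for j using nonpos[of j "d j"] d by force
  \<comment> \<open>There remains the case that no block ever ends. The positive exponents then
    decrease to a limit \<open>v\<close>, and the coefficients \<open>d j\<close>, which do not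
    depend on x, converge to g x / x^v for every x. Hence \<open>g\<close> is exactly a multiple of
    x^v: bounded if that is constant, and its own leading term otherwise.\<close>
  have "decseq \<gamma>" using anti by (simp add: decseq_def antimono_def monotone_on_def)
  then have "convergent \<gamma>" using pos
    by (intro Bseq_monoseq_convergent decseq_imp_monoseq)
       (auto intro!: BseqI'[of _ "\<gamma> 0"] simp: abs_of_pos antimonoD[OF anti])
  then obtain v where v: "\<gamma> \<longlonglongrightarrow> v" by (auto simp: convergent_def)
  have v0: "v \<ge> 0" using v pos by (intro LIMSEQ_le_const[of \<gamma> v 0]) (auto intro: less_imp_le)
  have lim: "d \<longlonglongrightarrow> g x / x powr v" if x: "x\<^sub>1 \<le> x" for x
  proof -
    have "(\<lambda>j. \<Sum>i<Suc j. c i * x powr \<gamma> i) \<longlonglongrightarrow> g x"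
      using has_sum_imp_sums[OF hs[OF x]] unfolding sums_def by (rule LIMSEQ_Suc)
    then have "(\<lambda>j. d j * x powr \<gamma> j) \<longlonglongrightarrow> g x" using d[OF x] by simp
    moreover have "(\<lambda>j. x powr \<gamma> j) \<longlonglongrightarrow> x powr v"
      using x x1 v by (intro tendsto_intros) auto
    ultimately have "(\<lambda>j. (d j * x powr \<gamma> j) / x powr \<gamma> j) \<longlonglongrightarrow> g x / x powr v"
      using x x1 by (intro tendsto_divide) auto
    then show ?thesis using x x1 by simp
  qed
  define e where "e = g x\<^sub>1 / x\<^sub>1 powr v"
  have g: "g x = e * x powr v" if x: "x\<^sub>1 \<le> x" for x
  proof -
    have "g x / x powr v = e" unfolding e_def by (rule LIMSEQ_unique[OF lim[OF x] lim[OF order_refl]])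
    then show ?thesis using x x1 by (auto simp: field_simps)
  qed
  show False
  proof (cases "e = 0 \<or> v = 0")
    case True
    then have "\<forall>x\<ge>x\<^sub>1. \<bar>g x\<bar> \<le> \<bar>e\<bar>" using g x1 by auto
    then show False using neg by blast
  next
    case False
    then have ?lead using v0 g
      by (intro exI[of _ e] exI[of _ v] exI[of _ "0::real"] exI[of _ "0::real"]) auto
    then show False using neg by blast
  qed
qed

section \<open>Tail bounds for unbounded noise\<close>

lemma has_density_onD:
  assumes "has_density_on D X \<rho>" "A \<in> sets borel" "A \<subseteq> X"
  shows "emeasure D A = (\<integral>\<^sup>+x\<in>A. ennreal (\<rho> x) \<partial>lborel)"
  using assms by (simp add: has_density_on_def)

text \<open>An interval of length 2 / s would carry mass 2. Applied with s = exp (-B), this shows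
  that the exponent \<open>g\<close> of the density cannot stay below any bound B.\<close>

lemma density_not_bounded_below:
  assumes "prob_space D" and dens: "has_density_on D {x\<^sub>0<..} \<rho>" and "x\<^sub>0 < x\<^sub>1" and "0 < s"
  shows "\<exists>x\<ge>x\<^sub>1. \<rho> x < s"
proof (rule ccontr)
  assume "\<not> ?thesis"
  then have ge: "s \<le> \<rho> x" if "x\<^sub>1 \<le> x" for x using that by force
  interpret prob_space D by fact
  define l where "l = 2 / s"
  have l: "l > 0" using \<open>0 < s\<close> by (simp add: l_def)
  have "ennreal 2 = ennreal (s * l)" using \<open>0 < s\<close> by (simp add: l_def)
  also have "\<dots> = (\<integral>\<^sup>+x\<in>{x\<^sub>1..x\<^sub>1 + l}. ennreal s \<partial>lborel)"
    using l \<open>0 < s\<close> by (simp add: nn_integral_cmult_indicator ennreal_mult)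
  also have "\<dots> \<le> (\<integral>\<^sup>+x\<in>{x\<^sub>1..x\<^sub>1 + l}. ennreal (\<rho> x) \<partial>lborel)"
    using ge by (intro nn_integral_mono) (auto simp: indicator_def ennreal_leI)
  also have "\<dots> = emeasure D {x\<^sub>1..x\<^sub>1 + l}"
    using \<open>x\<^sub>0 < x\<^sub>1\<close> by (intro has_density_onD[OF dens, symmetric]) auto
  also have "\<dots> \<le> 1" by (rule emeasure_le_1)
  finally show False by (simp add: ennreal_le_1)
qed

text \<open>Substitute x = l y in the integral over the farther tail; the factor \<open>l\<close> is
  the Jacobian.\<close>

lemma tail_ratio:
  assumes "prob_space D" and dens: "has_density_on D {x\<^sub>0<..} \<rho>" and "0 \<le> x\<^sub>0" "x\<^sub>0 \<le> t" "1 \<le> l"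
    and decay: "\<And>y. t < y \<Longrightarrow> \<rho> (l * y) \<le> q * \<rho> y" and "0 \<le> q"
  shows "measure D {l * t<..} \<le> l * q * measure D {t<..}"
proof -
  interpret prob_space D by fact
  have [measurable]: "\<rho> \<in> borel_measurable borel" and rho0: "\<And>x. 0 \<le> \<rho> x"
    using dens by (auto simp: has_density_on_def)
  have D: "emeasure D {s<..} = (\<integral>\<^sup>+x\<in>{s<..}. ennreal (\<rho> x) \<partial>lborel)" if "x\<^sub>0 \<le> s" for s
    using that by (intro has_density_onD[OF dens]) auto
  have "x\<^sub>0 \<le> l * t" using assms mult_mono[of 1 l t t] by auto
  then have "emeasure D {l * t<..} = (\<integral>\<^sup>+x. ennreal (\<rho> x) * indicator {l * t<..} x \<partial>lborel)"
    by (rule D)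
  also have "\<dots> = ennreal \<bar>l\<bar> * (\<integral>\<^sup>+x. ennreal (\<rho> (0 + l * x)) * indicator {l * t<..} (0 + l * x) \<partial>lborel)"
    using \<open>1 \<le> l\<close> by (intro nn_integral_real_affine) auto
  also have "\<dots> \<le> ennreal \<bar>l\<bar> * (\<integral>\<^sup>+x. ennreal q * (ennreal (\<rho> x) * indicator {t<..} x) \<partial>lborel)"
    using \<open>1 \<le> l\<close> \<open>0 \<le> q\<close> rho0 decay
    by (intro mult_left_mono nn_integral_mono)
       (auto simp: indicator_def ennreal_mult[symmetric] intro!: ennreal_leI)
  also have "\<dots> = ennreal \<bar>l\<bar> * (ennreal q * emeasure D {t<..})"
    using D[OF \<open>x\<^sub>0 \<le> t\<close>] by (simp add: nn_integral_cmult)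
  finally have "ennreal (measure D {l * t<..}) \<le> ennreal (l * q * measure D {t<..})"
    using \<open>1 \<le> l\<close> \<open>0 \<le> q\<close> by (simp add: emeasure_eq_measure ennreal_mult mult.assoc)
  then show ?thesis using \<open>1 \<le> l\<close> \<open>0 \<le> q\<close> by (subst (asm) ennreal_le_iff) auto
qed


text \<open>The finite mass of the density decides which alternative of the series lemma occurs: a
  bounded \<open>g\<close> and a negative leading coefficient would both keep the density above a
  positive constant on a half-line.\<close>

lemma exponential_tail_leading_term:
  assumes "prob_space D" and dens: "has_density_on D {x\<^sub>0<..} \<rho>" and "0 \<le> x\<^sub>0"
    and anti: "antimono (\<gamma> :: nat \<Rightarrow> real)"
    and rho: "\<And>x. x\<^sub>0 < x \<Longrightarrow> \<rho> x = exp (- g x)"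
    and hs: "\<And>x. x\<^sub>0 < x \<Longrightarrow> ((\<lambda>i. c i * x powr \<gamma> i) has_sum g x) UNIV"
  obtains C v v' K x\<^sub>1 where "0 < C" "0 \<le> v'" "v' < v" "0 \<le> K" "x\<^sub>0 < x\<^sub>1" "1 \<le> x\<^sub>1"
    "\<And>x. x\<^sub>1 \<le> x \<Longrightarrow> \<bar>g x - C * x powr v\<bar> \<le> K * x powr v'"
proof -
  define x\<^sub>1 where "x\<^sub>1 = x\<^sub>0 + 1"
  have x1: "x\<^sub>0 < x\<^sub>1" "1 \<le> x\<^sub>1" using \<open>0 \<le> x\<^sub>0\<close> by (auto simp: x\<^sub>1_def)
  have unbounded: False if "x\<^sub>1 \<le> y" "\<And>x. y \<le> x \<Longrightarrow> g x \<le> B" for B y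
  proof -
    have "x\<^sub>0 < y" using that x1 by simp
    from density_not_bounded_below[OF assms(1) dens this, of "exp (- B)"]
    obtain x where "y \<le> x" "\<rho> x < exp (- B)" by auto
    then show False using that(2)[of x] rho[of x] \<open>x\<^sub>0 < y\<close> by simp
  qed
  have "\<not> (\<exists>B. \<forall>x\<ge>x\<^sub>1. \<bar>g x\<bar> \<le> B)" using unbounded[OF order_refl] by (metis abs_le_D1)
  moreover have "((\<lambda>i. c i * x powr \<gamma> i) has_sum g x) UNIV" if "x\<^sub>1 \<le> x" for x
    using that x1 hs by simp
  ultimately obtain d v v' K where lead: "d \<noteq> 0" "0 \<le> v'" "v' < v" "0 \<le> K"
    "\<forall>x\<ge>x\<^sub>1. \<bar>g x - d * x powr v\<bar> \<le> K * x powr v'"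
    using powr_series_leading_term[OF anti x1(2), of c g] by blast
  have "0 < d"
  proof (rule ccontr)
    assume "\<not> 0 < d"
    then have d: "d < 0" using lead(1) by simp
    \<comment> \<open>With a negative coefficient the main term outgrows the error of lower
      exponent, so that \<open>g\<close> is eventually at most 0 and the density at least 1.\<close>
    have "filterlim (\<lambda>x::real. x powr (v - v')) at_top at_top" using lead(3) by real_asymp
    then have "eventually (\<lambda>x. K / (- d) \<le> x powr (v - v')) at_top"
      by (simp add: filterlim_at_top)
    then obtain y where y: "\<And>x. y \<le> x \<Longrightarrow> K / (- d) \<le> x powr (v - v')"
      by (auto simp: eventually_at_top_linorder)
    have "g x \<le> 0" if "max x\<^sub>1 y \<le> x" for x
    proof -
      have "x > 0" using that x1 by simp
      have "K / (- d) \<le> x powr v / x powr v'" using y[of x] that by (simp add: powr_diff)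
      then have "K * x powr v' \<le> - d * x powr v" using d \<open>x > 0\<close> by (simp add: field_simps)
      moreover have "\<bar>g x - d * x powr v\<bar> \<le> K * x powr v'" using lead(5) that by simp
      ultimately show ?thesis by linarith
    qed
    then show False by (intro unbounded[of "max x\<^sub>1 y" 0]) auto
  qed
  then show ?thesis using lead x1 that by blast
qed

text \<open>A substitute for Bernoulli's inequality that also covers exponents below 1, at the price
  of the factor 1/2. It rests on \<open>ln (1 + \<epsilon>)\<close> being at least
  \<open>\<epsilon> / 2\<close> on the unit interval.\<close>

lemma powr_one_plus_ge:
  fixes v :: real
  assumes "0 < \<epsilon>" "\<epsilon> \<le> 1" "0 \<le> v"
  shows "1 + v * \<epsilon> / 2 \<le> (1 + \<epsilon>) powr v"
proof -
  have "ln (1 / (1 + \<epsilon>)) \<le> 1 / (1 + \<epsilon>) - 1" using assms by (intro ln_le_minus_one) auto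
  then have "\<epsilon> / (1 + \<epsilon>) \<le> ln (1 + \<epsilon>)" using assms by (simp add: ln_div field_simps)
  moreover have "\<epsilon> / 2 \<le> \<epsilon> / (1 + \<epsilon>)" using assms by (intro divide_left_mono) auto
  ultimately have "\<epsilon> / 2 \<le> ln (1 + \<epsilon>)" by linarith
  then have "v * (\<epsilon> / 2) \<le> v * ln (1 + \<epsilon>)" using assms(3) by (rule mult_left_mono)
  then have "1 + v * \<epsilon> / 2 \<le> 1 + v * ln (1 + \<epsilon>)" by simp
  also have "\<dots> \<le> exp (v * ln (1 + \<epsilon>))" by (rule exp_ge_add_one_self)
  finally show ?thesis using assms by (simp add: powr_def)
qed

text \<open>The lower bound is the mass of the interval from t to 2t, on which \<open>g\<close> is
  at most A t^v. For the upper bound, passing from y to \<open>(1 + \<epsilon>) * y\<close> raises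
  the main term of \<open>g\<close> by an amount of order \<open>\<epsilon>\<close> y^v, while the
  error terms are of order y^v'. The condition on \<open>\<kappa>\<close>, with u = v - v', says
  that the gain dominates the errors. The factor 2 bounds the Jacobian
  \<open>1 + \<epsilon>\<close>.\<close>

lemma exponential_tail_bounds:
  assumes "prob_space D" and dens: "has_density_on D {x\<^sub>0<..} \<rho>" and "0 \<le> x\<^sub>0"
    and anti: "antimono (\<gamma> :: nat \<Rightarrow> real)"
    and rho: "\<And>x. x\<^sub>0 < x \<Longrightarrow> \<rho> x = exp (- g x)"
    and hs: "\<And>x. x\<^sub>0 < x \<Longrightarrow> ((\<lambda>i. c i * x powr \<gamma> i) has_sum g x) UNIV"
  obtains b A \<kappa> v u x\<^sub>1 where "0 < b" "0 < A" "0 < u" "u \<le> v" "x\<^sub>0 < x\<^sub>1" "1 \<le> x\<^sub>1"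
    "\<And>t. x\<^sub>1 \<le> t \<Longrightarrow> exp (- A * t powr v) \<le> measure D {t<..}"
    "\<And>t \<epsilon>. x\<^sub>1 \<le> t \<Longrightarrow> 0 < \<epsilon> \<Longrightarrow> \<epsilon> \<le> 1 \<Longrightarrow> \<kappa> \<le> \<epsilon> * t powr u \<Longrightarrow>
       measure D {(1 + \<epsilon>) * t<..} \<le> 2 * exp (- b * \<epsilon> * t powr v) * measure D {t<..}"
proof -
  interpret prob_space D by fact
  obtain C v v' K x\<^sub>1 where lead: "0 < C" "0 \<le> v'" "v' < v" "0 \<le> K" "x\<^sub>0 < x\<^sub>1" "1 \<le> x\<^sub>1"
    and g: "\<And>x. x\<^sub>1 \<le> x \<Longrightarrow> \<bar>g x - C * x powr v\<bar> \<le> K * x powr v'"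
    using exponential_tail_leading_term[OF assms] by metis
  define A where "A = (C + K) * 2 powr v"
  define K2 where "K2 = K * (2 powr v' + 1)"
  \<comment> \<open>The gain of the main term is at least C v \<open>\<epsilon>\<close> / 2 times
    y^v, that is 2 b \<open>\<epsilon>\<close> y^v. One half pays for the errors, the other half
    remains as decay.\<close>
  define b where "b = C * v / 4"
  have v: "0 < v" using lead by simp
  have lower: "exp (- A * t powr v) \<le> measure D {t<..}" if t: "x\<^sub>1 \<le> t" for t
  proof -
    have t1: "1 \<le> t" using t lead by simp
    have le: "g x \<le> A * t powr v" if x: "t < x" "x \<le> 2 * t" for x
    proof -
      have "g x \<le> C * x powr v + K * x powr v'" using g[of x] t x by (simp add: abs_le_iff)
      also have "\<dots> \<le> C * x powr v + K * x powr v"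
        using lead t1 x by (intro add_mono mult_left_mono powr_mono) auto
      also have "\<dots> = (C + K) * x powr v" by (simp add: algebra_simps)
      also have "\<dots> \<le> (C + K) * (2 * t) powr v"
        using lead t1 x by (intro mult_left_mono powr_mono2) auto
      finally show ?thesis using t1 by (simp add: A_def powr_mult)
    qed
    have "ennreal (exp (- A * t powr v)) \<le> ennreal (exp (- A * t powr v) * t)"
      using t1 by (intro ennreal_leI) simp
    also have "\<dots> = (\<integral>\<^sup>+x\<in>{t<..2 * t}. ennreal (exp (- A * t powr v)) \<partial>lborel)"
      using t1 by (simp add: nn_integral_cmult_indicator ennreal_mult)
    also have "\<dots> \<le> (\<integral>\<^sup>+x\<in>{t<..2 * t}. ennreal (\<rho> x) \<partial>lborel)"
      using le rho t lead by (intro nn_integral_mono) (auto simp: indicator_def intro!: ennreal_leI)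
    also have "\<dots> \<le> (\<integral>\<^sup>+x\<in>{t<..}. ennreal (\<rho> x) \<partial>lborel)"
      by (intro nn_integral_mono) (auto simp: indicator_def)
    also have "\<dots> = emeasure D {t<..}"
      using t lead by (intro has_density_onD[OF dens, symmetric]) auto
    finally show ?thesis by (simp add: emeasure_eq_measure)
  qed
  have upper: "measure D {(1 + \<epsilon>) * t<..} \<le> 2 * exp (- b * \<epsilon> * t powr v) * measure D {t<..}"
    if t: "x\<^sub>1 \<le> t" and e: "0 < \<epsilon>" "\<epsilon> \<le> 1" and kappa: "K2 / b \<le> \<epsilon> * t powr (v - v')" for t \<epsilon>
  proof -
    have b: "0 < b" using lead v by (simp add: b_def)
    have decay: "\<rho> ((1 + \<epsilon>) * y) \<le> exp (- b * \<epsilon> * t powr v) * \<rho> y" if y: "t < y" for y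
    proof -
      have y1: "1 \<le> y" "x\<^sub>1 \<le> y" "x\<^sub>1 \<le> (1 + \<epsilon>) * y"
        using y t lead e by (auto simp: algebra_simps add_increasing2)
      have p: "((1 + \<epsilon>) * y) powr w = (1 + \<epsilon>) powr w * y powr w" for w
        using y1 e by (simp add: powr_mult)
      have "(1 + \<epsilon>) powr v' \<le> 2 powr v'" using e lead by (intro powr_mono2) auto
      then have "K * ((1 + \<epsilon>) powr v' + 1) * y powr v' \<le> K2 * y powr v'"
        unfolding K2_def using lead by (intro mult_right_mono mult_left_mono) auto
      also have "\<dots> \<le> (b * (\<epsilon> * y powr (v - v'))) * y powr v'"
      proof -
        have "K2 \<le> b * (\<epsilon> * t powr (v - v'))" using kappa b by (simp add: field_simps)
        also have "\<dots> \<le> b * (\<epsilon> * y powr (v - v'))"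
          using b e y t lead by (intro mult_left_mono powr_mono2) auto
        finally show ?thesis by (intro mult_right_mono) auto
      qed
      also have "\<dots> = b * \<epsilon> * y powr v" using y1 by (simp add: powr_diff)
      finally have err: "K * ((1 + \<epsilon>) powr v' + 1) * y powr v' \<le> b * \<epsilon> * y powr v" .
      have "2 * b * \<epsilon> * y powr v = C * (v * \<epsilon> / 2) * y powr v" by (simp add: b_def)
      also have "\<dots> \<le> C * ((1 + \<epsilon>) powr v - 1) * y powr v"
        using powr_one_plus_ge[OF e, of v] v lead by (intro mult_right_mono mult_left_mono) auto
      finally have main: "2 * b * \<epsilon> * y powr v \<le> C * ((1 + \<epsilon>) powr v - 1) * y powr v" .
      have 1: "g y \<le> C * y powr v + K * y powr v'"
        using g[OF y1(2)] by (simp add: abs_le_iff)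
      have 2: "C * ((1 + \<epsilon>) * y) powr v - K * ((1 + \<epsilon>) * y) powr v' \<le> g ((1 + \<epsilon>) * y)"
        using g[OF y1(3)] by (simp add: abs_le_iff)
      have "b * \<epsilon> * y powr v \<le> g ((1 + \<epsilon>) * y) - g y"
        using 1 2 main err unfolding p by (simp add: algebra_simps)
      moreover have "b * \<epsilon> * t powr v \<le> b * \<epsilon> * y powr v"
        using b e y t lead v by (intro mult_left_mono powr_mono2) auto
      ultimately have "- g ((1 + \<epsilon>) * y) \<le> - b * \<epsilon> * t powr v + (- g y)" by simp
      then have "exp (- g ((1 + \<epsilon>) * y)) \<le> exp (- b * \<epsilon> * t powr v) * exp (- g y)"
        by (simp add: exp_add[symmetric])
      moreover have "x\<^sub>0 < (1 + \<epsilon>) * y" "x\<^sub>0 < y" using y1 lead by auto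
      ultimately show ?thesis using rho by simp
    qed
    have "measure D {(1 + \<epsilon>) * t<..} \<le> (1 + \<epsilon>) * exp (- b * \<epsilon> * t powr v) * measure D {t<..}"
      using decay t e lead \<open>0 \<le> x\<^sub>0\<close>
      by (intro tail_ratio[OF assms(1) dens, of t "1 + \<epsilon>"]) auto
    also have "\<dots> \<le> 2 * exp (- b * \<epsilon> * t powr v) * measure D {t<..}"
      using e by (intro mult_right_mono) auto
    finally show ?thesis .
  qed
  show ?thesis
    by (rule that[of b A "v - v'" v x\<^sub>1 "K2 / b"]) (use lead v lower upper in \<open>auto simp: b_def A_def intro!: mult_pos_pos add_pos_nonneg\<close>)
qed


text \<open>This is the only property of the tail that matters for selecting the final set: the largest
  of \<open>m\<close> noise values is with high probability at most \<open>(1 + \<epsilon>) t\<close>, whereas already a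
  small fraction of them contains a value that is at least \<open>t\<close>.\<close>

definition concentrated_maxima :: "real measure \<Rightarrow> bool" where
  "concentrated_maxima D \<longleftrightarrow> (\<exists>k>0. \<exists>m\<^sub>0. \<forall>\<epsilon> m. 0 < \<epsilon> \<longrightarrow> \<epsilon> \<le> 1 \<longrightarrow> m\<^sub>0 \<le> m \<longrightarrow>
     (1 / \<epsilon>) powr k \<le> ln m \<longrightarrow>
     (\<exists>t>0. m * measure D {(1 + \<epsilon>) * t<..} \<le> 1 / ln m \<and> (ln m)\<^sup>2 \<le> m * measure D {t..}))"

text \<open>The upper bound with \<open>\<epsilon> = 1\<close> at x / 2 already gives decay like exp
  (- b (x/2)^v), faster than every power.\<close>

lemma exponential_tail_polynomial_bound:
  assumes "prob_space D" and dens: "has_density_on D {x\<^sub>0<..} \<rho>" and "0 \<le> x\<^sub>0"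
    and anti: "antimono (\<gamma> :: nat \<Rightarrow> real)"
    and rho: "\<And>x. x\<^sub>0 < x \<Longrightarrow> \<rho> x = exp (- g x)"
    and hs: "\<And>x. x\<^sub>0 < x \<Longrightarrow> ((\<lambda>i. c i * x powr \<gamma> i) has_sum g x) UNIV"
  shows "eventually (\<lambda>x. measure D {x<..} \<le> x powr (- q)) at_top"
proof -
  interpret prob_space D by fact
  obtain b A \<kappa> v u x\<^sub>1 where b: "0 < b" "0 < u" "u \<le> v" and
    upper: "\<And>t \<epsilon>. x\<^sub>1 \<le> t \<Longrightarrow> 0 < \<epsilon> \<Longrightarrow> \<epsilon> \<le> 1 \<Longrightarrow> \<kappa> \<le> \<epsilon> * t powr u \<Longrightarrow>
       measure D {(1 + \<epsilon>) * t<..} \<le> 2 * exp (- b * \<epsilon> * t powr v) * measure D {t<..}"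
    using exponential_tail_bounds[OF assms] by metis
  have v: "0 < v" using b by simp
  have "eventually (\<lambda>x. x\<^sub>1 \<le> x / 2) at_top" by real_asymp
  moreover have "filterlim (\<lambda>x::real. (x / 2) powr u) at_top at_top" using b(2) by real_asymp
  then have "eventually (\<lambda>x. \<kappa> \<le> (x / 2) powr u) at_top" by (simp add: filterlim_at_top)
  moreover have "eventually (\<lambda>x. 2 * exp (- b * (x / 2) powr v) \<le> x powr (- q)) at_top"
    using b(1) v by real_asymp
  ultimately show ?thesis
  proof eventually_elim
    case (elim x)
    have "measure D {x<..} \<le> 2 * exp (- b * (x / 2) powr v) * measure D {x / 2<..}"
      using upper[of "x / 2" 1] elim by simp
    also have "\<dots> \<le> 2 * exp (- b * (x / 2) powr v) * 1"
      by (intro mult_left_mono) auto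
    finally show ?case using elim by simp
  qed
qed

text \<open>Take for t the exact quantile with tail probability (ln m)^2 / m. The lower tail bound
  shows that t^v is at least of order ln m, and then the upper one shrinks the tail at
  \<open>(1 + \<epsilon>) * t\<close> by exp (- const * \<open>\<epsilon>\<close> ln m), which
  absorbs (ln m)^2.\<close>

lemma exponential_tail_concentrated_maxima:
  assumes "prob_space D" and sets: "sets D = sets borel"
    and dens: "has_density_on D {x\<^sub>0<..} \<rho>" and "0 \<le> x\<^sub>0"
    and anti: "antimono (\<gamma> :: nat \<Rightarrow> real)"
    and rho: "\<And>x. x\<^sub>0 < x \<Longrightarrow> \<rho> x = exp (- g x)"
    and hs: "\<And>x. x\<^sub>0 < x \<Longrightarrow> ((\<lambda>i. c i * x powr \<gamma> i) has_sum g x) UNIV"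
  shows "concentrated_maxima D"
proof -
  interpret prob_space D by fact
  interpret real_distribution D
    using sets by unfold_locales (auto simp: sets_eq_imp_space_eq)
  obtain b A \<kappa> v u x\<^sub>1 where b: "0 < b" "0 < A" "0 < u" "u \<le> v" "x\<^sub>0 < x\<^sub>1" "1 \<le> x\<^sub>1" and
    lower: "\<And>t. x\<^sub>1 \<le> t \<Longrightarrow> exp (- A * t powr v) \<le> measure D {t<..}" and
    upper: "\<And>t \<epsilon>. x\<^sub>1 \<le> t \<Longrightarrow> 0 < \<epsilon> \<Longrightarrow> \<epsilon> \<le> 1 \<Longrightarrow> \<kappa> \<le> \<epsilon> * t powr u \<Longrightarrow>
       measure D {(1 + \<epsilon>) * t<..} \<le> 2 * exp (- b * \<epsilon> * t powr v) * measure D {t<..}"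
    using exponential_tail_bounds[OF assms(1,3-)] by metis
  have v: "0 < v" using b by simp
  \<comment> \<open>Two demands meet here. From (1 / \<open>\<epsilon>\<close>)^k <= ln m, k >= 2
    gives \<open>\<epsilon>\<close> ln m >= sqrt (ln m). Moreover 1 / k is half of u / v, so
    \<open>\<epsilon>\<close> t^u keeps a factor (ln m)^(u / (2 v)), which eventually exceeds
    \<open>\<kappa>\<close>.\<close>
  define k where "k = 2 * v / u"
  have k: "2 \<le> k" using b v by (simp add: k_def field_simps)
  have tail: "measure D {x<..} = 1 - cdf D x" for x
  proof -
    have "measure D {x<..} = measure D (space D - {..x})" by (intro arg_cong[where f="measure D"]) auto
    then show ?thesis using prob_compl[of "{..x}"] by (simp add: cdf_def)
  qed
  have cont: "isCont (cdf D) x" if "x\<^sub>1 \<le> x" for x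
  proof -
    have "emeasure D {x} = (\<integral>\<^sup>+y\<in>{x}. ennreal (\<rho> y) \<partial>lborel)"
      using that b by (intro has_density_onD[OF dens]) auto
    also have "\<dots> = 0" by (intro nn_integral_null_set) auto
    finally show ?thesis by (simp add: isCont_cdf emeasure_eq_measure)
  qed
  have q0: "0 < measure D {x\<^sub>1<..}" using lower[of x\<^sub>1] by (meson exp_gt_zero less_le_trans order_refl)
  \<comment> \<open>The lower bound for t^v at the quantile is (ln m - 2 ln (ln m)) / A; giving up
    half of ln m removes the iterated logarithm.\<close>
  define R where "R m = ln m / (2 * A)" for m
  have "eventually (\<lambda>m. (ln m)\<^sup>2 / m \<le> measure D {x\<^sub>1<..}) at_top" using q0 by real_asymp
  moreover have "eventually (\<lambda>m. R m \<le> (ln m - 2 * ln (ln m)) / A) at_top"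
    unfolding R_def using b(2) by real_asymp
  moreover have "filterlim (\<lambda>m. (ln m) powr (u / v / 2) * (1 / (2 * A)) powr (u / v)) at_top at_top"
    using b(2,3) v by real_asymp
  then have "eventually (\<lambda>m. \<kappa> \<le> (ln m) powr (u / v / 2) * (1 / (2 * A)) powr (u / v)) at_top"
    by (simp add: filterlim_at_top)
  moreover have "eventually (\<lambda>m::real. 2 * (ln m)\<^sup>2 * exp (- (b / (2 * A)) * (ln m) powr (1/2)) \<le> 1 / ln m) at_top"
    using b(1,2) by real_asymp
  moreover have "eventually (\<lambda>m::real. 3 \<le> m) at_top" by real_asymp
  ultimately have "eventually (\<lambda>m. \<forall>\<epsilon>. 0 < \<epsilon> \<longrightarrow> \<epsilon> \<le> 1 \<longrightarrow> (1 / \<epsilon>) powr k \<le> ln m \<longrightarrow>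
     (\<exists>t>0. m * measure D {(1 + \<epsilon>) * t<..} \<le> 1 / ln m \<and> (ln m)\<^sup>2 \<le> m * measure D {t..})) at_top"
  proof eventually_elim
    case (elim m)
    show ?case
    proof (intro allI impI)
      fix \<epsilon> :: real assume e: "0 < \<epsilon>" "\<epsilon> \<le> 1" "(1 / \<epsilon>) powr k \<le> ln m"
      have m: "3 \<le> m" "0 < m" using elim by auto
      have ln1: "1 \<le> ln m" using m ln3_gt_1 ln_mono[of 3 m] by linarith
      define q where "q = (ln m)\<^sup>2 / m"
      have q: "0 < q" "q \<le> measure D {x\<^sub>1<..}" using ln1 m elim by (auto simp: q_def)
      \<comment> \<open>The density excludes atoms in this range, so the distribution function is
        continuous and takes the value 1 - q exactly.\<close>
      have "(cdf D \<longlongrightarrow> 1) at_top" by (rule cdf_lim_at_top_prob)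
      then have "eventually (\<lambda>x. 1 - q < cdf D x) at_top" using q by (intro order_tendstoD) auto
      then obtain y where y: "x\<^sub>1 \<le> y" "1 - q < cdf D y"
        by (metis eventually_at_top_linorder max.cobounded1 max.cobounded2)
      have "\<exists>t\<ge>x\<^sub>1. t \<le> y \<and> cdf D t = 1 - q"
        using y q tail[of x\<^sub>1] cont
        by (intro IVT) (auto)
      then obtain t where t: "x\<^sub>1 \<le> t" and Tt: "measure D {t<..} = q" by (auto simp: tail)
      have t1: "1 \<le> t" using t b by simp
      have "- A * t powr v \<le> ln q"
        using lower[OF t] q Tt by (simp add: ln_ge_iff)
      also have "ln q = 2 * ln (ln m) - ln m" using ln1 m by (simp add: q_def ln_div ln_realpow)
      finally have "(ln m - 2 * ln (ln m)) / A \<le> t powr v" using b by (simp add: field_simps)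
      then have tv: "R m \<le> t powr v" using elim by simp
      have "1 / \<epsilon> = ((1 / \<epsilon>) powr k) powr (1 / k)" using e k by (simp add: powr_powr)
      also have "\<dots> \<le> (ln m) powr (1 / k)" using e k by (intro powr_mono2) auto
      finally have ei: "1 / \<epsilon> \<le> (ln m) powr (1 / k)" .
      also have "\<dots> \<le> (ln m) powr (1 / 2)" using ln1 k by (intro powr_mono) (auto simp: field_simps)
      finally have eh: "1 / \<epsilon> \<le> (ln m) powr (1 / 2)" .
      have "\<kappa> \<le> (ln m) powr (u / v / 2) * (1 / (2 * A)) powr (u / v)" using elim by simp
      also have "\<dots> \<le> \<epsilon> * (R m) powr (u / v)"
      proof -
        have "(R m) powr (u / v) = (ln m) powr (u / v) * (1 / (2 * A)) powr (u / v)"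
          unfolding R_def using ln1 b powr_mult[of "ln m" "1 / (2 * A)" "u / v"] by simp
        moreover have "(ln m) powr (u / v) = (ln m) powr (1 / k) * (ln m) powr (u / v / 2)"
          by (simp add: powr_add[symmetric] k_def)
        moreover have "1 \<le> \<epsilon> * (ln m) powr (1 / k)" using ei e by (simp add: field_simps)
        ultimately show ?thesis
          using mult_right_mono[of 1 "\<epsilon> * (ln m) powr (1 / k)" "(ln m) powr (u / v / 2) * (1 / (2 * A)) powr (u / v)"]
          by (simp add: mult_ac)
      qed
      also have "\<dots> \<le> \<epsilon> * (t powr v) powr (u / v)"
        using tv e b v ln1 by (intro mult_left_mono powr_mono2) (auto simp: R_def)
      also have "\<dots> = \<epsilon> * t powr u" using v by (simp add: powr_powr)
      finally have kap: "\<kappa> \<le> \<epsilon> * t powr u" .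
      have "(ln m) powr (1 / 2) * (ln m) powr (1 / 2) = ln m" using ln1 by (simp add: powr_add[symmetric])
      moreover have "1 \<le> \<epsilon> * (ln m) powr (1 / 2)" using eh e by (simp add: field_simps)
      ultimately have eln: "(ln m) powr (1 / 2) \<le> \<epsilon> * ln m"
        using mult_right_mono[of 1 "\<epsilon> * (ln m) powr (1 / 2)" "(ln m) powr (1 / 2)"] by (simp add: mult.assoc)
      have "b / (2 * A) * (ln m) powr (1 / 2) \<le> b / (2 * A) * (\<epsilon> * ln m)"
        using eln b by (intro mult_left_mono) auto
      also have "\<dots> = b * \<epsilon> * R m" by (simp add: R_def)
      also have "\<dots> \<le> b * \<epsilon> * t powr v" using tv b e by (intro mult_left_mono) auto
      finally have ex: "- b * \<epsilon> * t powr v \<le> - (b / (2 * A)) * (ln m) powr (1 / 2)" by simp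
      have "m * measure D {(1 + \<epsilon>) * t<..} \<le> m * (2 * exp (- b * \<epsilon> * t powr v) * q)"
        using upper[OF t e(1,2) kap] m Tt by (intro mult_left_mono) auto
      also have "\<dots> = 2 * (ln m)\<^sup>2 * exp (- b * \<epsilon> * t powr v)" using m by (simp add: q_def)
      also have "\<dots> \<le> 2 * (ln m)\<^sup>2 * exp (- (b / (2 * A)) * (ln m) powr (1 / 2))"
        using ex by (intro mult_left_mono) auto
      also have "\<dots> \<le> 1 / ln m" using elim by simp
      finally have "m * measure D {(1 + \<epsilon>) * t<..} \<le> 1 / ln m" .
      moreover have "(ln m)\<^sup>2 = m * measure D {t<..}" using m Tt by (simp add: q_def)
      then have "(ln m)\<^sup>2 \<le> m * measure D {t..}"
        using m by (auto intro!: mult_left_mono finite_measure_mono)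
      ultimately show "\<exists>t>0. m * measure D {(1 + \<epsilon>) * t<..} \<le> 1 / ln m \<and> (ln m)\<^sup>2 \<le> m * measure D {t..}"
        using t1 by (intro exI[of _ t]) auto
    qed
  qed
  then obtain m\<^sub>0 where "\<And>m. m\<^sub>0 \<le> m \<Longrightarrow> \<forall>\<epsilon>. 0 < \<epsilon> \<longrightarrow> \<epsilon> \<le> 1 \<longrightarrow> (1 / \<epsilon>) powr k \<le> ln m \<longrightarrow>
     (\<exists>t>0. m * measure D {(1 + \<epsilon>) * t<..} \<le> 1 / ln m \<and> (ln m)\<^sup>2 \<le> m * measure D {t..})"
    by (auto simp: eventually_at_top_linorder)
  then show ?thesis
    unfolding concentrated_maxima_def using k by (intro exI[of _ k] exI[of _ m\<^sub>0]) auto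
qed


section \<open>Noise with bounded support\<close>

text \<open>Each point outside the support has a null ball around it. Uncountably many of them may
  be involved, and the Lindelof property reduces them to countably many.\<close>

lemma emeasure_disjoint_support_eq_0:
  assumes "prob_space D" and sets: "sets D = sets borel" and "open U" and disj: "U \<inter> support D = {}"
  shows "emeasure D U = 0"
proof -
  interpret prob_space D by fact
  define \<F> where "\<F> = {B. \<exists>x e. B = ball x e \<and> 0 < e \<and> measure D B = 0}"
  obtain \<F>' where F': "\<F>' \<subseteq> \<F>" "countable \<F>'" "\<Union>\<F>' = \<Union>\<F>"
    by (rule Lindelof[of \<F>]) (auto simp: \<F>_def)
  have "\<exists>e>0. measure D (ball x e) = 0" if "x \<in> U" for x
    using that disj measure_nonneg[of D] by (force simp: support_def not_less intro: antisym)
  then have "U \<subseteq> \<Union>\<F>" unfolding \<F>_def by (force intro: centre_in_ball[THEN iffD2])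
  moreover have "(\<Union>B\<in>\<F>'. B) \<in> null_sets D"
    using F' sets by (intro null_sets_UN') (auto simp: \<F>_def null_sets_def emeasure_eq_measure)
  ultimately have "U \<subseteq> (\<Union>B\<in>\<F>'. B)" "(\<Union>B\<in>\<F>'. B) \<in> null_sets D" using F'(3) by auto
  then have "U \<in> null_sets D" using \<open>open U\<close> sets by (intro null_sets_subset[of "\<Union>B\<in>\<F>'. B" D U]) auto
  then show ?thesis by auto
qed

text \<open>The mean 1 forces the supremum to be positive, without which scaling it by
  \<open>1 + \<epsilon>\<close> would be meaningless.\<close>

lemma bounded_support_Sup:
  assumes "prob_space D" and sets: "sets D = sets borel" and bdd: "bounded (support D)"
    and int: "integrable D (\<lambda>x. x)" and mean: "(\<integral>x. x \<partial>D) = 1"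
  shows "measure D {Sup (support D)<..} = 0" and "1 \<le> Sup (support D)"
proof -
  interpret prob_space D by fact
  have sp: "space D = UNIV" using sets by (simp add: sets_eq_imp_space_eq)
  let ?B = "Sup (support D)"
  have "bdd_above (support D)" using bdd by (rule bounded_imp_bdd_above)
  then have "{?B<..} \<inter> support D = {}" using cSup_upper[of _ "support D"] by force
  then have em: "emeasure D {?B<..} = 0"
    by (intro emeasure_disjoint_support_eq_0[OF assms(1) sets]) auto
  then show "measure D {?B<..} = 0" by (simp add: measure_def)
  have "AE x in D. x \<le> ?B"
    using em sets by (intro AE_I[where N="{?B<..}"]) auto
  then have "(\<integral>x. x \<partial>D) \<le> (\<integral>x. ?B \<partial>D)" using int by (intro integral_mono_AE) auto
  then show "1 \<le> ?B" using mean by (simp add: prob_space)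
qed

text \<open>With t = B / \<open>(1 + \<epsilon>)\<close> no value exceeds
  \<open>(1 + \<epsilon>) * t\<close>. An atom at B, or a density bounded away from 0 below B, gives
  the values from t on a mass of at least c \<open>\<epsilon>\<close>, hence at least c / ln m,
  which is far more than (ln m)^2 / m.\<close>

lemma bounded_support_concentrated_maxima:
  assumes "prob_space D" and sets: "sets D = sets borel"
    and null: "measure D {B<..} = 0" and "0 < B"
    and top: "measure D {B} > 0 \<or>
        (\<exists>\<rho>. \<exists>\<delta>>0. has_density_on D {B - \<delta> .. B} \<rho> \<and> (\<rho> \<longlongrightarrow> \<rho> B) (at_left B) \<and> \<rho> B \<noteq> 0)"
  shows "concentrated_maxima D"
proof -
  interpret prob_space D by fact
  have "\<exists>c>0. \<forall>\<epsilon>. 0 < \<epsilon> \<longrightarrow> \<epsilon> \<le> 1 \<longrightarrow> c * \<epsilon> \<le> measure D {B / (1 + \<epsilon>)..}"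
    using top
  proof
    assume pos: "measure D {B} > 0"
    have "measure D {B} * \<epsilon> \<le> measure D {B / (1 + \<epsilon>)..}" if "0 < \<epsilon>" "\<epsilon> \<le> 1" for \<epsilon>
    proof -
      have "measure D {B} * \<epsilon> \<le> measure D {B}" using pos that by (simp add: mult_left_le)
      also have "\<dots> \<le> measure D {B / (1 + \<epsilon>)..}"
        using sets that \<open>0 < B\<close> by (intro finite_measure_mono) (auto simp: field_simps)
      finally show ?thesis .
    qed
    then show ?thesis using pos by blast
  next
    assume "\<exists>\<rho>. \<exists>\<delta>>0. has_density_on D {B - \<delta> .. B} \<rho> \<and> (\<rho> \<longlongrightarrow> \<rho> B) (at_left B) \<and> \<rho> B \<noteq> 0"
    then obtain \<rho> \<delta> where "\<delta> > 0" and dens: "has_density_on D {B - \<delta> .. B} \<rho>"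
      and lim: "(\<rho> \<longlongrightarrow> \<rho> B) (at_left B)" and "\<rho> B \<noteq> 0" by blast
    then have pos: "0 < \<rho> B" by (metis has_density_on_def less_eq_real_def)
    then have "eventually (\<lambda>x. \<rho> B / 2 < \<rho> x) (at_left B)" using lim by (intro order_tendstoD) auto
    then obtain y where y: "y < B" "\<And>x. y < x \<Longrightarrow> x < B \<Longrightarrow> \<rho> B / 2 < \<rho> x"
      by (auto simp: eventually_at_left_field)
    \<comment> \<open>Right of \<open>l\<close> the density formula is valid and the density exceeds
      half its value at B.\<close>
    define l where "l = max y (B - \<delta>)"
    have l: "l < B" using y \<open>\<delta> > 0\<close> by (simp add: l_def)
    \<comment> \<open>B - B / \<open>(1 + \<epsilon>)\<close> is at least B
      \<open>\<epsilon>\<close> / 2, so the part of this window above t has length at least min (B -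
      l) (B / 2) times \<open>\<epsilon>\<close>.\<close>
    define c where "c = \<rho> B / 2 * min (B - l) (B / 2)"
    have "c > 0" using pos l \<open>0 < B\<close> by (simp add: c_def)
    moreover have "c * \<epsilon> \<le> measure D {B / (1 + \<epsilon>)..}" if e: "0 < \<epsilon>" "\<epsilon> \<le> 1" for \<epsilon>
    proof -
      define s where "s = max l (B / (1 + \<epsilon>))"
      have s: "s < B" "l \<le> s" "B / (1 + \<epsilon>) \<le> s" using l e \<open>0 < B\<close> by (auto simp: s_def field_simps)
      have "min (B - l) (B / 2) * \<epsilon> \<le> B - s"
      proof -
        have 1: "min (B - l) (B / 2) * \<epsilon> \<le> (B - l) * 1" using e l by (intro mult_mono) auto
        have "min (B - l) (B / 2) * \<epsilon> \<le> B / 2 * \<epsilon>"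
          using e by (intro mult_right_mono min.cobounded2) auto
        also have "\<dots> \<le> B * \<epsilon> / (1 + \<epsilon>)" using e \<open>0 < B\<close> by (simp add: field_simps)
        also have "\<dots> = B - B / (1 + \<epsilon>)" using e by (simp add: field_simps)
        finally show ?thesis using 1 by (simp add: s_def max_def)
      qed
      then have "c * \<epsilon> \<le> \<rho> B / 2 * (B - s)" using pos unfolding c_def mult.assoc by (intro mult_left_mono) auto
      then have "ennreal (c * \<epsilon>) \<le> ennreal (\<rho> B / 2 * (B - s))" by (rule ennreal_leI)
      also have "\<dots> = (\<integral>\<^sup>+x\<in>{s<..<B}. ennreal (\<rho> B / 2) \<partial>lborel)"
        using s pos by (simp add: nn_integral_cmult_indicator ennreal_mult[symmetric])
      also have "\<dots> \<le> (\<integral>\<^sup>+x\<in>{s<..<B}. ennreal (\<rho> x) \<partial>lborel)"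
        using y(2)[THEN less_imp_le] s
        by (intro nn_integral_mono) (auto simp: indicator_def l_def intro!: ennreal_leI)
      also have "\<dots> = emeasure D {s<..<B}"
        using s by (intro has_density_onD[OF dens, symmetric]) (auto simp: l_def)
      also have "\<dots> \<le> emeasure D {B / (1 + \<epsilon>)..}"
        using s sets by (intro emeasure_mono) auto
      finally show ?thesis by (simp add: emeasure_eq_measure)
    qed
    ultimately show ?thesis by blast
  qed
  then obtain c where c: "c > 0"
    "\<And>\<epsilon>. 0 < \<epsilon> \<Longrightarrow> \<epsilon> \<le> 1 \<Longrightarrow> c * \<epsilon> \<le> measure D {B / (1 + \<epsilon>)..}" by blast
  have "eventually (\<lambda>m::real. 3 \<le> m \<and> (ln m)\<^sup>2 \<le> m * (c * (1 / ln m))) at_top"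
    using c(1) by (intro eventually_conj; real_asymp)
  then obtain m\<^sub>0 where m0: "\<And>m. m\<^sub>0 \<le> m \<Longrightarrow> 3 \<le> m \<and> (ln m)\<^sup>2 \<le> m * (c * (1 / ln m))"
    by (auto simp: eventually_at_top_linorder)
  show ?thesis
    unfolding concentrated_maxima_def
  proof (rule exI[of _ 1], rule conjI, simp, rule exI[of _ m\<^sub>0], intro allI impI)
    fix \<epsilon> m :: real assume e: "0 < \<epsilon>" "\<epsilon> \<le> 1" "m\<^sub>0 \<le> m" "(1 / \<epsilon>) powr 1 \<le> ln m"
    have m: "3 \<le> m" "(ln m)\<^sup>2 \<le> m * (c * (1 / ln m))" using m0[OF e(3)] by auto
    have ln1: "1 \<le> ln m" using m ln3_gt_1 ln_mono[of 3 m] by linarith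
    have "1 / ln m \<le> \<epsilon>" using e ln1 by (simp add: field_simps)
    then have "m * (c * (1 / ln m)) \<le> m * (c * \<epsilon>)" using m c by (intro mult_left_mono) auto
    also have "\<dots> \<le> m * measure D {B / (1 + \<epsilon>)..}" using m c(2) e by (intro mult_left_mono) auto
    finally have "(ln m)\<^sup>2 \<le> m * measure D {B / (1 + \<epsilon>)..}" using m by simp
    moreover have "m * measure D {(1 + \<epsilon>) * (B / (1 + \<epsilon>))<..} \<le> 1 / ln m"
      using e null ln1 by simp
    ultimately show "\<exists>t>0. m * measure D {(1 + \<epsilon>) * t<..} \<le> 1 / ln m \<and> (ln m)\<^sup>2 \<le> m * measure D {t..}"
      using e \<open>0 < B\<close> by (intro exI[of _ "B / (1 + \<epsilon>)"]) auto
  qed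
qed

text \<open>The interface to the rest: concentrated maxima serve the final selection, the polynomial
  tail serves the truncation in the greedy steps.\<close>

lemma generalized_exponential_tail_bounds:
  assumes "prob_space D" and "sets D = sets borel" and "generalized_exponential_tail D"
    and "integrable D (\<lambda>x. x)" and "(\<integral>x. x \<partial>D) = 1"
  shows "concentrated_maxima D" and "eventually (\<lambda>x. measure D {x<..} \<le> x powr (- q)) at_top"
proof -
  interpret prob_space D by fact
  have "concentrated_maxima D \<and> eventually (\<lambda>x. measure D {x<..} \<le> x powr (- q)) at_top"
  proof (cases "bounded (support D)")
    case True
    let ?B = "Sup (support D)"
    note B = bounded_support_Sup[OF assms(1,2) True assms(4,5)]
    have "measure D {x<..} \<le> x powr (- q)" if "?B \<le> x" for x
    proof -
      have "measure D {x<..} \<le> measure D {?B<..}" using that assms(2) by (intro finite_measure_mono) auto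
      then show ?thesis using B(1) powr_ge_zero[of x "- q"] by linarith
    qed
    then have "eventually (\<lambda>x. measure D {x<..} \<le> x powr (- q)) at_top"
      by (auto simp: eventually_at_top_linorder)
    moreover have "concentrated_maxima D"
      by (rule bounded_support_concentrated_maxima[OF assms(1,2) B(1)])
         (use B(2) assms(3) True in \<open>auto simp: generalized_exponential_tail_def\<close>)
    ultimately show ?thesis by blast
  next
    case False
    then obtain x\<^sub>0 \<rho> g c \<gamma> where
      *: "has_density_on D {x\<^sub>0<..} \<rho>" "x\<^sub>0 \<ge> 0" "antimono (\<gamma> :: nat \<Rightarrow> real)"
         "\<And>x. x\<^sub>0 < x \<Longrightarrow> \<rho> x = exp (- g x)"
         "\<And>x. x\<^sub>0 < x \<Longrightarrow> ((\<lambda>i. c i * x powr \<gamma> i) has_sum g x) UNIV"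
      using assms(3) unfolding generalized_exponential_tail_def by (simp only: if_False) blast
    show ?thesis
      using exponential_tail_concentrated_maxima[OF assms(1,2) *]
        exponential_tail_polynomial_bound[OF assms(1) *] by blast
  qed
  then show "concentrated_maxima D" "eventually (\<lambda>x. measure D {x<..} \<le> x powr (- q)) at_top"
    by auto
qed

section \<open>The algorithm as a decision tree\<close>

text \<open>The continuation receives the answers as a table that agrees with the oracle on the
  batch and is 0 elsewhere. A step of the algorithm can thus be written as an ordinary function of
  an oracle and be run on the table.\<close>

primrec ask_list :: "'a set list \<Rightarrow> (('a set \<Rightarrow> real) \<Rightarrow> 'a strategy) \<Rightarrow> 'a strategy" where
  "ask_list [] k = k (\<lambda>_. 0)"
| "ask_list (S # Ss) k = Query S (\<lambda>y. ask_list Ss (\<lambda>tab. k (tab(S := y))))"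

definition ask :: "'a set set \<Rightarrow> (('a set \<Rightarrow> real) \<Rightarrow> 'a strategy) \<Rightarrow> 'a strategy" where
  "ask \<Q> k = ask_list (SOME Ss. set Ss = \<Q> \<and> distinct Ss) k"

definition answers :: "'a set set \<Rightarrow> ('a set \<Rightarrow> real) \<Rightarrow> 'a set \<Rightarrow> real" where
  "answers \<Q> orc = (\<lambda>S. if S \<in> \<Q> then orc S else 0)"

lemma answers_Cons: "(answers (set Ss) orc)(S := orc S) = answers (set (S # Ss)) orc"
  by (auto simp: answers_def)

lemma result_ask_list: "result (ask_list Ss k) orc = result (k (answers (set Ss) orc)) orc"
proof (induction Ss arbitrary: k)
  case (Cons S Ss)
  then show ?case using answers_Cons[of Ss orc S] by simp
qed (simp add: answers_def)

lemma num_queries_ask_list: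
  "num_queries (ask_list Ss k) orc = length Ss + num_queries (k (answers (set Ss) orc)) orc"
proof (induction Ss arbitrary: k)
  case (Cons S Ss)
  then show ?case using answers_Cons[of Ss orc S] by simp
qed (simp add: answers_def)

lemma queries_within_ask_list:
  "set Ss \<subseteq> Pow N \<Longrightarrow> (\<And>tab. queries_within N (k tab)) \<Longrightarrow> queries_within N (ask_list Ss k)"
  by (induction Ss arbitrary: k) auto

lemma
  assumes "finite \<Q>"
  shows result_ask: "result (ask \<Q> k) orc = result (k (answers \<Q> orc)) orc"
    and num_queries_ask: "num_queries (ask \<Q> k) orc = card \<Q> + num_queries (k (answers \<Q> orc)) orc"
    and queries_within_ask:
      "\<Q> \<subseteq> Pow N \<Longrightarrow> (\<And>tab. queries_within N (k tab)) \<Longrightarrow> queries_within N (ask \<Q> k)"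
proof -
  define Ss where "Ss = (SOME Ss. set Ss = \<Q> \<and> distinct Ss)"
  have "set Ss = \<Q> \<and> distinct Ss"
    unfolding Ss_def using finite_distinct_list[OF assms] by (rule someI_ex)
  then have Ss: "set Ss = \<Q>" "length Ss = card \<Q>" using distinct_card[of Ss] by auto
  have ask: "ask \<Q> k = ask_list Ss k" by (simp add: ask_def Ss_def)
  show "result (ask \<Q> k) orc = result (k (answers \<Q> orc)) orc"
    "num_queries (ask \<Q> k) orc = card \<Q> + num_queries (k (answers \<Q> orc)) orc"
    using Ss by (simp_all add: ask result_ask_list num_queries_ask_list)
  show "queries_within N (ask \<Q> k)" if "\<Q> \<subseteq> Pow N" "\<And>tab. queries_within N (k tab)"
    unfolding ask using Ss that by (intro queries_within_ask_list) auto
qed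

lemma result_cong_queries_within:
  "queries_within N T \<Longrightarrow> (\<And>S. S \<subseteq> N \<Longrightarrow> orc S = orc' S) \<Longrightarrow> result T orc = result T orc'"
  by (induction T) auto

section \<open>Measurable choice of a maximizer\<close>

definition argmax :: "'b set \<Rightarrow> ('b \<Rightarrow> real) \<Rightarrow> 'b" where
  "argmax X h = (SOME x. x \<in> X \<and> (\<forall>y\<in>X. h y \<le> h x))"

lemma argmax:
  assumes "finite X" "X \<noteq> {}"
  shows "argmax X h \<in> X" and "y \<in> X \<Longrightarrow> h y \<le> h (argmax X h)"
proof -
  have "Max (h ` X) \<in> h ` X" using assms by simp
  then obtain x where "x \<in> X" "h x = Max (h ` X)" by auto
  then have "\<exists>x. x \<in> X \<and> (\<forall>y\<in>X. h y \<le> h x)" using assms by auto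
  from someI_ex[OF this]
  show "argmax X h \<in> X" and "y \<in> X \<Longrightarrow> h y \<le> h (argmax X h)" by (auto simp: argmax_def)
qed

lemma argmax_cong: "(\<And>x. x \<in> X \<Longrightarrow> h x = h' x) \<Longrightarrow> argmax X h = argmax X h'"
  unfolding argmax_def by (intro arg_cong[where f=Eps] ext) auto

text \<open>The arbitrary choice made by \<open>SOME\<close> depends only on the set of all
  maximizers. That set is a measurable function with finitely many values, and on a discrete space
  every further function is measurable.\<close>

lemma measurable_argmax:
  assumes fin: "finite X" and "X \<noteq> {}" and h: "\<And>x. x \<in> X \<Longrightarrow> (\<lambda>\<omega>. h \<omega> x) \<in> borel_measurable M"
  shows "(\<lambda>\<omega>. argmax X (h \<omega>)) \<in> measurable M (count_space X)"
proof -
  define P where "P \<omega> x \<longleftrightarrow> (\<forall>y\<in>X. h \<omega> y \<le> h \<omega> x)" for \<omega> x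
  define Y where "Y \<omega> = {x \<in> X. P \<omega> x}" for \<omega>
  have Y: "Y \<in> measurable M (count_space (Pow X))"
  proof (rule measurable_count_space_eq2[THEN iffD2])
    show "finite (Pow X)" using fin by simp
    show "Y \<in> space M \<rightarrow> Pow X \<and> (\<forall>A\<in>Pow X. Y -` {A} \<inter> space M \<in> sets M)"
    proof (intro conjI ballI)
      show "Y \<in> space M \<rightarrow> Pow X" by (auto simp: Y_def)
      fix A assume A: "A \<in> Pow X"
      have "Y \<omega> = A \<longleftrightarrow> (\<forall>x\<in>X. x \<in> A \<longleftrightarrow> P \<omega> x)" for \<omega>
        using A unfolding Y_def by fast
      then have "Y -` {A} \<inter> space M = {\<omega> \<in> space M. \<forall>x\<in>X. x \<in> A \<longleftrightarrow> P \<omega> x}"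
        by (simp add: vimage_def Int_def conj_commute)
      also have "\<dots> \<in> sets M"
      proof (intro sets.sets_Collect_finite_All fin)
        fix x assume x: "x \<in> X"
        have le: "{\<omega> \<in> space M. P \<omega> x} \<in> sets M"
          unfolding P_def using x by (intro sets.sets_Collect_finite_All fin borel_measurable_le h) auto
        show "{\<omega> \<in> space M. x \<in> A \<longleftrightarrow> P \<omega> x} \<in> sets M"
          using le sets.sets_Collect_neg[OF le] by (cases "x \<in> A") (simp_all only: simp_thms)
      qed
      finally show "Y -` {A} \<inter> space M \<in> sets M" .
    qed
  qed
  have "(\<lambda>\<omega>. SOME x. x \<in> Y \<omega>) \<in> measurable M (count_space UNIV)"
    by (rule measurable_compose[OF Y]) simp
  moreover have "argmax X (h \<omega>) = (SOME x. x \<in> Y \<omega>)" for \<omega> by (simp add: argmax_def Y_def P_def)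
  ultimately have "(\<lambda>\<omega>. argmax X (h \<omega>)) \<in> measurable M (count_space UNIV)" by simp
  then show ?thesis
    using argmax(1)[OF fin \<open>X \<noteq> {}\<close>] by (auto simp: measurable_def)
qed

section \<open>The greedy algorithm and its queries\<close>

text \<open>Negative answers are cut off because nothing is known about the left tail of the noise.\<close>

definition score :: "'a set \<Rightarrow> ('a set \<Rightarrow> real) \<Rightarrow> 'a set \<Rightarrow> real" where
  "score H orc T = (\<Sum>x\<in>H - T. max 0 (orc (insert x T)))"

definition extend :: "'a set \<Rightarrow> 'a set \<Rightarrow> ('a set \<Rightarrow> real) \<Rightarrow> 'a set \<Rightarrow> 'a set" where
  "extend N H orc S = insert (argmax (N - S) (\<lambda>e. score H orc (insert e S))) S"

text \<open>One arbitrary element is added before the final selection, so that the selection is made with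
  noise variables of sets that are larger than all the sets queried before.\<close>

definition pad :: "'a set \<Rightarrow> 'a set \<Rightarrow> 'a set" where
  "pad N S = insert (SOME z. z \<in> N - S) S"

definition finish :: "'a set \<Rightarrow> 'a set \<Rightarrow> ('a set \<Rightarrow> real) \<Rightarrow> 'a set \<Rightarrow> 'a set" where
  "finish N H orc S = insert (argmax (H - pad N S) (\<lambda>x. orc (insert x (pad N S)))) (pad N S)"

definition extend_queries :: "'a set \<Rightarrow> 'a set \<Rightarrow> 'a set \<Rightarrow> 'a set set" where
  "extend_queries N H S = (\<lambda>(e, x). insert x (insert e S)) ` (SIGMA e:N - S. H - insert e S)"

definition finish_queries :: "'a set \<Rightarrow> 'a set \<Rightarrow> 'a set \<Rightarrow> 'a set set" where
  "finish_queries N H S = (\<lambda>x. insert x (pad N S)) ` (H - pad N S)"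

primrec greedy_strategy :: "'a set \<Rightarrow> 'a set \<Rightarrow> nat \<Rightarrow> 'a set \<Rightarrow> 'a strategy" where
  "greedy_strategy N H 0 S =
     ask (finish_queries N H S) (\<lambda>tab. Return (finish N H tab S))"
| "greedy_strategy N H (Suc j) S =
     ask (extend_queries N H S) (\<lambda>tab. greedy_strategy N H j (extend N H tab S))"

definition greedy :: "'a set \<Rightarrow> 'a set \<Rightarrow> ('a set \<Rightarrow> real) \<Rightarrow> nat \<Rightarrow> 'a set" where
  "greedy N H orc i = (extend N H orc ^^ i) {}"

text \<open>Serves twice: a step may be run on the table of its own batch, and its outcome depends
  on no noise outside that batch.\<close>

lemma extend_cong:
  "(\<And>T. T \<in> extend_queries N H S \<Longrightarrow> orc T = orc' T) \<Longrightarrow> extend N H orc S = extend N H orc' S"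
  unfolding extend_def score_def
  by (intro arg_cong2[where f=insert] argmax_cong refl sum.cong arg_cong[where f="max 0"])
     (force simp: extend_queries_def)

lemma finish_cong:
  "(\<And>T. T \<in> finish_queries N H S \<Longrightarrow> orc T = orc' T) \<Longrightarrow> finish N H orc S = finish N H orc' S"
  unfolding finish_def
  by (intro arg_cong2[where f=insert] argmax_cong refl) (force simp: finish_queries_def)

context
  fixes N H :: "'a set"
  assumes fin: "finite N" and H: "H \<subseteq> N"
begin

lemma finite_queries: "finite (extend_queries N H S)" "finite (finish_queries N H S)"
  unfolding extend_queries_def finish_queries_def
  using fin finite_subset[OF H fin] by (auto intro!: finite_imageI finite_SigmaI)

lemma card_queries:
  "card (extend_queries N H S) \<le> card N * card H" "card (finish_queries N H S) \<le> card H"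
proof -
  have fH: "finite H" by (rule finite_subset[OF H fin])
  have "card (extend_queries N H S) \<le> card (SIGMA e:N - S. H - insert e S)"
    unfolding extend_queries_def using fin fH by (intro card_image_le) auto
  also have "\<dots> \<le> card (N \<times> H)" using fin fH by (intro card_mono) auto
  finally show "card (extend_queries N H S) \<le> card N * card H" by (simp add: card_cartesian_product)
  have "card (finish_queries N H S) \<le> card (H - pad N S)"
    unfolding finish_queries_def using fH by (intro card_image_le) auto
  also have "\<dots> \<le> card H" using fH by (intro card_mono) auto
  finally show "card (finish_queries N H S) \<le> card H" .
qed

lemma extend_props:
  assumes "S \<subseteq> N" "card S < card N"
  shows "extend N H orc S \<subseteq> N" "card (extend N H orc S) = Suc (card S)"
    "\<exists>e\<in>N - S. extend N H orc S = insert e S \<and> (\<forall>e'\<in>N - S. score H orc (insert e' S) \<le> score H orc (insert e S))"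
proof -
  have "N - S \<noteq> {}" using assms by auto
  from argmax[OF _ this] have
    am: "argmax (N - S) h \<in> N - S" "y \<in> N - S \<Longrightarrow> h y \<le> h (argmax (N - S) h)" for h y using fin by auto
  show "\<exists>e\<in>N - S. extend N H orc S = insert e S \<and> (\<forall>e'\<in>N - S. score H orc (insert e' S) \<le> score H orc (insert e S))"
    unfolding extend_def
    by (rule bexI[OF _ am(1)[of "\<lambda>e. score H orc (insert e S)"]])
       (use am(2)[of _ "\<lambda>e. score H orc (insert e S)"] in auto)
  show "extend N H orc S \<subseteq> N" "card (extend N H orc S) = Suc (card S)"
    using am(1) assms finite_subset[OF assms(1) fin] unfolding extend_def by auto
qed

lemma pad_props:
  assumes "S \<subseteq> N" "card S < card N"
  shows "pad N S \<subseteq> N" "card (pad N S) = Suc (card S)" "S \<subseteq> pad N S"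
proof -
  have "N - S \<noteq> {}" using assms by auto
  then have "\<exists>z. z \<in> N - S" by blast
  from someI_ex[OF this] show "pad N S \<subseteq> N" "card (pad N S) = Suc (card S)" "S \<subseteq> pad N S"
    using assms finite_subset[OF assms(1) fin] unfolding pad_def by auto
qed

lemma finish_props:
  assumes "S \<subseteq> N" "card S < card N" "Suc (card S) < card H"
  shows "\<exists>x\<in>H - pad N S. finish N H orc S = insert x (pad N S) \<and>
      (\<forall>y\<in>H - pad N S. orc (insert y (pad N S)) \<le> orc (insert x (pad N S)))"
    and "finish N H orc S \<subseteq> N" and "card (finish N H orc S) = Suc (Suc (card S))"
proof -
  have fH: "finite H" by (rule finite_subset[OF H fin])
  note pad = pad_props[OF assms(1,2)]
  have "H - pad N S \<noteq> {}"
    using card_mono[OF finite_subset[OF pad(1) fin], of H] pad(2) assms(3) by auto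
  from argmax[OF _ this] have
    am: "argmax (H - pad N S) h \<in> H - pad N S" "y \<in> H - pad N S \<Longrightarrow> h y \<le> h (argmax (H - pad N S) h)" for h y
    using fH by auto
  show "\<exists>x\<in>H - pad N S. finish N H orc S = insert x (pad N S) \<and>
      (\<forall>y\<in>H - pad N S. orc (insert y (pad N S)) \<le> orc (insert x (pad N S)))"
    unfolding finish_def
    by (rule bexI[OF _ am(1)[of "\<lambda>x. orc (insert x (pad N S))"]])
       (use am(2)[of _ "\<lambda>x. orc (insert x (pad N S))"] in auto)
  show "finish N H orc S \<subseteq> N" and "card (finish N H orc S) = Suc (Suc (card S))"
    using am(1) pad H finite_subset[OF pad(1) fin] unfolding finish_def by (auto simp: card_insert_if)
qed

lemma extend_queries_within: "S \<subseteq> N \<Longrightarrow> extend_queries N H S \<subseteq> Pow N"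
  using H unfolding extend_queries_def by auto

lemma finish_queries_within: "S \<subseteq> N \<Longrightarrow> card S < card N \<Longrightarrow> finish_queries N H S \<subseteq> Pow N"
  using H pad_props(1)[of S] unfolding finish_queries_def by auto

text \<open>Since \<open>e\<close> and \<open>x\<close> are new and distinct, all queries of a step
  lie on a single level of the subset lattice, and different steps use different levels.\<close>

lemma card_extend_queries:
  "S \<subseteq> N \<Longrightarrow> T \<in> extend_queries N H S \<Longrightarrow> card T = card S + 2"
proof -
  assume "S \<subseteq> N" "T \<in> extend_queries N H S"
  then obtain e x where "T = insert x (insert e S)" "e \<notin> S" "x \<notin> insert e S"
    unfolding extend_queries_def by auto
  then show "card T = card S + 2" using finite_subset[OF \<open>S \<subseteq> N\<close> fin] by simp
qed

lemma queries_within_greedy_strategy: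
  "S \<subseteq> N \<Longrightarrow> card S + j < card N \<Longrightarrow> queries_within N (greedy_strategy N H j S)"
proof (induction j arbitrary: S)
  case 0
  then show ?case using finish_queries_within[of S] by (auto intro!: queries_within_ask finite_queries)
next
  case (Suc j)
  then show ?case using extend_queries_within[of S] extend_props[of S]
    by (auto intro!: queries_within_ask finite_queries)
qed

lemma result_greedy_strategy:
  "result (greedy_strategy N H j S) orc = finish N H orc ((extend N H orc ^^ j) S)"
proof (induction j arbitrary: S)
  case 0
  have "finish N H (answers (finish_queries N H S) orc) S = finish N H orc S"
    by (rule finish_cong) (simp add: answers_def)
  then show ?case by (simp add: result_ask finite_queries)
next
  case (Suc j)
  have "extend N H (answers (extend_queries N H S) orc) S = extend N H orc S"
    by (rule extend_cong) (simp add: answers_def)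
  then show ?case using Suc by (simp add: result_ask finite_queries funpow_swap1)
qed

lemma num_queries_greedy_strategy:
  "num_queries (greedy_strategy N H j S) orc \<le> j * (card N * card H) + card H"
proof (induction j arbitrary: S)
  case 0
  then show ?case using card_queries by (simp add: num_queries_ask finite_queries)
next
  case (Suc j)
  have "num_queries (greedy_strategy N H (Suc j) S) orc
      \<le> card N * card H + (j * (card N * card H) + card H)"
    by (simp add: num_queries_ask finite_queries) (intro add_mono card_queries Suc)
  then show ?case by simp
qed

lemma greedy_Suc: "greedy N H orc (Suc i) = extend N H orc (greedy N H orc i)"
  by (simp add: greedy_def)

lemma greedy_props:
  "i \<le> card N \<Longrightarrow> greedy N H orc i \<subseteq> N \<and> card (greedy N H orc i) = i"
proof (induction i)
  case (Suc i)
  then show ?case using extend_props[of "greedy N H orc i"] by (auto simp: greedy_Suc)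
qed (simp add: greedy_def)

text \<open>The last of i steps starts from a set of size i - 1 and asks sets of size i + 1. The
  level i + 2, asked next, has not influenced the current set.\<close>

lemma greedy_cong:
  assumes "i \<le> card N" "\<And>T. T \<subseteq> N \<Longrightarrow> card T \<le> Suc i \<Longrightarrow> orc T = orc' T"
  shows "greedy N H orc i = greedy N H orc' i"
  using assms
proof (induction i)
  case (Suc i)
  then have IH: "greedy N H orc i = greedy N H orc' i" by auto
  have S: "greedy N H orc i \<subseteq> N" "card (greedy N H orc i) = i" using greedy_props Suc.prems by auto
  show ?case
    unfolding greedy_Suc IH[symmetric]
    using S card_extend_queries[OF S(1)] extend_queries_within[OF S(1)]
    by (intro extend_cong Suc.prems) auto
qed (simp add: greedy_def)

lemma measurable_extend:
  assumes "S \<subseteq> N" "card S < card N"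
  shows "(\<lambda>orc. extend N H orc S) \<in> measurable (PiM (Pow N) (\<lambda>_. borel)) (count_space (Pow N))"
proof -
  have "N - S \<noteq> {}" using assms by auto
  have "(\<lambda>orc. score H orc (insert e S)) \<in> borel_measurable (PiM (Pow N) (\<lambda>_. borel))" if "e \<in> N - S" for e
    unfolding score_def
  proof (intro borel_measurable_sum borel_measurable_max measurable_component_singleton measurable_const)
    fix x assume "x \<in> H - insert e S"
    then show "insert x (insert e S) \<in> Pow N" using H assms that by auto
  qed auto
  from measurable_argmax[OF _ \<open>N - S \<noteq> {}\<close> this]
  have "(\<lambda>orc. argmax (N - S) (\<lambda>e. score H orc (insert e S))) \<in> measurable (PiM (Pow N) (\<lambda>_. borel)) (count_space (N - S))"
    using fin by simp
  moreover have "(\<lambda>e. insert e S) \<in> measurable (count_space (N - S)) (count_space (Pow N))"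
    using assms by auto
  ultimately show ?thesis unfolding extend_def by (rule measurable_compose)
qed

lemma measurable_finish:
  assumes "S \<subseteq> N" "card S < card N" "Suc (card S) < card H"
  shows "(\<lambda>orc. finish N H orc S) \<in> measurable (PiM (Pow N) (\<lambda>_. borel)) (count_space (Pow N))"
proof -
  note pad = pad_props[OF assms(1,2)]
  have fH: "finite H" by (rule finite_subset[OF H fin])
  have ne: "H - pad N S \<noteq> {}"
    using card_mono[OF finite_subset[OF pad(1) fin], of H] pad(2) assms(3) by auto
  have "(\<lambda>orc. argmax (H - pad N S) (\<lambda>x. orc (insert x (pad N S)))) \<in> measurable (PiM (Pow N) (\<lambda>_. borel)) (count_space (H - pad N S))"
    using fH pad H by (intro measurable_argmax ne measurable_component_singleton) auto
  moreover have "(\<lambda>x. insert x (pad N S)) \<in> measurable (count_space (H - pad N S)) (count_space (Pow N))"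
    using pad H by auto
  ultimately show ?thesis unfolding finish_def by (rule measurable_compose)
qed

text \<open>The set to be extended is itself random, but it has finitely many possible values, and
  for each fixed value one step is measurable.\<close>

lemma measurable_greedy:
  assumes "i \<le> card N"
  shows "(\<lambda>orc. greedy N H orc i) \<in> measurable (PiM (Pow N) (\<lambda>_. borel)) (count_space {S. S \<subseteq> N \<and> card S = i})"
  using assms
proof (induction i)
  case (Suc i)
  let ?I = "{S. S \<subseteq> N \<and> card S = i}"
  have "(\<lambda>orc. extend N H orc (greedy N H orc i)) \<in> measurable (PiM (Pow N) (\<lambda>_. borel)) (count_space (Pow N))"
  proof (rule measurable_compose_countable'[where I="?I" and f="\<lambda>S orc. extend N H orc S"
        and g="\<lambda>orc. greedy N H orc i"])
    show "(\<lambda>orc. extend N H orc S) \<in> measurable (PiM (Pow N) (\<lambda>_. borel)) (count_space (Pow N))"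
      if "S \<in> ?I" for S using that Suc.prems by (intro measurable_extend) auto
    show "countable ?I" using fin by (intro countable_finite) auto
  qed (use Suc in auto)
  then show ?case
    using greedy_props[OF Suc.prems] fin
    by (simp add: measurable_count_space_eq2 greedy_Suc)
qed (auto simp: greedy_def)

lemma measurable_result_greedy_strategy:
  assumes "Suc j < card H"
  shows "result (greedy_strategy N H j {}) \<in> measurable (PiM (Pow N) (\<lambda>_. borel)) (count_space (Pow N))"
proof -
  let ?I = "{S. S \<subseteq> N \<and> card S = j}"
  have j: "Suc j < card N" using assms card_mono[OF fin H] by simp
  have "(\<lambda>orc. finish N H orc (greedy N H orc j)) \<in> measurable (PiM (Pow N) (\<lambda>_. borel)) (count_space (Pow N))"
  proof (rule measurable_compose_countable'[where I="?I" and f="\<lambda>S orc. finish N H orc S"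
        and g="\<lambda>orc. greedy N H orc j"])
    show "(\<lambda>orc. finish N H orc S) \<in> measurable (PiM (Pow N) (\<lambda>_. borel)) (count_space (Pow N))"
      if "S \<in> ?I" for S using that assms j by (intro measurable_finish) auto
    show "countable ?I" using fin by (intro countable_finite) auto
  qed (use j measurable_greedy in auto)
  moreover have "result (greedy_strategy N H j {}) = (\<lambda>orc. finish N H orc (greedy N H orc j))"
    by (simp add: fun_eq_iff result_greedy_strategy greedy_def)
  ultimately show ?thesis by simp
qed

end

section \<open>Greedy maximization of the smoothed function\<close>

definition smoothed :: "'a set \<Rightarrow> ('a set \<Rightarrow> real) \<Rightarrow> 'a set \<Rightarrow> real" where
  "smoothed H f T = (\<Sum>x\<in>H. f (insert x T))"

text \<open>Each summand is \<open>f\<close> with one element inserted beforehand, which preserves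
  decreasing gains. If that element is the added one, both gains vanish.\<close>

lemma submodular_on_smoothed:
  assumes "submodular_on N f" and "H \<subseteq> N"
  shows "submodular_on N (smoothed H f)"
  unfolding submodular_on_def
proof (intro allI impI)
  fix A B y assume AB: "A \<subseteq> B" "B \<subseteq> N" "y \<in> N - B"
  have "f (insert x (insert y B)) - f (insert x B) \<le> f (insert x (insert y A)) - f (insert x A)"
    if "x \<in> H" for x
  proof (cases "x = y")
    case False
    then have "insert x A \<subseteq> insert x B" "insert x B \<subseteq> N" "y \<in> N - insert x B"
      using AB that assms(2) by auto
    then have "f (insert y (insert x B)) - f (insert x B) \<le> f (insert y (insert x A)) - f (insert x A)"
      using assms(1) unfolding submodular_on_def by blast
    then show ?thesis by (simp add: insert_commute)
  qed simp
  then show "smoothed H f (insert y B) - smoothed H f B \<le> smoothed H f (insert y A) - smoothed H f A"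
    unfolding smoothed_def sum_subtractf[symmetric] by (rule sum_mono)
qed

lemma mono_on_smoothed:
  assumes "mono_on (Pow N) f" and "H \<subseteq> N"
  shows "mono_on (Pow N) (smoothed H f)"
  unfolding smoothed_def
  by (intro mono_onI sum_mono mono_onD[OF assms(1)]) (use assms(2) in auto)

lemma submodular_gain_le_sum:
  assumes sub: "submodular_on N F" and "finite N" and "S \<subseteq> N" and "T \<subseteq> N"
  shows "F (S \<union> T) - F S \<le> (\<Sum>e\<in>T - S. F (insert e S) - F S)"
proof -
  have "finite T" using assms finite_subset by blast
  then show ?thesis using \<open>T \<subseteq> N\<close>
  proof (induction T)
    case (insert e T)
    show ?case
    proof (cases "e \<in> S")
      case True
      then have "S \<union> insert e T = S \<union> T" "insert e T - S = T - S" by auto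
      then show ?thesis using insert by simp
    next
      case False
      have "F (insert e (S \<union> T)) - F (S \<union> T) \<le> F (insert e S) - F S"
        using sub False insert assms(3) unfolding submodular_on_def by auto
      moreover have "insert e T - S = insert e (T - S)" "e \<notin> T - S" "finite (T - S)"
        using False insert by auto
      ultimately show ?thesis using insert by simp
    qed
  qed simp
qed

text \<open>The classical greedy inequality, with an upper bound \<open>G\<close> instead of the
  best one-element extension: from inaccurate scores greedy obtains a near-maximizer only, and
  \<open>G\<close> will be the value reached plus the error. That \<open>G\<close> is at least F S
  covers a T with fewer than r new elements.\<close>

lemma submodular_best_gain:
  assumes sub: "submodular_on N F" and mono: "mono_on (Pow N) F" and fin: "finite N"
    and "S \<subseteq> N" and "T \<subseteq> N" and "card T \<le> r"
    and best: "\<And>e. e \<in> N - S \<Longrightarrow> F (insert e S) \<le> G" and "F S \<le> G"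
  shows "F T - F S \<le> real r * (G - F S)"
proof -
  have "F T \<le> F (S \<union> T)" using assms by (intro mono_onD[OF mono]) auto
  then have "F T - F S \<le> (\<Sum>e\<in>T - S. F (insert e S) - F S)"
    using submodular_gain_le_sum[OF sub fin assms(4,5)] by simp
  also have "\<dots> \<le> (\<Sum>e\<in>T - S. G - F S)" using best assms by (intro sum_mono) auto
  also have "\<dots> = real (card (T - S)) * (G - F S)" by simp
  also have "\<dots> \<le> real r * (G - F S)"
  proof (intro mult_right_mono)
    have "card (T - S) \<le> card T" using assms finite_subset[OF \<open>T \<subseteq> N\<close> fin] by (intro card_mono) auto
    then show "real (card (T - S)) \<le> real r" using assms by simp
  qed (use assms in simp)
  finally show ?thesis .
qed

lemma linear_recurrence_bound:
  fixes a :: "nat \<Rightarrow> real"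
  assumes step: "\<And>i. i < s \<Longrightarrow> a (Suc i) \<le> q * a i + \<eta>" and q: "0 \<le> q" "q \<le> 1" and "0 \<le> \<eta>"
  shows "a s \<le> q ^ s * a 0 + real s * \<eta>"
proof -
  have "i \<le> s \<Longrightarrow> a i \<le> q ^ i * a 0 + real i * \<eta>" for i
  proof (induction i)
    case (Suc i)
    have "a (Suc i) \<le> q * a i + \<eta>" using step Suc by simp
    also have "\<dots> \<le> q * (q ^ i * a 0 + real i * \<eta>) + \<eta>" using Suc q by (intro add_mono mult_left_mono) auto
    also have "\<dots> \<le> q ^ Suc i * a 0 + real (Suc i) * \<eta>"
    proof -
      have "q * (real i * \<eta>) \<le> 1 * (real i * \<eta>)" using q \<open>0 \<le> \<eta>\<close> by (intro mult_right_mono) auto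
      then show ?thesis by (simp add: algebra_simps)
    qed
    finally show ?case .
  qed simp
  then show ?thesis by simp
qed

section \<open>Greedy and final selection with inaccurate scores\<close>

context
  fixes N H :: "'a set" and f :: "'a set \<Rightarrow> real" and r :: nat and opt :: real
  assumes fin: "finite N" and H: "H \<subseteq> N" and ms: "monotone_submodular N f"
    and opt: "\<And>T. T \<subseteq> N \<Longrightarrow> card T \<le> r \<Longrightarrow> f T \<le> opt"
begin

lemma opt_nonneg: "0 \<le> opt"
  using opt[of "{}"] ms by (simp add: monotone_submodular_def)

text \<open>Bounds what a score gives up by skipping the x in T: there are at most r such terms and
  each equals f T.\<close>

lemma smoothed_minus_proper:
  assumes "T \<subseteq> N" "card T \<le> r"
  shows "smoothed H f T - (\<Sum>x\<in>H - T. f (insert x T)) \<in> {0..real r * opt}"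
proof -
  have fH: "finite H" by (rule finite_subset[OF H fin])
  have fT: "finite T" by (rule finite_subset[OF assms(1) fin])
  have "smoothed H f T = (\<Sum>x\<in>H - T. f (insert x T)) + (\<Sum>x\<in>H \<inter> T. f (insert x T))"
    unfolding smoothed_def using fH sum.Int_Diff[of H "\<lambda>x. f (insert x T)" T] by simp
  also have "(\<Sum>x\<in>H \<inter> T. f (insert x T)) = (\<Sum>x\<in>H \<inter> T. f T)"
    by (intro sum.cong) (auto simp: insert_absorb)
  finally have eq: "smoothed H f T - (\<Sum>x\<in>H - T. f (insert x T)) = real (card (H \<inter> T)) * f T" by simp
  have "card (H \<inter> T) \<le> r" using card_mono[OF fT, of "H \<inter> T"] assms(2) by simp
  moreover have "0 \<le> f T" "f T \<le> opt" using ms assms opt by (auto simp: monotone_submodular_def)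
  ultimately show ?thesis unfolding eq using mult_mono[of "real (card (H \<inter> T))" "real r" "f T" opt] by simp
qed

lemma smoothed_ge:
  assumes "T \<subseteq> N"
  shows "real (card H) * f T \<le> smoothed H f T"
proof -
  have "f T \<le> f (insert x T)" if "x \<in> H" for x
    using ms assms that H unfolding monotone_submodular_def by (intro mono_onD[of "Pow N" f]) auto
  then have "(\<Sum>x\<in>H. f T) \<le> smoothed H f T" unfolding smoothed_def by (rule sum_mono)
  then show ?thesis by simp
qed

text \<open>Scores estimate the smoothed function up to the common factor \<open>\<mu>\<close>,
  which does not affect the choice of a maximizer. The optimum Z of \<open>f\<close> serves as the
  benchmark, since its smoothed value is at least |H| times the optimum; the deficit against this
  number contracts by 1 - 1/r per step, up to the error.\<close>

lemma greedy_smoothed_value: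
  assumes Z: "Z \<subseteq> N" "card Z \<le> r" "f Z = opt"
    and s: "Suc s \<le> r" "r \<le> card N" and "0 < \<mu>" and "0 \<le> \<eta>"
    and acc: "\<And>i e. i < s \<Longrightarrow> e \<in> N - greedy N H orc i \<Longrightarrow>
      \<bar>score H orc (insert e (greedy N H orc i)) -
        \<mu> * (\<Sum>x\<in>H - insert e (greedy N H orc i). f (insert x (insert e (greedy N H orc i))))\<bar> \<le> \<mu> * \<eta>"
  shows "smoothed H f (greedy N H orc s)
    \<ge> real (card H) * opt * (1 - (1 - 1 / real r) ^ s) - 2 * real s * (\<eta> + real r * opt)"
proof -
  let ?F = "smoothed H f" and ?S = "greedy N H orc"
  define a where "a i = real (card H) * opt - ?F (?S i)" for i
  have r: "0 < r" using s by simp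
  have sub: "submodular_on N ?F" and mono: "mono_on (Pow N) ?F"
    using ms H submodular_on_smoothed mono_on_smoothed by (auto simp: monotone_submodular_def)
  have step: "a (Suc i) \<le> (1 - 1 / real r) * a i + 2 * (\<eta> + real r * opt)" if i: "i < s" for i
  proof -
    have Si: "?S i \<subseteq> N" "card (?S i) = i" using greedy_props[OF fin H, of i orc] i s by auto
    have fS: "finite (?S i)" using Si fin finite_subset by blast
    have close: "\<bar>score H orc (insert e (?S i)) - \<mu> * ?F (insert e (?S i))\<bar> \<le> \<mu> * (\<eta> + real r * opt)"
      if e: "e \<in> N - ?S i" for e
    proof -
      let ?T = "insert e (?S i)"
      have "?T \<subseteq> N" "card ?T \<le> r" using Si e fS i s by auto
      from smoothed_minus_proper[OF this]
      have "\<mu> * (\<Sum>x\<in>H - ?T. f (insert x ?T)) \<le> \<mu> * ?F ?T"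
        "\<mu> * ?F ?T \<le> \<mu> * ((\<Sum>x\<in>H - ?T. f (insert x ?T)) + real r * opt)"
        using \<open>0 < \<mu>\<close> by (auto intro!: mult_left_mono)
      then show ?thesis using acc[OF i e] by (simp add: abs_le_iff algebra_simps)
    qed
    obtain e where e: "e \<in> N - ?S i" "?S (Suc i) = insert e (?S i)"
      and best: "\<And>e'. e' \<in> N - ?S i \<Longrightarrow> score H orc (insert e' (?S i)) \<le> score H orc (insert e (?S i))"
      using extend_props(3)[OF fin H Si(1), of orc] i s Si(2) by (auto simp: greedy_Suc[OF fin H])
    \<comment> \<open>The error enters twice, once for the chosen element and once for its
      competitor.\<close>
    define G where "G = ?F (?S (Suc i)) + 2 * (\<eta> + real r * opt)"
    have "?F (insert e' (?S i)) \<le> G" if e': "e' \<in> N - ?S i" for e'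
    proof -
      have "\<mu> * ?F (insert e' (?S i)) \<le> score H orc (insert e (?S i)) + \<mu> * (\<eta> + real r * opt)"
        using close[OF e'] best[OF e'] by linarith
      also have "\<dots> \<le> \<mu> * ?F (insert e (?S i)) + 2 * (\<mu> * (\<eta> + real r * opt))"
        using close[OF e(1)] by linarith
      also have "\<dots> = \<mu> * G" by (simp add: G_def e(2) algebra_simps)
      finally show ?thesis using \<open>0 < \<mu>\<close> by simp
    qed
    moreover have "?F (?S i) \<le> G"
    proof -
      have "?F (?S i) \<le> ?F (?S (Suc i))" using e Si by (intro mono_onD[OF mono]) auto
      moreover have "0 \<le> real r * opt" using opt_nonneg by simp
      ultimately show ?thesis using \<open>0 \<le> \<eta>\<close> by (simp add: G_def)
    qed
    ultimately have "?F Z - ?F (?S i) \<le> real r * (G - ?F (?S i))"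
      using Z Si by (intro submodular_best_gain[OF sub mono fin]) auto
    moreover have "real (card H) * opt \<le> ?F Z" using smoothed_ge[OF Z(1)] Z(3) by simp
    ultimately have "a i \<le> real r * (G - ?F (?S i))" by (simp add: a_def)
    then have "a i / real r \<le> G - ?F (?S i)" using r by (simp add: field_simps)
    then have "a (Suc i) \<le> a i - a i / real r + 2 * (\<eta> + real r * opt)" by (simp add: a_def G_def)
    then show ?thesis by (simp add: left_diff_distrib)
  qed
  have "a s \<le> (1 - 1 / real r) ^ s * a 0 + real s * (2 * (\<eta> + real r * opt))"
    using step r opt_nonneg \<open>0 \<le> \<eta>\<close> by (intro linear_recurrence_bound) auto
  moreover have "(1 - 1 / real r) ^ s * a 0 \<le> (1 - 1 / real r) ^ s * (real (card H) * opt)"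
  proof (intro mult_left_mono)
    have "real (card H) * f {} \<le> ?F {}" by (rule smoothed_ge) simp
    then show "a 0 \<le> real (card H) * opt"
      using ms by (simp add: a_def greedy_def monotone_submodular_def)
  qed (use r in auto)
  ultimately show ?thesis by (simp add: a_def algebra_simps)
qed

text \<open>An averaging argument. Padding does not lower the mean V, by monotonicity. No summand
  exceeds the optimum, so if the summands above V - \<open>\<epsilon>\<close> opt made up less than
  a fraction \<open>\<epsilon>\<close>, the mean would fall below V. The summand r pays for elements
  of \<open>H\<close> already in the padded set.\<close>

lemma many_good_completions:
  assumes S: "S \<subseteq> N" "card S < card N" "Suc (Suc (card S)) \<le> r" and e: "0 \<le> \<epsilon>" "\<epsilon> \<le> 1" and "H \<noteq> {}"
    and V: "V = smoothed H f S / real (card H)" and "0 < opt"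
  shows "\<epsilon> * real (card H) - real r \<le> real (card {x \<in> H - pad N S. V - \<epsilon> * opt \<le> f (insert x (pad N S))})"
    (is "_ \<le> real (card ?P)")
proof -
  let ?T = "pad N S" and ?M = "real (card H)"
  have fH: "finite H" by (rule finite_subset[OF H fin])
  then have M: "0 < ?M" using \<open>H \<noteq> {}\<close> by (simp add: card_gt_0_iff)
  note pad = pad_props[OF fin H S(1,2)]
  have fT: "finite ?T" by (rule finite_subset[OF pad(1) fin])
  have w: "0 \<le> f (insert x ?T)" "f (insert x ?T) \<le> opt" if "x \<in> H - ?T" for x
    using that ms H pad fT S by (auto simp: monotone_submodular_def intro!: opt)
  show ?thesis
  proof (cases "V < \<epsilon> * opt")
    \<comment> \<open>The threshold is negative, so every completion qualifies. The averaging below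
      needs it to be nonnegative, in order to replace |H - T| by |H|.\<close>
    case True
    then have "?P = H - ?T" using w(1) by force
    moreover have "card H \<le> card (H - ?T) + card ?T"
      using diff_card_le_card_Diff[OF fT, of H] by simp
    moreover have "\<epsilon> * ?M \<le> 1 * ?M" using e by (intro mult_right_mono) auto
    ultimately show ?thesis using pad(2) S(3) by simp
  next
    case False
    have "mono_on (Pow N) (smoothed H f)"
      using ms H mono_on_smoothed by (auto simp: monotone_submodular_def)
    then have "?M * V \<le> smoothed H f ?T"
      using V M pad by (simp add: mono_onD S(1))
    also have "\<dots> \<le> (\<Sum>x\<in>H - ?T. f (insert x ?T)) + real r * opt"
      using smoothed_minus_proper[OF pad(1)] pad(2) S(3) by simp
    also have "(\<Sum>x\<in>H - ?T. f (insert x ?T)) \<le> (\<Sum>x\<in>H - ?T. (if x \<in> ?P then opt else 0) + (V - \<epsilon> * opt))"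
    proof (rule sum_mono)
      fix x assume "x \<in> H - ?T"
      then show "f (insert x ?T) \<le> (if x \<in> ?P then opt else 0) + (V - \<epsilon> * opt)"
        using w[of x] False by (cases "V - \<epsilon> * opt \<le> f (insert x ?T)") auto
    qed
    also have "\<dots> = real (card ?P) * opt + real (card (H - ?T)) * (V - \<epsilon> * opt)"
    proof -
      have "(\<Sum>x\<in>H - ?T. if x \<in> ?P then opt else 0) = (\<Sum>x\<in>?P. opt)"
        using fH by (intro sum.mono_neutral_cong_right) auto
      then show ?thesis by (simp add: sum.distrib)
    qed
    also have "\<dots> \<le> real (card ?P) * opt + ?M * (V - \<epsilon> * opt)"
      using False fH by (intro add_left_mono mult_right_mono) (auto intro: card_mono)
    finally have "(\<epsilon> * ?M - real r) * opt \<le> real (card ?P) * opt" by (simp add: algebra_simps)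
    then show ?thesis using \<open>0 < opt\<close> by simp
  qed
qed

text \<open>The winner's noisy value is at least that of the good completion \<open>y\<close>, hence
  at least t f(y), while its own multiplier is at most \<open>(1 + \<epsilon>) * t\<close>. So its
  true value is at least f(y) / \<open>(1 + \<epsilon>)\<close>. One \<open>\<epsilon>\<close> is
  lost through y, one through this ratio.\<close>

lemma finish_value:
  assumes S: "S \<subseteq> N" "card S < card N" "Suc (Suc (card S)) \<le> r" and "Suc (card S) < card H"
    and e: "0 \<le> \<epsilon>" and "0 < t"
    and V: "V = smoothed H f S / real (card H)"
    and le: "\<And>x. x \<in> H - pad N S \<Longrightarrow> \<xi> (insert x (pad N S)) \<le> (1 + \<epsilon>) * t"
    and ge: "y \<in> H - pad N S" "V - \<epsilon> * opt \<le> f (insert y (pad N S))" "t \<le> \<xi> (insert y (pad N S))"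
  shows "V - 2 * \<epsilon> * opt \<le> f (finish N H (noisy_oracle f \<xi>) S)"
proof -
  let ?T = "pad N S"
  note pad = pad_props[OF fin H S(1,2)]
  have fT: "finite ?T" by (rule finite_subset[OF pad(1) fin])
  have w: "0 \<le> f (insert x ?T)" "f (insert x ?T) \<le> opt" if "x \<in> H - ?T" for x
    using that ms H pad fT S by (auto simp: monotone_submodular_def intro!: opt)
  obtain x where x: "x \<in> H - ?T" "finish N H (noisy_oracle f \<xi>) S = insert x ?T"
    "\<And>y. y \<in> H - ?T \<Longrightarrow> noisy_oracle f \<xi> (insert y ?T) \<le> noisy_oracle f \<xi> (insert x ?T)"
    using finish_props(1)[OF fin H S(1,2) assms(4), of "noisy_oracle f \<xi>"] by blast
  have "t * f (insert y ?T) \<le> \<xi> (insert y ?T) * f (insert y ?T)"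
    using ge w(1) by (intro mult_right_mono) auto
  also have "\<dots> \<le> \<xi> (insert x ?T) * f (insert x ?T)" using x(3)[OF ge(1)] by (simp add: noisy_oracle_def)
  also have "\<dots> \<le> (1 + \<epsilon>) * t * f (insert x ?T)" using le[OF x(1)] w(1)[OF x(1)] by (rule mult_right_mono)
  finally have "t * f (insert y ?T) \<le> t * ((1 + \<epsilon>) * f (insert x ?T))" by (simp add: mult_ac)
  then have "f (insert y ?T) \<le> (1 + \<epsilon>) * f (insert x ?T)" using \<open>0 < t\<close> by simp
  also have "\<dots> \<le> f (insert x ?T) + \<epsilon> * opt"
    using w(2)[OF x(1)] e by (simp add: algebra_simps mult_left_mono)
  finally show ?thesis using ge(2) x(2) by simp
qed

end

section \<open>Events depending on disjoint coordinates\<close>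

lemma indep_vars_coordinates:
  fixes D :: "'b measure"
  assumes "prob_space D" and "I \<noteq> {}"
  shows "prob_space.indep_vars (PiM I (\<lambda>_. D)) (\<lambda>_. D) (\<lambda>i \<omega>. \<omega> i) I"
proof -
  let ?M = "PiM I (\<lambda>_. D)"
  interpret P: prob_space ?M by (intro prob_space_PiM assms)
  have "distr ?M ?M (\<lambda>\<omega>. restrict \<omega> I) = distr ?M ?M (\<lambda>\<omega>. \<omega>)"
    by (intro distr_cong refl) (simp add: space_PiM)
  also have "\<dots> = ?M" by (rule distr_id)
  also have "\<dots> = PiM I (\<lambda>i. distr ?M D (\<lambda>\<omega>. \<omega> i))"
    using assms by (intro PiM_cong refl distr_PiM_component[symmetric]) auto
  finally have "distr ?M ?M (\<lambda>\<omega>. \<lambda>i\<in>I. \<omega> i) = PiM I (\<lambda>i. distr ?M D (\<lambda>\<omega>. \<omega> i))" .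
  moreover have "(\<lambda>\<omega>. \<omega> i) \<in> measurable ?M D" if "i \<in> I" for i
    using that by (rule measurable_component_singleton)
  ultimately show ?thesis
    using P.indep_vars_iff_distr_eq_PiM'[OF \<open>I \<noteq> {}\<close>, of "\<lambda>i \<omega>. \<omega> i" "\<lambda>_. D"] by blast
qed

text \<open>Replaces measurability with respect to the coordinates in K: the event is measurable in
  the full product, and locality is a separate pointwise condition that is easy to check for an
  algorithm.\<close>

definition depends_on :: "('i \<Rightarrow> 'b) set \<Rightarrow> 'i set \<Rightarrow> (('i \<Rightarrow> 'b) \<Rightarrow> bool) \<Rightarrow> bool" where
  "depends_on \<Omega> K P \<longleftrightarrow> (\<forall>\<omega>\<in>\<Omega>. \<forall>\<omega>'\<in>\<Omega>. (\<forall>i\<in>K. \<omega> i = \<omega>' i) \<longrightarrow> P \<omega> = P \<omega>')"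

text \<open>Fill the coordinates outside K with a constant. This map from the smaller product to the
  larger one is measurable, and by locality P cannot see the filling.\<close>

lemma depends_on_preimage:
  fixes D :: "'b measure"
  assumes "prob_space D" and "K \<subseteq> I" and X: "{\<omega> \<in> space (PiM I (\<lambda>_. D)). P \<omega>} \<in> sets (PiM I (\<lambda>_. D))"
    and dep: "depends_on (space (PiM I (\<lambda>_. D))) K P"
  obtains X' where "X' \<in> sets (PiM K (\<lambda>_. D))"
    and "\<And>\<omega>. \<omega> \<in> space (PiM I (\<lambda>_. D)) \<Longrightarrow> P \<omega> \<longleftrightarrow> restrict \<omega> K \<in> X'"
proof -
  interpret prob_space D by fact
  obtain d where d: "d \<in> space D" using not_empty by auto
  define \<phi> where "\<phi> \<zeta> = (\<lambda>i\<in>I. if i \<in> K then \<zeta> i else d)" for \<zeta>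
  have phi: "\<phi> \<in> measurable (PiM K (\<lambda>_. D)) (PiM I (\<lambda>_. D))"
    unfolding \<phi>_def
  proof (rule measurable_restrict)
    fix i assume "i \<in> I"
    show "(\<lambda>\<zeta>. if i \<in> K then \<zeta> i else d) \<in> measurable (PiM K (\<lambda>_. D)) D"
      using d by (cases "i \<in> K") auto
  qed
  define X' where "X' = \<phi> -` {\<omega> \<in> space (PiM I (\<lambda>_. D)). P \<omega>} \<inter> space (PiM K (\<lambda>_. D))"
  show ?thesis
  proof (rule that[of X'])
    show "X' \<in> sets (PiM K (\<lambda>_. D))" unfolding X'_def using phi X by (rule measurable_sets)
    fix \<omega> assume \<omega>: "\<omega> \<in> space (PiM I (\<lambda>_. D))"
    have r: "restrict \<omega> K \<in> space (PiM K (\<lambda>_. D))" using \<omega> \<open>K \<subseteq> I\<close> by (auto simp: space_PiM)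
    have p: "\<phi> (restrict \<omega> K) \<in> space (PiM I (\<lambda>_. D))" using measurable_space[OF phi r] .
    have "\<omega> i = \<phi> (restrict \<omega> K) i" if "i \<in> K" for i
      using that \<open>K \<subseteq> I\<close> by (simp add: \<phi>_def subsetD)
    then have "P \<omega> = P (\<phi> (restrict \<omega> K))"
      using dep[unfolded depends_on_def, rule_format, OF \<omega> p] by simp
    then show "P \<omega> \<longleftrightarrow> restrict \<omega> K \<in> X'" using r p by (simp add: X'_def)
  qed
qed

lemma prob_conj_disjoint_coordinates:
  fixes D :: "'b measure" and I :: "'i set"
  defines "M \<equiv> PiM I (\<lambda>_. D)"
  assumes "prob_space D" and ne: "I \<noteq> {}" and KL: "K \<subseteq> I" "L \<subseteq> I" "K \<inter> L = {}"
    and P: "{\<omega> \<in> space M. P \<omega>} \<in> sets M" "depends_on (space M) K P"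
    and Q: "{\<omega> \<in> space M. Q \<omega>} \<in> sets M" "depends_on (space M) L Q"
  shows "measure M {\<omega> \<in> space M. P \<omega> \<and> Q \<omega>} = measure M {\<omega> \<in> space M. P \<omega>} * measure M {\<omega> \<in> space M. Q \<omega>}"
proof -
  interpret M: prob_space M unfolding M_def by (intro prob_space_PiM assms)
  obtain X where X: "X \<in> sets (PiM K (\<lambda>_. D))" "\<And>\<omega>. \<omega> \<in> space M \<Longrightarrow> P \<omega> \<longleftrightarrow> restrict \<omega> K \<in> X"
    using depends_on_preimage[OF assms(2) KL(1) P[unfolded M_def]] unfolding M_def by blast
  obtain Y where Y: "Y \<in> sets (PiM L (\<lambda>_. D))" "\<And>\<omega>. \<omega> \<in> space M \<Longrightarrow> Q \<omega> \<longleftrightarrow> restrict \<omega> L \<in> Y"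
    using depends_on_preimage[OF assms(2) KL(2) Q[unfolded M_def]] unfolding M_def by blast
  have "M.indep_var (PiM K (\<lambda>_. D)) (\<lambda>\<omega>. restrict (\<lambda>i. \<omega> i) K) (PiM L (\<lambda>_. D)) (\<lambda>\<omega>. restrict (\<lambda>i. \<omega> i) L)"
    using indep_vars_coordinates[OF assms(2) ne] KL
    unfolding M_def[symmetric] by (intro M.indep_var_restrict) auto
  from M.indep_varD[OF this X(1) Y(1)]
  have "measure M ((\<lambda>\<omega>. (restrict \<omega> K, restrict \<omega> L)) -` (X \<times> Y) \<inter> space M)
      = measure M ((\<lambda>\<omega>. restrict \<omega> K) -` X \<inter> space M) * measure M ((\<lambda>\<omega>. restrict \<omega> L) -` Y \<inter> space M)"
    by simp
  moreover have "(\<lambda>\<omega>. (restrict \<omega> K, restrict \<omega> L)) -` (X \<times> Y) \<inter> space M = {\<omega> \<in> space M. P \<omega> \<and> Q \<omega>}"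
    "(\<lambda>\<omega>. restrict \<omega> K) -` X \<inter> space M = {\<omega> \<in> space M. P \<omega>}"
    "(\<lambda>\<omega>. restrict \<omega> L) -` Y \<inter> space M = {\<omega> \<in> space M. Q \<omega>}"
    using X(2) Y(2) by auto
  ultimately show ?thesis by simp
qed

text \<open>Adaptivity costs nothing: the current set \<open>Z\<close> is determined by coordinates that are disjoint
  from those of the noise it is about to meet.\<close>

lemma prob_adaptive_choice_le:
  fixes D :: "'b measure" and I :: "'i set"
  defines "M \<equiv> PiM I (\<lambda>_. D)"
  assumes "prob_space D" and ne: "I \<noteq> {}" and KL: "K \<subseteq> I" "L \<subseteq> I" "K \<inter> L = {}" and fin: "finite \<Z>"
    and Z: "Z \<in> measurable M (count_space \<Z>)"
    and depZ: "\<And>z. depends_on (space M) K (\<lambda>\<omega>. Z \<omega> = z)"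
    and Q: "\<And>z. z \<in> \<Z> \<Longrightarrow> {\<omega> \<in> space M. Q z \<omega>} \<in> sets M"
    and depQ: "\<And>z. z \<in> \<Z> \<Longrightarrow> depends_on (space M) L (Q z)"
    and p: "\<And>z. z \<in> \<Z> \<Longrightarrow> measure M {\<omega> \<in> space M. Q z \<omega>} \<le> p"
  shows "{\<omega> \<in> space M. Q (Z \<omega>) \<omega>} \<in> sets M" and "measure M {\<omega> \<in> space M. Q (Z \<omega>) \<omega>} \<le> p"
proof -
  interpret M: prob_space M unfolding M_def by (intro prob_space_PiM assms)
  have ZZ: "Z \<omega> \<in> \<Z>" if "\<omega> \<in> space M" for \<omega> using measurable_space[OF Z that] by simp
  have Zm: "{\<omega> \<in> space M. Z \<omega> = z} \<in> sets M" if "z \<in> \<Z>" for z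
  proof -
    have "{\<omega> \<in> space M. Z \<omega> = z} = Z -` {z} \<inter> space M" by auto
    then show ?thesis using measurable_sets[OF Z, of "{z}"] that by simp
  qed
  have m: "{\<omega> \<in> space M. Z \<omega> = z \<and> Q z \<omega>} \<in> sets M" if "z \<in> \<Z>" for z
  proof -
    have "{\<omega> \<in> space M. Z \<omega> = z \<and> Q z \<omega>} = {\<omega> \<in> space M. Z \<omega> = z} \<inter> {\<omega> \<in> space M. Q z \<omega>}"
      by (rule set_eqI, simp, argo)
    then show ?thesis using sets.Int[OF Zm[OF that] Q[OF that]] by (simp only:)
  qed
  have eq: "{\<omega> \<in> space M. Q (Z \<omega>) \<omega>} = (\<Union>z\<in>\<Z>. {\<omega> \<in> space M. Z \<omega> = z \<and> Q z \<omega>})"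
    by (rule set_eqI) (simp, metis ZZ)
  show "{\<omega> \<in> space M. Q (Z \<omega>) \<omega>} \<in> sets M"
    unfolding eq by (rule sets.finite_UN[OF fin m])
  have "measure M {\<omega> \<in> space M. Q (Z \<omega>) \<omega>} \<le> (\<Sum>z\<in>\<Z>. measure M {\<omega> \<in> space M. Z \<omega> = z \<and> Q z \<omega>})"
    unfolding eq by (rule measure_UNION_le[OF fin m])
  also have "\<dots> = (\<Sum>z\<in>\<Z>. measure M {\<omega> \<in> space M. Z \<omega> = z} * measure M {\<omega> \<in> space M. Q z \<omega>})"
    using Zm Q depZ depQ unfolding M_def
    by (intro sum.cong refl prob_conj_disjoint_coordinates[OF assms(2) ne KL])
  also have "\<dots> \<le> (\<Sum>z\<in>\<Z>. measure M {\<omega> \<in> space M. Z \<omega> = z} * p)"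
    using p by (intro sum_mono mult_left_mono) auto
  also have "\<dots> = measure M (\<Union>z\<in>\<Z>. {\<omega> \<in> space M. Z \<omega> = z}) * p"
  proof (subst M.finite_measure_finite_Union)
    show "disjoint_family_on (\<lambda>z. {\<omega> \<in> space M. Z \<omega> = z}) \<Z>" by (auto simp: disjoint_family_on_def)
    show "(\<lambda>z. {\<omega> \<in> space M. Z \<omega> = z}) ` \<Z> \<subseteq> sets M" using Zm by (rule image_subsetI)
  qed (simp_all add: fin sum_distrib_right)
  also have "(\<Union>z\<in>\<Z>. {\<omega> \<in> space M. Z \<omega> = z}) = space M" using ZZ by auto
  finally show "measure M {\<omega> \<in> space M. Q (Z \<omega>) \<omega>} \<le> p" by (simp add: M.prob_space)
qed

section \<open>Union bound, products and Hoeffding's inequality for coordinates\<close>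

lemma measure_PiM_coordinate:
  assumes "prob_space D" "i \<in> I" "{x \<in> space D. Q x} \<in> sets D"
  shows "measure (PiM I (\<lambda>_. D)) {\<omega> \<in> space (PiM I (\<lambda>_. D)). Q (\<omega> i)} = measure D {x \<in> space D. Q x}"
proof -
  have "measure D {x \<in> space D. Q x} = measure (distr (PiM I (\<lambda>_. D)) D (\<lambda>\<omega>. \<omega> i)) {x \<in> space D. Q x}"
    using distr_PiM_component[of I "\<lambda>_. D" i] assms by simp
  also have "\<dots> = measure (PiM I (\<lambda>_. D)) {\<omega> \<in> space (PiM I (\<lambda>_. D)). Q (\<omega> i)}"
    using assms by (subst measure_distr) (auto intro!: arg_cong[where f="measure _"] simp: space_PiM)
  finally show ?thesis by simp
qed

lemma prob_exists_coordinate_le: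
  assumes "prob_space D" "finite J" "J \<subseteq> I" "{x \<in> space D. Q x} \<in> sets D"
  shows "{\<omega> \<in> space (PiM I (\<lambda>_. D)). \<exists>i\<in>J. Q (\<omega> i)} \<in> sets (PiM I (\<lambda>_. D))"
    and "measure (PiM I (\<lambda>_. D)) {\<omega> \<in> space (PiM I (\<lambda>_. D)). \<exists>i\<in>J. Q (\<omega> i)}
      \<le> real (card J) * measure D {x \<in> space D. Q x}"
proof -
  let ?M = "PiM I (\<lambda>_. D)"
  have m: "{\<omega> \<in> space ?M. Q (\<omega> i)} \<in> sets ?M" if "i \<in> J" for i
  proof -
    have "{\<omega> \<in> space ?M. Q (\<omega> i)} = (\<lambda>\<omega>. \<omega> i) -` {x \<in> space D. Q x} \<inter> space ?M"
      using that assms(3) by (auto simp: space_PiM)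
    then show ?thesis using that assms by (auto intro!: measurable_sets[of _ ?M D])
  qed
  have eq: "{\<omega> \<in> space ?M. \<exists>i\<in>J. Q (\<omega> i)} = (\<Union>i\<in>J. {\<omega> \<in> space ?M. Q (\<omega> i)})" by auto
  show "{\<omega> \<in> space ?M. \<exists>i\<in>J. Q (\<omega> i)} \<in> sets ?M" unfolding eq using assms m by auto
  have "measure ?M {\<omega> \<in> space ?M. \<exists>i\<in>J. Q (\<omega> i)} \<le> (\<Sum>i\<in>J. measure ?M {\<omega> \<in> space ?M. Q (\<omega> i)})"
    unfolding eq using assms m by (intro measure_UNION_le) auto
  also have "\<dots> = (\<Sum>i\<in>J. measure D {x \<in> space D. Q x})"
    using assms by (intro sum.cong refl measure_PiM_coordinate) auto
  finally show "measure ?M {\<omega> \<in> space ?M. \<exists>i\<in>J. Q (\<omega> i)} \<le> real (card J) * measure D {x \<in> space D. Q x}"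
    by simp
qed

lemma prob_all_coordinates:
  assumes "prob_space D" "finite J" "J \<subseteq> I" "{x \<in> space D. Q x} \<in> sets D"
  shows "{\<omega> \<in> space (PiM I (\<lambda>_. D)). \<forall>i\<in>J. Q (\<omega> i)} \<in> sets (PiM I (\<lambda>_. D))"
    and "measure (PiM I (\<lambda>_. D)) {\<omega> \<in> space (PiM I (\<lambda>_. D)). \<forall>i\<in>J. Q (\<omega> i)} = measure D {x \<in> space D. Q x} ^ card J"
proof -
  interpret D: prob_space D by fact
  interpret product_prob_space "\<lambda>_. D" I by unfold_locales
  have eq: "{\<omega> \<in> space (PiM I (\<lambda>_. D)). \<forall>i\<in>J. Q (\<omega> i)}
      = prod_emb I (\<lambda>_. D) J (PiE J (\<lambda>_. {x \<in> space D. Q x}))"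
  proof (rule set_eqI)
    fix \<omega>
    have "(\<forall>i\<in>J. Q (\<omega> i)) \<longleftrightarrow> restrict \<omega> J \<in> PiE J (\<lambda>_. {x \<in> space D. Q x})"
      if \<omega>: "\<omega> \<in> PiE I (\<lambda>_. space D)"
    proof -
      have "\<omega> i \<in> space D" if "i \<in> J" for i using PiE_mem[OF \<omega>] that assms(3) by blast
      then show ?thesis by (simp add: restrict_PiE_iff Pi_iff)
    qed
    then show "\<omega> \<in> {\<omega> \<in> space (PiM I (\<lambda>_. D)). \<forall>i\<in>J. Q (\<omega> i)} \<longleftrightarrow>
        \<omega> \<in> prod_emb I (\<lambda>_. D) J (PiE J (\<lambda>_. {x \<in> space D. Q x}))"
      by (simp only: prod_emb_def space_PiM mem_Collect_eq Int_iff vimage_eq) blast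
  qed
  show "{\<omega> \<in> space (PiM I (\<lambda>_. D)). \<forall>i\<in>J. Q (\<omega> i)} \<in> sets (PiM I (\<lambda>_. D))"
    unfolding eq using assms by (intro sets_PiM_I) auto
  show "measure (PiM I (\<lambda>_. D)) {\<omega> \<in> space (PiM I (\<lambda>_. D)). \<forall>i\<in>J. Q (\<omega> i)} = measure D {x \<in> space D. Q x} ^ card J"
    unfolding eq using assms by (subst measure_PiM_emb) auto
qed

text \<open>Here \<open>h\<close> will be the truncation of the noise and the weights
  \<open>w\<close> the true values of the queried sets, so each summand lies between 0 and l
  B.\<close>

lemma Hoeffding_coordinates:
  fixes D :: "real measure" and w :: "'i \<Rightarrow> real" and h :: "real \<Rightarrow> real"
  assumes "prob_space D" and sets: "sets D = sets borel" and J: "finite J" "J \<subseteq> I" "J \<noteq> {}"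
    and h: "h \<in> borel_measurable borel" "\<And>x. 0 \<le> h x" "\<And>x. h x \<le> l" and "0 < l"
    and w: "\<And>i. i \<in> J \<Longrightarrow> 0 \<le> w i" "\<And>i. i \<in> J \<Longrightarrow> w i \<le> B" and "0 < B" and "0 \<le> \<eta>"
  shows "{\<omega> \<in> space (PiM I (\<lambda>_. D)). \<eta> \<le> \<bar>(\<Sum>i\<in>J. h (\<omega> i) * w i) - (\<integral>x. h x \<partial>D) * (\<Sum>i\<in>J. w i)\<bar>}
      \<in> sets (PiM I (\<lambda>_. D))"
    and "measure (PiM I (\<lambda>_. D))
      {\<omega> \<in> space (PiM I (\<lambda>_. D)). \<eta> \<le> \<bar>(\<Sum>i\<in>J. h (\<omega> i) * w i) - (\<integral>x. h x \<partial>D) * (\<Sum>i\<in>J. w i)\<bar>}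
      \<le> 2 * exp (- 2 * \<eta>\<^sup>2 / (real (card J) * (l * B)\<^sup>2))"
proof -
  let ?M = "PiM I (\<lambda>_. D)"
  interpret D: prob_space D by fact
  interpret M: prob_space ?M by (intro prob_space_PiM assms)
  have hD: "h \<in> borel_measurable D" using h(1) sets measurable_cong_sets by blast
  have c: "(\<lambda>\<omega>. \<omega> i) \<in> measurable ?M D" if "i \<in> J" for i using that J by auto
  have hc: "(\<lambda>\<omega>. h (\<omega> i)) \<in> borel_measurable ?M" if "i \<in> J" for i
    using measurable_compose[OF c[OF that] hD] .
  have E: "M.expectation (\<lambda>\<omega>. h (\<omega> i) * w i) = (\<integral>x. h x \<partial>D) * w i" if "i \<in> J" for i
  proof -
    have "(\<integral>x. h x \<partial>D) = (\<integral>x. h x \<partial>distr ?M D (\<lambda>\<omega>. \<omega> i))"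
      using distr_PiM_component[of I "\<lambda>_. D" i] assms that by auto
    also have "\<dots> = M.expectation (\<lambda>\<omega>. h (\<omega> i))" using c[OF that] hD by (rule integral_distr)
    finally show ?thesis by simp
  qed
  have "M.indep_vars (\<lambda>_. D) (\<lambda>i \<omega>. \<omega> i) J"
    using J by (intro M.indep_vars_subset[OF indep_vars_coordinates[OF assms(1)]]) auto
  then have ind: "M.indep_vars (\<lambda>_. borel) (\<lambda>i \<omega>. h (\<omega> i) * w i) J"
    by (rule M.indep_vars_compose2[where Y="\<lambda>i x. h x * w i"]) (use hD in auto)
  interpret H: Hoeffding_ineq ?M J "\<lambda>i \<omega>. h (\<omega> i) * w i" "\<lambda>_. 0" "\<lambda>_. l * B"
    "\<Sum>i\<in>J. M.expectation (\<lambda>\<omega>. h (\<omega> i) * w i)"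
  proof unfold_locales
    show "AE \<omega> in ?M. h (\<omega> i) * w i \<in> {0..l * B}" if "i \<in> J" for i
      using h w[OF that] \<open>0 < l\<close> by (auto intro!: mult_mono)
  qed (use J ind in auto)
  have mu: "(\<Sum>i\<in>J. M.expectation (\<lambda>\<omega>. h (\<omega> i) * w i)) = (\<integral>x. h x \<partial>D) * (\<Sum>i\<in>J. w i)"
    unfolding sum_distrib_left by (intro sum.cong refl E)
  have pos: "0 < (\<Sum>i\<in>J. (l * B - 0)\<^sup>2)" using J \<open>0 < l\<close> \<open>0 < B\<close> by (intro sum_pos) auto
  show "measure ?M {\<omega> \<in> space ?M. \<eta> \<le> \<bar>(\<Sum>i\<in>J. h (\<omega> i) * w i) - (\<integral>x. h x \<partial>D) * (\<Sum>i\<in>J. w i)\<bar>}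
      \<le> 2 * exp (- 2 * \<eta>\<^sup>2 / (real (card J) * (l * B)\<^sup>2))"
    using H.Hoeffding_ineq_abs_ge[OF \<open>0 \<le> \<eta>\<close> pos] unfolding mu by simp
  show "{\<omega> \<in> space ?M. \<eta> \<le> \<bar>(\<Sum>i\<in>J. h (\<omega> i) * w i) - (\<integral>x. h x \<partial>D) * (\<Sum>i\<in>J. w i)\<bar>} \<in> sets ?M"
    by (intro borel_measurable_le borel_measurable_const borel_measurable_abs borel_measurable_diff
        borel_measurable_sum borel_measurable_times hc)
qed

section \<open>Success probability\<close>

text \<open>The cut at 0 is the one made in the scores; the cut at \<open>l\<close> provides the
  bounded range for Hoeffding's inequality and changes a score only if some multiplier exceeds
  \<open>l\<close>.\<close>

definition truncate :: "real \<Rightarrow> real \<Rightarrow> real" where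
  "truncate l x = min (max 0 x) l"

lemma measurable_noisy_oracle:
  fixes D :: "real measure"
  assumes "sets D = sets borel"
  shows "(\<lambda>\<xi>. restrict (noisy_oracle f \<xi>) (Pow N)) \<in> measurable (PiM (Pow N) (\<lambda>_. D)) (PiM (Pow N) (\<lambda>_. borel))"
proof (rule measurable_restrict)
  fix S assume S: "S \<in> Pow N"
  have "(\<lambda>\<xi>. \<xi> S) \<in> measurable (PiM (Pow N) (\<lambda>_. D)) D"
    using S by (rule measurable_component_singleton)
  then have "(\<lambda>\<xi>. \<xi> S) \<in> borel_measurable (PiM (Pow N) (\<lambda>_. D))"
    by (simp only: measurable_cong_sets[OF refl assms])
  then show "(\<lambda>\<xi>. noisy_oracle f \<xi> S) \<in> borel_measurable (PiM (Pow N) (\<lambda>_. D))"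
    unfolding noisy_oracle_def by (intro borel_measurable_times borel_measurable_const)
qed

text \<open>The noisy oracle is defined on all sets, whereas points of the product space are
  undefined outside \<open>Pow N\<close>. A tree that asks only subsets of N does not notice the
  restriction.\<close>

lemma measurable_strategy_result:
  fixes D :: "real measure"
  assumes "sets D = sets borel" and "queries_within N T"
    and "result T \<in> measurable (PiM (Pow N) (\<lambda>_. borel)) (count_space (Pow N))"
  shows "(\<lambda>\<xi>. result T (noisy_oracle f \<xi>)) \<in> measurable (PiM (Pow N) (\<lambda>_. D)) (count_space (Pow N))"
proof -
  have "result T (noisy_oracle f \<xi>) = result T (restrict (noisy_oracle f \<xi>) (Pow N))" for \<xi>
    using assms(2) by (rule result_cong_queries_within) simp
  then show ?thesis
    using measurable_compose[OF measurable_noisy_oracle[OF assms(1)] assms(3)] by simp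
qed

context
  fixes N H :: "'a set" and f :: "'a set \<Rightarrow> real" and r :: nat and opt :: real and D :: "real measure"
  assumes fin: "finite N" and H: "H \<subseteq> N" and ms: "monotone_submodular N f"
    and opt: "\<And>T. T \<subseteq> N \<Longrightarrow> card T \<le> r \<Longrightarrow> f T \<le> opt" and opt_pos: "0 < opt"
    and D: "prob_space D" and setsD: "sets D = sets borel"
    and r: "r \<le> card N" "r < card H"
begin

abbreviation noise :: "('a set \<Rightarrow> real) measure" where
  "noise \<equiv> PiM (Pow N) (\<lambda>_. D)"

lemma finite_H: "finite H"
  by (rule finite_subset[OF H fin])

lemma f_bounds: "T \<subseteq> N \<Longrightarrow> card T \<le> r \<Longrightarrow> 0 \<le> f T \<and> f T \<le> opt"
  using ms opt by (auto simp: monotone_submodular_def)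

lemma measurable_noise_greedy:
  assumes "i \<le> card N"
  shows "(\<lambda>\<xi>. greedy N H (noisy_oracle f \<xi>) i) \<in> measurable noise (count_space {S. S \<subseteq> N \<and> card S = i})"
proof -
  have "greedy N H (noisy_oracle f \<xi>) i = greedy N H (restrict (noisy_oracle f \<xi>) (Pow N)) i" for \<xi>
    by (rule greedy_cong[OF fin H assms]) simp
  then show ?thesis
    using measurable_compose[OF measurable_noisy_oracle[OF setsD] measurable_greedy[OF fin H assms]] by simp
qed

lemma greedy_depends_on:
  assumes "i \<le> card N"
  shows "depends_on \<Omega> {T. T \<subseteq> N \<and> card T \<le> Suc i} (\<lambda>\<xi>. greedy N H (noisy_oracle f \<xi>) i = S)"
  unfolding depends_on_def
proof (intro ballI impI)
  fix \<xi> \<xi>' :: "'a set \<Rightarrow> real" assume "\<forall>T\<in>{T. T \<subseteq> N \<and> card T \<le> Suc i}. \<xi> T = \<xi>' T"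
  then have "greedy N H (noisy_oracle f \<xi>) i = greedy N H (noisy_oracle f \<xi>') i"
    by (intro greedy_cong[OF fin H assms]) (simp add: noisy_oracle_def)
  then show "(greedy N H (noisy_oracle f \<xi>) i = S) = (greedy N H (noisy_oracle f \<xi>') i = S)" by simp
qed

definition completions :: "'a set \<Rightarrow> 'a set set" where
  "completions T = (\<lambda>x. insert x T) ` (H - T)"

lemma completions_props:
  assumes "T \<subseteq> N" "card T < r"
  shows "finite (completions T)" "completions T \<noteq> {}" "completions T \<subseteq> Pow N" "card (completions T) \<le> card H"
    "\<And>U. U \<in> completions T \<Longrightarrow> card U = Suc (card T)"
    "sum h (completions T) = (\<Sum>x\<in>H - T. h (insert x T))"
proof -
  have fT: "finite T" by (rule finite_subset[OF assms(1) fin])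
  show "finite (completions T)" using finite_H by (simp add: completions_def)
  show "completions T \<noteq> {}" using card_mono[OF fT, of H] r assms by (auto simp: completions_def)
  show "completions T \<subseteq> Pow N" using H assms by (auto simp: completions_def)
  have "card (completions T) \<le> card (H - T)" unfolding completions_def using finite_H by (intro card_image_le) auto
  also have "\<dots> \<le> card H" using finite_H by (intro card_mono) auto
  finally show "card (completions T) \<le> card H" .
  show "\<And>U. U \<in> completions T \<Longrightarrow> card U = Suc (card T)" using fT by (auto simp: completions_def)
  have "inj_on (\<lambda>x. insert x T) (H - T)" by (auto simp: inj_on_def)
  then show "sum h (completions T) = (\<Sum>x\<in>H - T. h (insert x T))"
    unfolding completions_def by (simp add: sum.reindex)
qed

text \<open>Formulated for a fixed S and all candidates at once, so that it involves only noise of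
  sets of size |S| + 2. Outside the first alternative the truncated sum is the actual score.\<close>

definition bad_step :: "real \<Rightarrow> real \<Rightarrow> 'a set \<Rightarrow> ('a set \<Rightarrow> real) \<Rightarrow> bool" where
  "bad_step l \<eta> S \<xi> \<longleftrightarrow> (\<exists>e\<in>N - S.
     (\<exists>T\<in>completions (insert e S). l < \<xi> T) \<or>
     \<eta> \<le> \<bar>(\<Sum>T\<in>completions (insert e S). truncate l (\<xi> T) * f T)
        - (\<integral>x. truncate l x \<partial>D) * (\<Sum>T\<in>completions (insert e S). f T)\<bar>)"

text \<open>The two ways in which the selection can be misled: a completion has too large a
  multiplier, or no completion of value at least \<open>v\<close> has a multiplier reaching
  t.\<close>

definition bad_finish :: "real \<Rightarrow> real \<Rightarrow> real \<Rightarrow> 'a set \<Rightarrow> ('a set \<Rightarrow> real) \<Rightarrow> bool" where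
  "bad_finish \<epsilon> t v S \<xi> \<longleftrightarrow>
     (\<exists>T\<in>completions (pad N S). (1 + \<epsilon>) * t < \<xi> T) \<or>
     (\<forall>T\<in>{T \<in> completions (pad N S). v \<le> f T}. \<xi> T < t)"

lemma bad_step_prob:
  assumes S: "S \<subseteq> N" "card S + 2 \<le> r" and l: "0 < l" and \<eta>: "0 \<le> \<eta>"
  shows "{\<xi> \<in> space noise. bad_step l \<eta> S \<xi>} \<in> sets noise"
    and "measure noise {\<xi> \<in> space noise. bad_step l \<eta> S \<xi>} \<le> real (card N) *
      (real (card H) * measure D {l<..} + 2 * exp (- 2 * \<eta>\<^sup>2 / (real (card H) * (l * opt)\<^sup>2)))"
    and "depends_on (space noise) {T. T \<subseteq> N \<and> card T = card S + 2} (bad_step l \<eta> S)"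
proof -
  interpret M: prob_space noise by (intro prob_space_PiM D)
  have spD: "space D = UNIV" using setsD by (simp add: sets_eq_imp_space_eq)
  have fS: "finite S" by (rule finite_subset[OF S(1) fin])
  define A where "A e = {\<xi> \<in> space noise. \<exists>T\<in>completions (insert e S). l < \<xi> T}" for e
  define B where "B e = {\<xi> \<in> space noise. \<eta> \<le> \<bar>(\<Sum>T\<in>completions (insert e S). truncate l (\<xi> T) * f T)
        - (\<integral>x. truncate l x \<partial>D) * (\<Sum>T\<in>completions (insert e S). f T)\<bar>}" for e
  have J: "insert e S \<subseteq> N" "card (insert e S) < r" "card (insert e S) = Suc (card S)" if "e \<in> N - S" for e
    using that S fS by auto
  have A: "A e \<in> sets noise" "measure noise (A e) \<le> real (card H) * measure D {l<..}" if e: "e \<in> N - S" for e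
  proof -
    note c = completions_props[OF J(1,2)[OF e]]
    have eq: "{x \<in> space D. l < x} = {l<..}" using spD by auto
    have m: "{x \<in> space D. l < x} \<in> sets D" unfolding eq using setsD by simp
    from prob_exists_coordinate_le[OF D c(1,3) m] show "A e \<in> sets noise" unfolding A_def by simp
    have "measure noise (A e) \<le> real (card (completions (insert e S))) * measure D {l<..}"
      using prob_exists_coordinate_le(2)[OF D c(1,3) m] unfolding A_def eq .
    also have "\<dots> \<le> real (card H) * measure D {l<..}" using c(4) by (intro mult_right_mono) auto
    finally show "measure noise (A e) \<le> real (card H) * measure D {l<..}" .
  qed
  have B: "B e \<in> sets noise"
    "measure noise (B e) \<le> 2 * exp (- 2 * \<eta>\<^sup>2 / (real (card H) * (l * opt)\<^sup>2))" if e: "e \<in> N - S" for e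
  proof -
    note c = completions_props[OF J(1,2)[OF e]]
    have fT: "0 \<le> f T" "f T \<le> opt" if "T \<in> completions (insert e S)" for T
      using f_bounds[of T] c(3) c(5)[OF that] that J[OF e] S(2) by auto
    have h: "truncate l \<in> borel_measurable borel" "\<And>x. 0 \<le> truncate l x" "\<And>x. truncate l x \<le> l"
      using l by (auto simp: truncate_def[abs_def])
    note hoeff = Hoeffding_coordinates[OF D setsD c(1,3,2) h l fT opt_pos \<eta>]
    show "B e \<in> sets noise" unfolding B_def by (rule hoeff(1))
    have "measure noise (B e) \<le> 2 * exp (- 2 * \<eta>\<^sup>2 / (real (card (completions (insert e S))) * (l * opt)\<^sup>2))"
      unfolding B_def by (rule hoeff(2))
    also have "\<dots> \<le> 2 * exp (- 2 * \<eta>\<^sup>2 / (real (card H) * (l * opt)\<^sup>2))"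
    proof -
      have "0 < card (completions (insert e S))" using c by (simp add: card_gt_0_iff)
      then have "2 * \<eta>\<^sup>2 / (real (card H) * (l * opt)\<^sup>2) \<le> 2 * \<eta>\<^sup>2 / (real (card (completions (insert e S))) * (l * opt)\<^sup>2)"
        using c(4) l opt_pos by (intro divide_left_mono mult_right_mono mult_pos_pos) auto
      then show ?thesis by simp
    qed
    finally show "measure noise (B e) \<le> 2 * exp (- 2 * \<eta>\<^sup>2 / (real (card H) * (l * opt)\<^sup>2))" .
  qed
  have eq: "{\<xi> \<in> space noise. bad_step l \<eta> S \<xi>} = (\<Union>e\<in>N - S. A e \<union> B e)"
    unfolding bad_step_def A_def B_def by blast
  have fNS: "finite (N - S)" using fin by simp
  have AB: "A e \<union> B e \<in> sets noise" if "e \<in> N - S" for e using A(1)[OF that] B(1)[OF that] by (rule sets.Un)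
  show "{\<xi> \<in> space noise. bad_step l \<eta> S \<xi>} \<in> sets noise"
    unfolding eq by (rule sets.finite_UN[OF fNS AB])
  let ?p = "real (card H) * measure D {l<..} + 2 * exp (- 2 * \<eta>\<^sup>2 / (real (card H) * (l * opt)\<^sup>2))"
  have "measure noise {\<xi> \<in> space noise. bad_step l \<eta> S \<xi>} \<le> (\<Sum>e\<in>N - S. measure noise (A e \<union> B e))"
    unfolding eq by (rule measure_UNION_le[OF fNS AB])
  also have "\<dots> \<le> (\<Sum>e\<in>N - S. ?p)"
  proof (rule sum_mono)
    fix e assume e: "e \<in> N - S"
    have "measure noise (A e \<union> B e) \<le> measure noise (A e) + measure noise (B e)"
      using A(1)[OF e] B(1)[OF e] by (rule measure_Un_le)
    then show "measure noise (A e \<union> B e) \<le> ?p" using A(2)[OF e] B(2)[OF e] by linarith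
  qed
  also have "\<dots> = real (card (N - S)) * ?p" by simp
  also have "\<dots> \<le> real (card N) * ?p" using fin by (intro mult_right_mono) (auto intro!: card_mono add_nonneg_nonneg)
  finally show "measure noise {\<xi> \<in> space noise. bad_step l \<eta> S \<xi>} \<le> real (card N) * ?p" .
  show "depends_on (space noise) {T. T \<subseteq> N \<and> card T = card S + 2} (bad_step l \<eta> S)"
    unfolding depends_on_def
  proof (intro ballI impI)
    fix \<xi> \<xi>' :: "'a set \<Rightarrow> real" assume *: "\<forall>T\<in>{T. T \<subseteq> N \<and> card T = card S + 2}. \<xi> T = \<xi>' T"
    have agree: "\<xi> T = \<xi>' T" if "e \<in> N - S" "T \<in> completions (insert e S)" for e T
      using * completions_props(3,5)[OF J(1,2)[OF that(1)]] that J(3)[OF that(1)] by force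
    have ex: "(\<exists>T\<in>completions (insert e S). l < \<xi> T) = (\<exists>T\<in>completions (insert e S). l < \<xi>' T)"
      if "e \<in> N - S" for e
      using agree[OF that] by (intro bex_cong) auto
    have su: "(\<Sum>T\<in>completions (insert e S). truncate l (\<xi> T) * f T)
        = (\<Sum>T\<in>completions (insert e S). truncate l (\<xi>' T) * f T)" if "e \<in> N - S" for e
      using agree[OF that] by (intro sum.cong) auto
    show "bad_step l \<eta> S \<xi> = bad_step l \<eta> S \<xi>'"
      unfolding bad_step_def by (rule bex_cong[OF refl]) (simp only: ex su)
  qed
qed

text \<open>As f is nonnegative and no multiplier exceeds \<open>l\<close>, cutting the noisy value
  at 0 is the same as truncating the multiplier.\<close>

lemma not_bad_step_score:
  assumes S: "S \<subseteq> N" "card S + 2 \<le> r" and l: "0 < l" and good: "\<not> bad_step l \<eta> S \<xi>" and e: "e \<in> N - S"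
  shows "\<bar>score H (noisy_oracle f \<xi>) (insert e S)
      - (\<integral>x. truncate l x \<partial>D) * (\<Sum>x\<in>H - insert e S. f (insert x (insert e S)))\<bar> \<le> \<eta>"
proof -
  have J: "insert e S \<subseteq> N" "card (insert e S) < r" "card (insert e S) = Suc (card S)"
    using e S finite_subset[OF S(1) fin] by auto
  note c = completions_props[OF J(1,2)]
  have "score H (noisy_oracle f \<xi>) (insert e S)
      = (\<Sum>T\<in>completions (insert e S). max 0 (noisy_oracle f \<xi> T))"
    unfolding score_def by (rule c(6)[symmetric])
  also have "\<dots> = (\<Sum>T\<in>completions (insert e S). truncate l (\<xi> T) * f T)"
  proof (rule sum.cong[OF refl])
    fix T assume T: "T \<in> completions (insert e S)"
    have "0 \<le> f T" using f_bounds[of T] c(3) c(5)[OF T] T J S(2) by auto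
    moreover have "\<xi> T \<le> l" using good e T unfolding bad_step_def by force
    ultimately show "max 0 (noisy_oracle f \<xi> T) = truncate l (\<xi> T) * f T"
      using l by (auto simp: noisy_oracle_def truncate_def max_def min_def mult_le_0_iff zero_le_mult_iff)
  qed
  finally show ?thesis using good e unfolding bad_step_def c(6)[of f, symmetric] by force
qed

lemma bad_finish_prob:
  assumes S: "S \<subseteq> N" "card S + 2 \<le> r"
    and k: "k \<le> card {T \<in> completions (pad N S). v \<le> f T}"
  shows "{\<xi> \<in> space noise. bad_finish \<epsilon> t v S \<xi>} \<in> sets noise"
    and "measure noise {\<xi> \<in> space noise. bad_finish \<epsilon> t v S \<xi>}
      \<le> real (card H) * measure D {(1 + \<epsilon>) * t<..} + (1 - measure D {t..}) ^ k"
    and "depends_on (space noise) {T. T \<subseteq> N \<and> card T = card S + 2} (bad_finish \<epsilon> t v S)"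
proof -
  interpret D: prob_space D by (rule D)
  have spD: "space D = UNIV" using setsD by (simp add: sets_eq_imp_space_eq)
  have "card S < card N" using S r by simp
  note pad = pad_props[OF fin H S(1) this]
  have "card (pad N S) < r" using pad(2) S by simp
  note c = completions_props[OF pad(1) this]
  let ?J = "completions (pad N S)" and ?J' = "{T \<in> completions (pad N S). v \<le> f T}"
  have fJ': "finite ?J'" "?J' \<subseteq> Pow N" using c by auto
  define A where "A = {\<xi> \<in> space noise. \<exists>T\<in>?J. (1 + \<epsilon>) * t < \<xi> T}"
  define B where "B = {\<xi> \<in> space noise. \<forall>T\<in>?J'. \<xi> T < t}"
  have eqA: "{x \<in> space D. (1 + \<epsilon>) * t < x} = {(1 + \<epsilon>) * t<..}" using spD by auto
  have mA: "{x \<in> space D. (1 + \<epsilon>) * t < x} \<in> sets D" unfolding eqA using setsD by simp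
  have eqB: "{x \<in> space D. x < t} = space D - {t..}" using spD by auto
  have mB: "{x \<in> space D. x < t} \<in> sets D" unfolding eqB using setsD by (intro sets.Diff sets.top) simp
  have A: "A \<in> sets noise" unfolding A_def by (rule prob_exists_coordinate_le(1)[OF D c(1,3) mA])
  have B: "B \<in> sets noise" unfolding B_def by (rule prob_all_coordinates(1)[OF D fJ' mB])
  have "measure noise A \<le> real (card ?J) * measure D {(1 + \<epsilon>) * t<..}"
    using prob_exists_coordinate_le(2)[OF D c(1,3) mA] unfolding A_def eqA .
  also have "\<dots> \<le> real (card H) * measure D {(1 + \<epsilon>) * t<..}" using c(4) by (intro mult_right_mono) auto
  finally have pA: "measure noise A \<le> real (card H) * measure D {(1 + \<epsilon>) * t<..}" .
  have "measure noise B = (1 - measure D {t..}) ^ card ?J'"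
    using prob_all_coordinates(2)[OF D fJ' mB] D.prob_compl[of "{t..}"] setsD unfolding B_def eqB by simp
  also have "\<dots> \<le> (1 - measure D {t..}) ^ k" using k by (intro power_decreasing) auto
  finally have pB: "measure noise B \<le> (1 - measure D {t..}) ^ k" .
  have eq: "{\<xi> \<in> space noise. bad_finish \<epsilon> t v S \<xi>} = A \<union> B"
    unfolding bad_finish_def A_def B_def by blast
  show "{\<xi> \<in> space noise. bad_finish \<epsilon> t v S \<xi>} \<in> sets noise" unfolding eq using A B by (rule sets.Un)
  show "measure noise {\<xi> \<in> space noise. bad_finish \<epsilon> t v S \<xi>}
      \<le> real (card H) * measure D {(1 + \<epsilon>) * t<..} + (1 - measure D {t..}) ^ k"
    unfolding eq using measure_Un_le[OF A B] pA pB by linarith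
  show "depends_on (space noise) {T. T \<subseteq> N \<and> card T = card S + 2} (bad_finish \<epsilon> t v S)"
    unfolding depends_on_def
  proof (intro ballI impI)
    fix \<xi> \<xi>' :: "'a set \<Rightarrow> real" assume *: "\<forall>T\<in>{T. T \<subseteq> N \<and> card T = card S + 2}. \<xi> T = \<xi>' T"
    have "\<xi> T = \<xi>' T" if "T \<in> ?J" for T using * c(3) c(5)[OF that] that pad(2) by force
    then show "bad_finish \<epsilon> t v S \<xi> = bad_finish \<epsilon> t v S \<xi>'"
      unfolding bad_finish_def by (auto)
  qed
qed

lemma card_good_completions:
  "card {T \<in> completions U. v \<le> f T} = card {x \<in> H - U. v \<le> f (insert x U)}"
proof -
  have "{T \<in> completions U. v \<le> f T} = (\<lambda>x. insert x U) ` {x \<in> H - U. v \<le> f (insert x U)}"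
    by (auto simp: completions_def)
  moreover have "inj_on (\<lambda>x. insert x U) {x \<in> H - U. v \<le> f (insert x U)}" by (auto simp: inj_on_def)
  ultimately show ?thesis by (simp add: card_image)
qed

section \<open>Success probability of a whole run\<close>

text \<open>A union bound over the r - 2 steps and the final selection. Each bad event concerns the
  random current set, but its probability is bounded by that for a fixed set, because the set is
  determined by smaller levels.\<close>

lemma greedy_success_probability:
  fixes \<epsilon> t l \<eta> :: real and k :: nat
  defines "\<mu> \<equiv> \<integral>x. truncate l x \<partial>D"
  assumes Z: "Z \<subseteq> N" "card Z \<le> r" "f Z = opt" and "2 \<le> r"
    and e: "0 \<le> \<epsilon>" "\<epsilon> \<le> 1" and "0 < t" and l: "0 < l" and "0 < \<mu>" and "0 \<le> \<eta>"
    and k: "real k \<le> \<epsilon> * real (card H) - real r"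
    and p1: "real (card N) * (real (card H) * measure D {l<..}
        + 2 * exp (- 2 * (\<mu> * \<eta>)\<^sup>2 / (real (card H) * (l * opt)\<^sup>2))) \<le> p1"
    and p2: "real (card H) * measure D {(1 + \<epsilon>) * t<..} + (1 - measure D {t..}) ^ k \<le> p2"
  shows "1 - (real r * p1 + p2) \<le> measure noise {\<xi> \<in> space noise.
     opt * (1 - (1 - 1 / real r) ^ (r - 2)) - 2 * real r * (\<eta> + real r * opt) / real (card H) - 2 * \<epsilon> * opt
       \<le> f (result (greedy_strategy N H (r - 2) {}) (noisy_oracle f \<xi>))}"
proof -
  interpret M: prob_space noise by (intro prob_space_PiM D)
  \<comment> \<open>Two of the r elements are reserved, one for padding and one for the final
    selection.\<close>
  define s where "s = r - 2"
  have s: "s + 2 = r" using \<open>2 \<le> r\<close> by (simp add: s_def)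
  define m where "m = real (card H)"
  have m: "0 < m" using r by (simp add: m_def)
  let ?S = "\<lambda>i \<xi>. greedy N H (noisy_oracle f \<xi>) i"
  let ?L = "\<lambda>i. {T. T \<subseteq> N \<and> card T = i + 2}"
  \<comment> \<open>The threshold is a function of the set alone; for each fixed set the final bad
    event therefore depends on fresh noise only.\<close>
  define v where "v S = smoothed H f S / m - \<epsilon> * opt" for S
  define Bs where "Bs i = {\<xi> \<in> space noise. bad_step l (\<mu> * \<eta>) (?S i \<xi>) \<xi>}" for i
  define Bf where "Bf = {\<xi> \<in> space noise. bad_finish \<epsilon> t (v (?S s \<xi>)) (?S s \<xi>) \<xi>}"
  have Pow_ne: "Pow N \<noteq> {}" by blast
  have finZ: "finite {S. S \<subseteq> N \<and> card S = i}" for i using fin by simp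
  have Bs: "Bs i \<in> sets noise" "measure noise (Bs i) \<le> p1" if i: "i < s" for i
  proof -
    have iN: "i \<le> card N" using i s r by simp
    have \<eta>': "0 \<le> \<mu> * \<eta>" using \<open>0 < \<mu>\<close> \<open>0 \<le> \<eta>\<close> by simp
    have c: "S \<subseteq> N" "card S + 2 \<le> r" "card S = i" if "S \<in> {S. S \<subseteq> N \<and> card S = i}" for S
      using that i s by auto
    have p: "measure noise {\<xi> \<in> space noise. bad_step l (\<mu> * \<eta>) S \<xi>} \<le> p1"
      if "S \<in> {S. S \<subseteq> N \<and> card S = i}" for S
      using bad_step_prob(2)[OF c(1,2)[OF that] l \<eta>'] p1 by linarith
    have d: "depends_on (space noise) (?L i) (bad_step l (\<mu> * \<eta>) S)"
      if "S \<in> {S. S \<subseteq> N \<and> card S = i}" for S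
      using bad_step_prob(3)[OF c(1,2)[OF that] l \<eta>'] c(3)[OF that] by simp
    \<comment> \<open>After i steps the set depends on sizes up to i + 1, and the step made now
      meets size i + 2.\<close>
    have K: "{T. T \<subseteq> N \<and> card T \<le> Suc i} \<subseteq> Pow N" "?L i \<subseteq> Pow N" "{T. T \<subseteq> N \<and> card T \<le> Suc i} \<inter> ?L i = {}"
      by auto
    note ad = prob_adaptive_choice_le[OF D Pow_ne K finZ measurable_noise_greedy[OF iN]
        greedy_depends_on[OF iN] bad_step_prob(1)[OF c(1,2) l \<eta>'] d p]
    show "Bs i \<in> sets noise" unfolding Bs_def by (rule ad(1))
    show "measure noise (Bs i) \<le> p1" unfolding Bs_def by (rule ad(2))
  qed
  have Bf: "Bf \<in> sets noise" "measure noise Bf \<le> p2"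
  proof -
    have sN: "s \<le> card N" using s r by simp
    have c: "S \<subseteq> N" "card S + 2 \<le> r" "card S = s" if "S \<in> {S. S \<subseteq> N \<and> card S = s}" for S
      using that s by auto
    have kc: "k \<le> card {T \<in> completions (pad N S). v S \<le> f T}" if S: "S \<in> {S. S \<subseteq> N \<and> card S = s}" for S
    proof -
      have "card S < card N" "Suc (Suc (card S)) \<le> r" "H \<noteq> {}" using c[OF S] s r by auto
      from many_good_completions[OF fin H ms opt c(1)[OF S] this(1,2) e this(3) refl opt_pos]
      show ?thesis using k unfolding card_good_completions v_def m_def by linarith
    qed
    have p: "measure noise {\<xi> \<in> space noise. bad_finish \<epsilon> t (v S) S \<xi>} \<le> p2"
      if "S \<in> {S. S \<subseteq> N \<and> card S = s}" for S
      using bad_finish_prob(2)[OF c(1,2)[OF that] kc[OF that], of \<epsilon> t] p2 by linarith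
    have d: "depends_on (space noise) (?L s) (bad_finish \<epsilon> t (v S) S)"
      if "S \<in> {S. S \<subseteq> N \<and> card S = s}" for S
      using bad_finish_prob(3)[OF c(1,2)[OF that] kc[OF that]] c(3)[OF that] by simp
    have K: "{T. T \<subseteq> N \<and> card T \<le> Suc s} \<subseteq> Pow N" "?L s \<subseteq> Pow N" "{T. T \<subseteq> N \<and> card T \<le> Suc s} \<inter> ?L s = {}"
      by auto
    note ad = prob_adaptive_choice_le[OF D Pow_ne K finZ measurable_noise_greedy[OF sN]
        greedy_depends_on[OF sN] bad_finish_prob(1)[OF c(1,2) kc] d p]
    show "Bf \<in> sets noise" unfolding Bf_def by (rule ad(1))
    show "measure noise Bf \<le> p2" unfolding Bf_def by (rule ad(2))
  qed
  define val where "val = opt * (1 - (1 - 1 / real r) ^ s) - 2 * real r * (\<eta> + real r * opt) / m - 2 * \<epsilon> * opt"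
  define R where "R \<xi> = result (greedy_strategy N H s {}) (noisy_oracle f \<xi>)" for \<xi>
  have R: "R \<xi> = finish N H (noisy_oracle f \<xi>) (?S s \<xi>)" for \<xi>
    by (simp add: R_def result_greedy_strategy[OF fin H] greedy_def)
  have Suc_s: "Suc s < card H" using s r by simp
  have "R \<in> measurable noise (count_space (Pow N))"
    unfolding R_def using s r
    by (intro measurable_strategy_result setsD queries_within_greedy_strategy[OF fin H]
        measurable_result_greedy_strategy[OF fin H Suc_s]) auto
  then have G: "{\<xi> \<in> space noise. val \<le> f (R \<xi>)} \<in> sets noise"
    by (intro borel_measurable_le borel_measurable_const measurable_compose[of R _ _ f]) auto
  have "{\<xi> \<in> space noise. \<not> val \<le> f (R \<xi>)} \<subseteq> (\<Union>i<s. Bs i) \<union> Bf"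
  proof
    fix \<xi> assume \<xi>: "\<xi> \<in> {\<xi> \<in> space noise. \<not> val \<le> f (R \<xi>)}"
    show "\<xi> \<in> (\<Union>i<s. Bs i) \<union> Bf"
    proof (rule ccontr)
      assume "\<xi> \<notin> (\<Union>i<s. Bs i) \<union> Bf"
      then have nb: "\<And>i. i < s \<Longrightarrow> \<not> bad_step l (\<mu> * \<eta>) (?S i \<xi>) \<xi>"
        and nf: "\<not> bad_finish \<epsilon> t (v (?S s \<xi>)) (?S s \<xi>) \<xi>"
        using \<xi> by (auto simp: Bs_def Bf_def)
      have Si: "?S i \<xi> \<subseteq> N" "card (?S i \<xi>) = i" if "i \<le> s" for i
        using greedy_props[OF fin H, of i] that s r by auto
      have acc: "\<bar>score H (noisy_oracle f \<xi>) (insert e (?S i \<xi>)) -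
        \<mu> * (\<Sum>x\<in>H - insert e (?S i \<xi>). f (insert x (insert e (?S i \<xi>))))\<bar> \<le> \<mu> * \<eta>"
        if "i < s" "e \<in> N - ?S i \<xi>" for i e
        using not_bad_step_score[OF Si(1) _ l nb[OF that(1)] that(2)] Si(2)[of i] that(1) s
        unfolding \<mu>_def by simp
      have "Suc s \<le> r" using s by simp
      from greedy_smoothed_value[OF fin H ms opt Z this r(1) \<open>0 < \<mu>\<close> \<open>0 \<le> \<eta>\<close> acc]
      have "m * opt * (1 - (1 - 1 / real r) ^ s) - 2 * real s * (\<eta> + real r * opt) \<le> smoothed H f (?S s \<xi>)"
        unfolding m_def by simp
      moreover have "2 * real s * (\<eta> + real r * opt) \<le> 2 * real r * (\<eta> + real r * opt)"
        using s \<open>0 \<le> \<eta>\<close> opt_pos by (intro mult_right_mono) auto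
      ultimately have "m * (opt * (1 - (1 - 1 / real r) ^ s)) - 2 * real r * (\<eta> + real r * opt) \<le> smoothed H f (?S s \<xi>)"
        by (simp add: mult.assoc)
      then have "(m * (opt * (1 - (1 - 1 / real r) ^ s)) - 2 * real r * (\<eta> + real r * opt)) / m \<le> smoothed H f (?S s \<xi>) / m"
        using m by (intro divide_right_mono) auto
      then have V: "val + 2 * \<epsilon> * opt \<le> smoothed H f (?S s \<xi>) / m"
        using m by (simp add: val_def diff_divide_distrib)
      have cS: "?S s \<xi> \<subseteq> N" "card (?S s \<xi>) < card N" "Suc (Suc (card (?S s \<xi>))) \<le> r"
        "Suc (card (?S s \<xi>)) < card H"
        using Si[of s] s r by auto
      from nf obtain T where T: "T \<in> completions (pad N (?S s \<xi>))" "v (?S s \<xi>) \<le> f T" "t \<le> \<xi> T"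
        and le: "\<And>T. T \<in> completions (pad N (?S s \<xi>)) \<Longrightarrow> \<xi> T \<le> (1 + \<epsilon>) * t"
        unfolding bad_finish_def by force
      then obtain y where y: "y \<in> H - pad N (?S s \<xi>)" "T = insert y (pad N (?S s \<xi>))"
        by (auto simp: completions_def)
      have "smoothed H f (?S s \<xi>) / real (card H) - 2 * \<epsilon> * opt \<le> f (finish N H (noisy_oracle f \<xi>) (?S s \<xi>))"
        using T y le
        by (intro finish_value[OF fin H ms opt cS e(1) \<open>0 < t\<close> refl _ y(1)]) (auto simp: v_def m_def completions_def)
      then have "val \<le> f (R \<xi>)" using V by (simp add: R m_def)
      then show False using \<xi> by simp
    qed
  qed
  moreover have U: "(\<Union>i<s. Bs i) \<in> sets noise" using Bs(1) by (intro sets.finite_UN) auto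
  ultimately have "measure noise {\<xi> \<in> space noise. \<not> val \<le> f (R \<xi>)} \<le> measure noise ((\<Union>i<s. Bs i) \<union> Bf)"
    using Bf(1) by (intro M.finite_measure_mono sets.Un)
  also have "\<dots> \<le> measure noise (\<Union>i<s. Bs i) + measure noise Bf" using U Bf(1) by (rule measure_Un_le)
  also have "measure noise (\<Union>i<s. Bs i) \<le> (\<Sum>i<s. measure noise (Bs i))"
    using Bs(1) by (intro measure_UNION_le) auto
  also have "\<dots> \<le> (\<Sum>i<s. p1)" using Bs(2) by (intro sum_mono) auto
  also have "(\<Sum>i<s. p1) \<le> real r * p1"
  proof -
    have "0 \<le> real (card N) * (real (card H) * measure D {l<..}
        + 2 * exp (- 2 * (\<mu> * \<eta>)\<^sup>2 / (real (card H) * (l * opt)\<^sup>2)))"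
      by (intro mult_nonneg_nonneg add_nonneg_nonneg) auto
    then have "0 \<le> p1" using p1 by linarith
    then show ?thesis using s by (simp add: mult_right_mono)
  qed
  also have "measure noise Bf \<le> p2" by (rule Bf(2))
  finally have bad: "measure noise {\<xi> \<in> space noise. \<not> val \<le> f (R \<xi>)} \<le> real r * p1 + p2" by simp
  have "{\<xi> \<in> space noise. \<not> val \<le> f (R \<xi>)} = space noise - {\<xi> \<in> space noise. val \<le> f (R \<xi>)}" by blast
  then have "measure noise {\<xi> \<in> space noise. \<not> val \<le> f (R \<xi>)} = 1 - measure noise {\<xi> \<in> space noise. val \<le> f (R \<xi>)}"
    using M.prob_compl[OF G] by (simp only:)
  then have "1 - (real r * p1 + p2) \<le> measure noise {\<xi> \<in> space noise. val \<le> f (R \<xi>)}"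
    using bad by linarith
  then show ?thesis unfolding val_def R_def m_def s_def .
qed

end

section \<open>Choice of parameters\<close>

lemma truncate_nonneg: "0 \<le> l \<Longrightarrow> 0 \<le> truncate l x"
  by (simp add: truncate_def)

lemma truncate_mono: "l \<le> l' \<Longrightarrow> truncate l x \<le> truncate l' x"
  by (simp add: truncate_def)

text \<open>The scores are scaled by the truncated mean, so their relative accuracy requires a
  positive lower bound that is uniform in \<open>l\<close>. If the mean truncated at 1 vanished, the
  noise would be almost surely at most 0, against its mean 1.\<close>

lemma truncated_mean_pos:
  assumes "prob_space D" and sets: "sets D = sets borel"
    and int: "integrable D (\<lambda>x. x)" and mean: "(\<integral>x. x \<partial>D) = 1"
  obtains c where "0 < c" "\<And>l. 1 \<le> l \<Longrightarrow> c \<le> (\<integral>x. truncate l x \<partial>D)"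
proof -
  interpret prob_space D by fact
  have m: "truncate l \<in> borel_measurable D" for l
    unfolding truncate_def[abs_def] measurable_cong_sets[OF sets refl] by simp
  have i: "integrable D (truncate l)" if "0 \<le> l" for l
    using m that by (intro integrable_const_bound[of _ l]) (auto simp: truncate_def)
  have "0 < (\<integral>x. truncate 1 x \<partial>D)"
  proof (rule ccontr)
    assume "\<not> 0 < (\<integral>x. truncate 1 x \<partial>D)"
    moreover have "0 \<le> (\<integral>x. truncate 1 x \<partial>D)" by (intro Bochner_Integration.integral_nonneg truncate_nonneg) simp
    ultimately have "(\<integral>x. truncate 1 x \<partial>D) = 0" by simp
    then have "AE x in D. truncate 1 x = 0"
      using integral_nonneg_eq_0_iff_AE[OF i[of 1]] truncate_nonneg[of 1] by simp
    then have "AE x in D. x \<le> 0" by eventually_elim (auto simp: truncate_def min_def max_def split: if_splits)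
    then have "(\<integral>x. x \<partial>D) \<le> (\<integral>x. 0 \<partial>D)" using int by (intro integral_mono_AE) auto
    then show False using mean by simp
  qed
  moreover have "(\<integral>x. truncate 1 x \<partial>D) \<le> (\<integral>x. truncate l x \<partial>D)" if "1 \<le> l" for l
    using that by (intro integral_mono i truncate_mono) auto
  ultimately show ?thesis using that by blast
qed

text \<open>The two missing steps cost a factor exp (2 / r), at most 1 + 4 / r. Since r is at least
  a / \<open>\<epsilon>\<close>, this loss is of order \<open>\<epsilon>\<close>.\<close>

lemma one_minus_inverse_power_le:
  assumes "2 \<le> r"
  shows "(1 - 1 / real r) ^ (r - 2) \<le> 1 / exp 1 + 4 / real r"
proof -
  have r: "0 < real r" using assms by simp
  have "(1 - 1 / real r) ^ (r - 2) \<le> exp (- 1 / real r) ^ (r - 2)"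
    using exp_ge_add_one_self[of "- 1 / real r"] assms by (intro power_mono) auto
  also have "\<dots> = exp (real (r - 2) * (- 1 / real r))" by (rule exp_of_nat_mult[symmetric])
  also have "real (r - 2) * (- 1 / real r) = - 1 + 2 / real r" using assms r by (simp add: of_nat_diff field_simps)
  also have "exp (- 1 + 2 / real r) = exp (2 / real r) / exp 1" using exp_diff[of "2 / real r" 1] by simp
  also have "\<dots> \<le> (1 + 4 / real r) / exp 1"
  proof (intro divide_right_mono)
    have "exp (2 / real r) \<le> 1 + 2 / real r + (2 / real r)\<^sup>2" using assms by (intro exp_bound) auto
    also have "(2 / real r)\<^sup>2 \<le> 2 / real r" using assms r by (simp add: power2_eq_square field_simps)
    finally show "exp (2 / real r) \<le> 1 + 4 / real r" by simp
  qed simp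
  also have "\<dots> \<le> 1 / exp 1 + 4 / real r"
  proof -
    have "4 / real r / exp 1 \<le> 4 / real r / 1" using r by (intro divide_left_mono) auto
    then show ?thesis by (simp add: add_divide_distrib)
  qed
  finally show ?thesis .
qed

lemma cardinality_constraint_Max:
  fixes r :: nat
  assumes "finite N" and ms: "monotone_submodular N f"
  defines "opt \<equiv> Max (f ` cardinality_constraint N r)"
  shows "T \<subseteq> N \<Longrightarrow> card T \<le> r \<Longrightarrow> f T \<le> opt" and "\<exists>T\<subseteq>N. card T \<le> r \<and> f T = opt" and "0 \<le> opt"
proof -
  have fin: "finite (cardinality_constraint N r)" using assms(1) by (simp add: cardinality_constraint_def)
  have ne: "{} \<in> cardinality_constraint N r" by (simp add: cardinality_constraint_def)
  show le: "f T \<le> opt" if "T \<subseteq> N" "card T \<le> r" for T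
    unfolding opt_def using that fin by (intro Max_ge) (auto simp: cardinality_constraint_def)
  have "opt \<in> f ` cardinality_constraint N r" unfolding opt_def using fin ne by (intro Max_in) auto
  then show "\<exists>T\<subseteq>N. card T \<le> r \<and> f T = opt" by (auto simp: cardinality_constraint_def)
  show "0 \<le> opt" using le[of "{}"] ms by (simp add: monotone_submodular_def)
qed

lemma success_probability_return_pmf:
  "success_probability D N \<I> f \<beta> (return_pmf T) =
     measure (PiM (Pow N) (\<lambda>_. D))
       {\<xi> \<in> space (PiM (Pow N) (\<lambda>_. D)). is_approximation \<I> f \<beta> (result T (noisy_oracle f \<xi>))}"
  unfolding success_probability_def by (subst integral_measure_pmf[where A="{T}"]) auto

lemma success_probability_trivial:
  fixes D :: "real measure"
  assumes "prob_space D"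
    and "\<And>\<xi>. is_approximation \<I> f \<beta> (result T (noisy_oracle f \<xi>))"
  shows "success_probability D N \<I> f \<beta> (return_pmf T) = 1"
proof -
  interpret prob_space "PiM (Pow N) (\<lambda>_. D)" by (intro prob_space_PiM assms)
  show ?thesis unfolding success_probability_return_pmf using assms(2) by (simp add: prob_space)
qed

text \<open>The loss 6 + 4 / a, in units of \<open>\<epsilon>\<close> times the optimum, consists of
  2 from the score errors, 2 from the skipped terms by r^2 <= \<open>\<epsilon>\<close> |H|, 2 from
  the final selection and 4 / a from the two missing greedy steps.\<close>

lemma greedy_strategy_success:
  fixes D :: "real measure" and N H :: "'a set" and \<epsilon> t l c :: real
  assumes D: "prob_space D" and setsD: "sets D = sets borel" and fin: "finite N" and H: "H \<subseteq> N"
    and ms: "monotone_submodular N f"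
    and r: "2 \<le> r" "r \<le> card N" "r < card H" and e: "0 < \<epsilon>" "\<epsilon> \<le> 1" and t: "0 < t" and l: "0 < l"
    and c: "0 < c" "c \<le> (\<integral>x. truncate l x \<partial>D)"
    and large: "2 * real r + 2 \<le> \<epsilon> * real (card H)" "(real r)\<^sup>2 \<le> \<epsilon> * real (card H)"
    and a: "0 < a" "a / \<epsilon> \<le> real r"
    and C: "6 + 4 / a \<le> C"
  shows "1 - (real r * (real (card N) * (real (card H) * measure D {l<..}
            + 2 * exp (- 2 * (c * \<epsilon> / (real r * l))\<^sup>2 * real (card H))))
          + (real (card H) * measure D {(1 + \<epsilon>) * t<..} + exp (- (measure D {t..} * (\<epsilon> * real (card H) / 2)))))
     \<le> success_probability D N (cardinality_constraint N r) f (1 - 1 / exp 1 - C * \<epsilon>)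
         (return_pmf (greedy_strategy N H (r - 2) {}))" (is "1 - ?p \<le> success_probability D N ?I f ?\<beta> (return_pmf ?T)")
proof -
  interpret D: prob_space D by fact
  define opt where "opt = Max (f ` ?I)"
  note opt = cardinality_constraint_Max[OF fin ms, where r=r, folded opt_def]
  have Suc_s: "Suc (r - 2) < card H" using r by simp
  have qw: "queries_within N ?T" using r by (intro queries_within_greedy_strategy[OF fin H]) auto
  have meas: "(\<lambda>\<xi>. result ?T (noisy_oracle f \<xi>)) \<in> measurable (PiM (Pow N) (\<lambda>_. D)) (count_space (Pow N))"
    by (rule measurable_strategy_result[OF setsD qw measurable_result_greedy_strategy[OF fin H Suc_s]])
  have feas: "result ?T orc \<in> ?I" for orc
  proof -
    let ?S = "greedy N H orc (r - 2)"
    have S: "?S \<subseteq> N" "card ?S = r - 2" using greedy_props[OF fin H, of "r - 2" orc] r by auto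
    have "card ?S < card N" "Suc (card ?S) < card H" using S r by auto
    from finish_props(2,3)[OF fin H S(1) this, of orc]
    show ?thesis using S r unfolding result_greedy_strategy[OF fin H] greedy_def[symmetric]
      by (simp add: cardinality_constraint_def)
  qed
  have p0: "0 \<le> ?p" by (intro add_nonneg_nonneg mult_nonneg_nonneg) auto
  show ?thesis
  proof (cases "0 < opt")
    \<comment> \<open>If the optimum is 0, every feasible set is optimal. The other case needs a
      positive bound on the weights in Hoeffding's inequality.\<close>
    case False
    then have "opt = 0" using opt(3) by simp
    then have "is_approximation ?I f ?\<beta> (result ?T (noisy_oracle f \<xi>))" for \<xi>
      using feas[of "noisy_oracle f \<xi>"] ms
      by (auto simp: is_approximation_def opt_def cardinality_constraint_def monotone_submodular_def)
    then have "success_probability D N ?I f ?\<beta> (return_pmf ?T) = 1" by (rule success_probability_trivial[OF D])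
    then show ?thesis using p0 by linarith
  next
    case True
    let ?M = "PiM (Pow N) (\<lambda>_. D)" and ?\<mu> = "\<integral>x. truncate l x \<partial>D"
    interpret M: prob_space ?M by (intro prob_space_PiM D)
    obtain Z where Z: "Z \<subseteq> N" "card Z \<le> r" "f Z = opt" using opt(2) by blast
    define m where "m = real (card H)"
    have m: "0 < m" "real r < m" using r by (auto simp: m_def)
    have r0: "0 < real r" using r by simp
    \<comment> \<open>An error of \<open>\<epsilon>\<close> / r times the optimum per element of
      \<open>H\<close> and step adds up to order \<open>\<epsilon>\<close> over at most r
      steps.\<close>
    define \<eta> where "\<eta> = \<epsilon> / real r * m * opt"
    \<comment> \<open>The first part of \<open>large\<close> makes the rounded number at least half
      of \<open>\<epsilon>\<close> m.\<close>
    define k where "k = nat \<lfloor>\<epsilon> * m - real r\<rfloor>"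
    have k: "real k \<le> \<epsilon> * m - real r" "\<epsilon> * m / 2 \<le> real k"
      using large(1) unfolding k_def m_def by linarith+
    have \<eta>0: "0 \<le> \<eta>" using e m r0 True by (simp add: \<eta>_def)
    define p1 where "p1 = real (card N) * (m * measure D {l<..} + 2 * exp (- 2 * (c * \<epsilon> / (real r * l))\<^sup>2 * m))"
    define p2 where "p2 = m * measure D {(1 + \<epsilon>) * t<..} + exp (- (measure D {t..} * (\<epsilon> * m / 2)))"
    have mu: "0 < ?\<mu>" using c by simp
    have p1: "real (card N) * (m * measure D {l<..} + 2 * exp (- 2 * (?\<mu> * \<eta>)\<^sup>2 / (m * (l * opt)\<^sup>2))) \<le> p1"
      unfolding p1_def
    proof (intro mult_left_mono add_left_mono)
      have "(c * \<eta>)\<^sup>2 \<le> (?\<mu> * \<eta>)\<^sup>2" using c \<eta>0 by (intro power_mono mult_right_mono) auto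
      then have "2 * (c * \<eta>)\<^sup>2 / (m * (l * opt)\<^sup>2) \<le> 2 * (?\<mu> * \<eta>)\<^sup>2 / (m * (l * opt)\<^sup>2)"
        using m by (intro divide_right_mono) auto
      moreover have "2 * (c * \<eta>)\<^sup>2 / (m * (l * opt)\<^sup>2) = 2 * (c * \<epsilon> / (real r * l))\<^sup>2 * m"
        using m True l r0 by (simp add: \<eta>_def power2_eq_square field_simps)
      ultimately show "exp (- 2 * (?\<mu> * \<eta>)\<^sup>2 / (m * (l * opt)\<^sup>2)) \<le> exp (- 2 * (c * \<epsilon> / (real r * l))\<^sup>2 * m)"
        by simp
    qed auto
    have p2: "m * measure D {(1 + \<epsilon>) * t<..} + (1 - measure D {t..}) ^ k \<le> p2"
      unfolding p2_def
    proof (intro add_left_mono)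
      have "(1 - measure D {t..}) ^ k \<le> exp (- measure D {t..}) ^ k"
        using exp_ge_add_one_self[of "- measure D {t..}"] by (intro power_mono) auto
      also have "\<dots> = exp (real k * (- measure D {t..}))" by (rule exp_of_nat_mult[symmetric])
      also have "\<dots> \<le> exp (- (measure D {t..} * (\<epsilon> * m / 2)))"
        using mult_left_mono[OF k(2), of "measure D {t..}"] by (simp add: mult.commute)
      finally show "(1 - measure D {t..}) ^ k \<le> exp (- (measure D {t..} * (\<epsilon> * m / 2)))" .
    qed
    define val where "val = opt * (1 - (1 - 1 / real r) ^ (r - 2)) - 2 * real r * (\<eta> + real r * opt) / m - 2 * \<epsilon> * opt"
    have main: "1 - (real r * p1 + p2) \<le> measure ?M {\<xi> \<in> space ?M. val \<le> f (result ?T (noisy_oracle f \<xi>))}"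
      unfolding val_def m_def
      by (rule greedy_success_probability[OF fin H ms opt(1) True D setsD r(2,3) Z r(1) less_imp_le[OF e(1)] e(2) t l mu
            \<eta>0 k(1)[unfolded m_def] p1[unfolded m_def] p2[unfolded m_def]])
    have "?\<beta> * opt \<le> val"
    proof -
      have "2 * real r * (\<eta> + real r * opt) / m = 2 * \<epsilon> * opt + 2 * ((real r)\<^sup>2 / m) * opt"
        using m r0 by (simp add: \<eta>_def power2_eq_square field_simps)
      also have "\<dots> \<le> 2 * \<epsilon> * opt + 2 * \<epsilon> * opt"
        using large(2) m True by (intro add_left_mono mult_right_mono) (auto simp: m_def field_simps)
      finally have 1: "2 * real r * (\<eta> + real r * opt) / m \<le> 4 * \<epsilon> * opt" by simp
      have "4 / real r \<le> 4 / a * \<epsilon>" using a r0 e by (simp add: field_simps)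
      then have "(1 - 1 / real r) ^ (r - 2) \<le> 1 / exp 1 + 4 / a * \<epsilon>"
        using one_minus_inverse_power_le[OF r(1)] by linarith
      then have "1 - 1 / exp 1 - 4 / a * \<epsilon> \<le> 1 - (1 - 1 / real r) ^ (r - 2)" by linarith
      then have 2: "opt * (1 - 1 / exp 1 - 4 / a * \<epsilon>) \<le> opt * (1 - (1 - 1 / real r) ^ (r - 2))"
        using True by (intro mult_left_mono) auto
      have "(6 + 4 / a) * \<epsilon> \<le> C * \<epsilon>" using C e by (intro mult_right_mono) auto
      then have "?\<beta> * opt \<le> (1 - 1 / exp 1 - (6 + 4 / a) * \<epsilon>) * opt" using True by (intro mult_right_mono) auto
      also have "\<dots> = opt * (1 - 1 / exp 1 - 4 / a * \<epsilon>) - 4 * \<epsilon> * opt - 2 * \<epsilon> * opt" by (simp add: algebra_simps)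
      finally show ?thesis using 1 2 unfolding val_def by linarith
    qed
    then have sub: "{\<xi> \<in> space ?M. val \<le> f (result ?T (noisy_oracle f \<xi>))}
        \<subseteq> {\<xi> \<in> space ?M. is_approximation ?I f ?\<beta> (result ?T (noisy_oracle f \<xi>))}"
      using feas by (auto simp: is_approximation_def opt_def)
    have "{\<xi> \<in> space ?M. is_approximation ?I f ?\<beta> (result ?T (noisy_oracle f \<xi>))}
        = (\<lambda>\<xi>. result ?T (noisy_oracle f \<xi>)) -` ({S. is_approximation ?I f ?\<beta> S} \<inter> Pow N) \<inter> space ?M"
      by (auto simp: is_approximation_def cardinality_constraint_def)
    moreover have "\<dots> \<in> sets ?M" by (rule measurable_sets[OF meas]) simp
    ultimately have "{\<xi> \<in> space ?M. is_approximation ?I f ?\<beta> (result ?T (noisy_oracle f \<xi>))} \<in> sets ?M"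
      by (simp only:)
    from M.finite_measure_mono[OF sub this]
    have "1 - (real r * p1 + p2) \<le> success_probability D N ?I f ?\<beta> (return_pmf ?T)"
      unfolding success_probability_return_pmf using main by linarith
    then show ?thesis unfolding p1_def p2_def m_def .
  qed
qed

theorem theorem4p1:
  fixes D :: "real measure" and a b :: real
  assumes "prob_space D" and "sets D = sets borel"
    and "generalized_exponential_tail D"
    and "integrable D (\<lambda>x. x)" and "(\<integral>x. x \<partial>D) = 1"
    and "a > 0" and "b > 0"
  shows "\<exists>k>0. \<exists>n\<^sub>0>0. \<exists>C\<^sub>1>0. \<exists>C\<^sub>2>0. \<exists>C\<^sub>3>0.
    \<forall>\<epsilon>>0. \<forall>(n::nat) (r::nat) (N::'a set).
      finite N \<longrightarrow> card N = n \<longrightarrow>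
      real n \<ge> n\<^sub>0 * exp ((1 / \<epsilon>) powr k) \<longrightarrow>
      a / \<epsilon> \<le> real r \<longrightarrow> real r \<le> b * real n powr (1/3) \<longrightarrow>
      (\<exists>\<A>. algorithm_on N \<A> \<and>
         (\<forall>T \<in> set_pmf \<A>. \<forall>orc.
            real (num_queries T orc)
              \<le> C\<^sub>3 * (real r ^ 2 * ln (real r) ^ 2 * real n powr (3/2) * (1 / \<epsilon>)
                       * max (real r) (ln (real n)))) \<and>
         (\<forall>f. monotone_submodular N f \<longrightarrow>
            success_probability D N (cardinality_constraint N r) f
              (1 - 1 / exp 1 - C\<^sub>1 * \<epsilon>) \<A>
            \<ge> 1 - C\<^sub>2 / ln (real n)))"
proof -
  note tail = generalized_exponential_tail_bounds[OF assms(1-5)]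
  obtain k m\<^sub>0 where k: "0 < k" and conc: "\<And>\<epsilon> m. 0 < \<epsilon> \<Longrightarrow> \<epsilon> \<le> 1 \<Longrightarrow> m\<^sub>0 \<le> m \<Longrightarrow> (1 / \<epsilon>) powr k \<le> ln m \<Longrightarrow>
     \<exists>t>0. m * measure D {(1 + \<epsilon>) * t<..} \<le> 1 / ln m \<and> (ln m)\<^sup>2 \<le> m * measure D {t..}"
    using tail(1) unfolding concentrated_maxima_def by metis
  obtain c where c: "0 < c" "\<And>l. 1 \<le> l \<Longrightarrow> c \<le> (\<integral>x. truncate l x \<partial>D)"
    using truncated_mean_pos[OF assms(1,2,4,5)] by metis
  \<comment> \<open>Hoeffding's exponent at the extreme admissible values: \<open>\<epsilon>\<close>
    replaced by 1 / ln x, |H| / r by sqrt x / 2, r by b x^(1/3), and truncation at x^(1/24). It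
    grows like x^(1/12) up to logarithms.\<close>
  define Y where "Y x = 2 * (c * (1 / ln x))\<^sup>2 * (sqrt x / 2 / (b * x powr (1/3))) / (x powr (1/24))\<^sup>2" for x :: real
  \<comment> \<open>All demands on n in a form free of \<open>\<epsilon>\<close> and r. The exponent
    96 = 24 * 4 turns the tail beyond the truncation level into n^(-4), enough for a union bound
    over all queried sets.\<close>
  define good where "good x \<longleftrightarrow> 16 \<le> x \<and> 1 \<le> ln x \<and> m\<^sub>0 \<le> sqrt x \<and> 1 \<le> x powr (1/24)
     \<and> measure D {x powr (1/24)<..} \<le> (x powr (1/24)) powr (-96)
     \<and> b * x powr (1/3) * sqrt x \<le> x \<and> b * x powr (1/3) \<le> x
     \<and> 8 \<le> sqrt x / ln x \<and> b * x powr (1/3) \<le> sqrt x / 2 / ln x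
     \<and> b * x powr (1/3) * (x * (x * x powr (-4) + 2 * exp (- Y x))) \<le> 1 / ln x
     \<and> exp (- (ln x / 8)) \<le> 1 / ln x" for x :: real
  have "eventually good at_top"
    unfolding good_def
  proof (intro eventually_conj)
    have "filterlim (\<lambda>x::real. x powr (1/24)) at_top at_top" by real_asymp
    from eventually_compose_filterlim[OF tail(2)[of 96] this]
    show "eventually (\<lambda>x. measure D {x powr (1/24)<..} \<le> (x powr (1/24)) powr (-96)) at_top" .
    show "eventually (\<lambda>x. b * x powr (1/3) * (x * (x * x powr (-4) + 2 * exp (- Y x))) \<le> 1 / ln x) at_top"
      unfolding Y_def using c(1) \<open>b > 0\<close> by real_asymp
  qed (use \<open>b > 0\<close> in real_asymp)+
  then obtain n\<^sub>1 where n1: "\<And>x. n\<^sub>1 \<le> x \<Longrightarrow> good x" by (auto simp: eventually_at_top_linorder)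
  define n\<^sub>0 where "n\<^sub>0 = max 1 n\<^sub>1"
  \<comment> \<open>If this constant times \<open>\<epsilon>\<close> is below 1, then 8
    \<open>\<epsilon>\<close> < 1 and, by a / \<open>\<epsilon>\<close> <= r, also r > 7. It also
    exceeds the loss 6 + 4 / a.\<close>
  define C\<^sub>1 where "C\<^sub>1 = 8 + 7 / a"
  have C1: "0 < C\<^sub>1" "6 + 4 / a \<le> C\<^sub>1" using divide_right_mono[of 4 7 a] \<open>a > 0\<close> by (auto simp: C\<^sub>1_def add_pos_pos)
  show ?thesis
  \<comment> \<open>The additional power of 1 / \<open>\<epsilon>\<close> yields both 1 /
    \<open>\<epsilon>\<close> <= ln n and a factor 2 to spare in (1 / \<open>\<epsilon>\<close>)^k
    <= ln n.\<close>
  proof (rule exI[of _ "k + 1"], intro conjI, use k in simp, rule exI[of _ n\<^sub>0], intro conjI, simp add: n\<^sub>0_def,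
      rule exI[of _ C\<^sub>1], intro conjI, rule C1(1), rule exI[of _ 4], intro conjI, simp, rule exI[of _ 1], intro conjI, simp,
      intro allI impI)
    fix \<epsilon> :: real and n r :: nat and N :: "'a set"
    assume \<epsilon>: "0 < \<epsilon>" and fin: "finite N" and n: "card N = n"
      and n_ge: "n\<^sub>0 * exp ((1 / \<epsilon>) powr (k + 1)) \<le> real n"
      and r_ge: "a / \<epsilon> \<le> real r" and r_le: "real r \<le> b * real n powr (1/3)"
    let ?I = "cardinality_constraint N r" and ?\<beta> = "1 - 1 / exp 1 - C\<^sub>1 * \<epsilon>"
    have "n\<^sub>0 * 1 \<le> n\<^sub>0 * exp ((1 / \<epsilon>) powr (k + 1))" by (intro mult_left_mono) (auto simp: n\<^sub>0_def)
    then have "n\<^sub>0 \<le> real n" using n_ge by linarith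
    then have g: "good (real n)" by (intro n1) (simp add: n\<^sub>0_def)
    have n16: "16 \<le> real n" and ln1: "1 \<le> ln (real n)" using g by (auto simp: good_def)
    show "\<exists>\<A>. algorithm_on N \<A> \<and>
         (\<forall>T \<in> set_pmf \<A>. \<forall>orc.
            real (num_queries T orc)
              \<le> 1 * (real r ^ 2 * ln (real r) ^ 2 * real n powr (3/2) * (1 / \<epsilon>)
                       * max (real r) (ln (real n)))) \<and>
         (\<forall>f. monotone_submodular N f \<longrightarrow> 1 - 4 / ln (real n) \<le> success_probability D N ?I f ?\<beta> \<A>)"
    proof (cases "1 \<le> C\<^sub>1 * \<epsilon>")
      \<comment> \<open>The required factor is at most 0, and the empty set is returned without a
        query.\<close>
      case True
      have "0 < 1 / exp (1::real)" by simp
      then have beta: "?\<beta> \<le> 0" using True by linarith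
      have "is_approximation ?I f ?\<beta> {}" if "monotone_submodular N f" for f
        using cardinality_constraint_Max(3)[OF fin that, of r] that beta
        by (auto simp: is_approximation_def cardinality_constraint_def monotone_submodular_def mult_nonpos_nonneg)
      then have "success_probability D N ?I f ?\<beta> (return_pmf (Return {})) = 1" if "monotone_submodular N f" for f
        using that by (intro success_probability_trivial[OF assms(1)]) simp
      moreover have "result (Return {}) = (\<lambda>_::'a set \<Rightarrow> real. {}::'a set)" by (simp add: fun_eq_iff)
      then have "algorithm_on N (return_pmf (Return {}))" by (simp add: algorithm_on_def)
      ultimately show ?thesis
        using ln1 \<epsilon> by (intro exI[of _ "return_pmf (Return {})"] conjI) auto
    next
      case False
      have "7 / a * \<epsilon> + 8 * \<epsilon> < 1" using False by (simp add: C\<^sub>1_def algebra_simps)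
      moreover have "0 < 7 / a * \<epsilon>" using \<open>a > 0\<close> \<epsilon> by simp
      ultimately have e8: "8 * \<epsilon> < 1" and ea: "7 / a * \<epsilon> < 1" using \<epsilon> by linarith+
      have "7 < a / \<epsilon>" using ea \<open>a > 0\<close> \<epsilon> by (simp add: field_simps)
      then have r7: "7 < real r" using r_ge by linarith
      \<comment> \<open>\<open>H\<close> gets exactly r q elements; r q <= n because r is at most of
        order n^(1/3).\<close>
      define q where "q = nat \<lfloor>sqrt (real n)\<rfloor>"
      have "4 \<le> sqrt (real n)" using n16 by (intro real_le_rsqrt) simp
      then have q: "sqrt (real n) / 2 \<le> real q" "real q \<le> sqrt (real n)" unfolding q_def by linarith+
      have "real (r * q) \<le> real n"
      proof -
        have "real r * real q \<le> (b * real n powr (1/3)) * sqrt (real n)"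
          using r_le q by (intro mult_mono) auto
        then show ?thesis using g by (simp add: good_def)
      qed
      then have "r * q \<le> card N" using n by (simp only: of_nat_le_iff)
      then obtain H where H: "H \<subseteq> N" "card H = r * q" by (metis obtain_subset_with_card_n)
      define m where "m = real (card H)"
      have m: "m = real r * real q" by (simp add: m_def H)
      have q2: "2 \<le> real q" using q \<open>4 \<le> sqrt (real n)\<close> by linarith
      have "(1 / \<epsilon>) powr (k + 1) \<le> ln (real n)"
      proof -
        have "exp ((1 / \<epsilon>) powr (k + 1)) \<le> n\<^sub>0 * exp ((1 / \<epsilon>) powr (k + 1))" by (simp add: n\<^sub>0_def)
        then have "exp ((1 / \<epsilon>) powr (k + 1)) \<le> real n" using n_ge by linarith
        then show ?thesis using n16 by (subst ln_ge_iff) auto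
      qed
      then have big: "(1 / \<epsilon>) * (1 / \<epsilon>) powr k \<le> ln (real n)" using \<epsilon> by (simp add: powr_add mult.commute)
      have ei: "8 < 1 / \<epsilon>" using e8 \<epsilon> by (simp add: field_simps)
      have "1 \<le> (1 / \<epsilon>) powr k" using ei k by (intro ge_one_powr_ge_zero) auto
      then have "(1 / \<epsilon>) * 1 \<le> (1 / \<epsilon>) * (1 / \<epsilon>) powr k" using \<epsilon> by (intro mult_left_mono) auto
      then have "1 / \<epsilon> \<le> ln (real n)" using big by linarith
      then have eps_ge: "1 / ln (real n) \<le> \<epsilon>" using \<epsilon> ln1 by (simp add: field_simps)
      \<comment> \<open>The tail property is applied with m = |H| rather than n; as m is at least
        sqrt n, ln m is at least half of ln n.\<close>
      have "2 * (1 / \<epsilon>) powr k \<le> (1 / \<epsilon>) * (1 / \<epsilon>) powr k" using ei by (intro mult_right_mono) auto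
      then have half: "(1 / \<epsilon>) powr k \<le> ln (real n) / 2" using big by linarith
      have "2 * real q \<le> m" unfolding m using r7 by (intro mult_right_mono) auto
      then have msq: "sqrt (real n) \<le> m" using q by linarith
      have lnm: "ln (real n) / 2 \<le> ln m"
      proof -
        have "ln (sqrt (real n)) \<le> ln m" using msq n16 by (intro ln_mono) auto
        then show ?thesis using n16 by (simp add: ln_sqrt)
      qed
      have "m\<^sub>0 \<le> m" using g msq by (simp add: good_def)
      then obtain t where t: "0 < t" "m * measure D {(1 + \<epsilon>) * t<..} \<le> 1 / ln m" "(ln m)\<^sup>2 \<le> m * measure D {t..}"
        using conc[of \<epsilon> m] \<epsilon> e8 half lnm by fastforce
      let ?T = "greedy_strategy N H (r - 2) {}" and ?l = "real n powr (1/24)"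
      have r2: "2 \<le> r" using r7 by simp
      have "b * real n powr (1/3) \<le> real n" using g unfolding good_def by blast
      then have "real r \<le> real n" using r_le by linarith
      then have rn: "r \<le> card N" using n by simp
      have "real r * 2 \<le> m" unfolding m using q2 by (intro mult_left_mono) auto
      then have "real r < m" using r7 by linarith
      then have rH: "r < card H" by (simp add: m_def)
      have eq: "4 \<le> \<epsilon> * real q"
      proof -
        have "8 \<le> sqrt (real n) / ln (real n)" using g unfolding good_def by blast
        then have "4 \<le> 1 / ln (real n) * (sqrt (real n) / 2)" by simp
        also have "\<dots> \<le> \<epsilon> * real q" using eps_ge q \<epsilon> ln1 by (intro mult_mono) auto
        finally show ?thesis .
      qed
      have large1: "2 * real r + 2 \<le> \<epsilon> * m"
      proof -
        have "real r * 4 \<le> real r * (\<epsilon> * real q)" using eq by (intro mult_left_mono) auto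
        moreover have "real r * (\<epsilon> * real q) = \<epsilon> * m" by (simp add: m)
        ultimately show ?thesis using r7 by linarith
      qed
      have large2: "(real r)\<^sup>2 \<le> \<epsilon> * m"
      proof -
        have "real r \<le> sqrt (real n) / 2 / ln (real n)" using g r_le unfolding good_def by linarith
        also have "\<dots> = 1 / ln (real n) * (sqrt (real n) / 2)" by simp
        also have "\<dots> \<le> \<epsilon> * real q" using eps_ge q \<epsilon> ln1 by (intro mult_mono) auto
        finally have "real r * real r \<le> real r * (\<epsilon> * real q)" by (intro mult_left_mono) auto
        moreover have "real r * (\<epsilon> * real q) = \<epsilon> * m" by (simp add: m)
        ultimately show ?thesis unfolding power2_eq_square by linarith
      qed
      have l1: "1 \<le> ?l" using g unfolding good_def by blast
      have alg: "algorithm_on N (return_pmf ?T)"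
        using rH r2 rn queries_within_greedy_strategy[OF fin H(1), of "{}" "r - 2"]
          measurable_result_greedy_strategy[OF fin H(1), of "r - 2"]
        by (simp add: algorithm_on_def)
      have queries: "real (num_queries ?T orc) \<le> real r ^ 2 * ln (real r) ^ 2 * real n powr (3/2) * (1 / \<epsilon>) * max (real r) (ln (real n))" for orc
      proof -
        have "num_queries ?T orc \<le> (r - 2) * (card N * card H) + card H" by (rule num_queries_greedy_strategy[OF fin H(1)])
        also have "\<dots> \<le> (r - 2) * (card N * card H) + card N * card H" using n n16 by simp
        also have "\<dots> = Suc (r - 2) * (card N * card H)" by simp
        also have "\<dots> \<le> r * (card N * card H)" using r2 by (intro mult_right_mono) auto
        finally have "real (num_queries ?T orc) \<le> real (r * (card N * card H))" by (simp only: of_nat_le_iff)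
        also have "\<dots> = (real r)\<^sup>2 * (real n * real q)" using n H by (simp add: power2_eq_square)
        also have "\<dots> \<le> (real r)\<^sup>2 * (real n * sqrt (real n))" using q by (intro mult_left_mono) auto
        also have "real n * sqrt (real n) = real n powr (3/2)"
          using n16 powr_add[of "real n" 1 "1/2"] by (simp add: powr_half_sqrt)
        also have "(real r)\<^sup>2 * real n powr (3/2) = (real r)\<^sup>2 * 1 * real n powr (3/2) * 1 * 1" by simp
        \<comment> \<open>The remaining factors of the bound are at least 1: r > 7 gives ln r >= 1,
          and \<open>\<epsilon>\<close> is below 1.\<close>
        also have "\<dots> \<le> real r ^ 2 * ln (real r) ^ 2 * real n powr (3/2) * (1 / \<epsilon>) * max (real r) (ln (real n))"
        proof -
          have "1 \<le> ln (real r)" using r7 ln3_gt_1 ln_mono[of 3 "real r"] by linarith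
          then have "1 \<le> ln (real r) ^ 2" by simp
          then show ?thesis using e8 r7 \<epsilon> by (intro mult_mono) auto
        qed
        finally show ?thesis .
      qed
      have succ: "1 - 4 / ln (real n) \<le> success_probability D N ?I f ?\<beta> (return_pmf ?T)"
        if f: "monotone_submodular N f" for f
      proof -
        have step: "real r * (real n * (m * measure D {?l<..} + 2 * exp (- 2 * (c * \<epsilon> / (real r * ?l))\<^sup>2 * m))) \<le> 1 / ln (real n)"
        proof -
          have "m \<le> real n" using \<open>real (r * q) \<le> real n\<close> by (simp add: m)
          moreover have "measure D {?l<..} \<le> real n powr (-4)"
            using g unfolding good_def by (simp add: powr_powr)
          ultimately have A: "m * measure D {?l<..} \<le> real n * real n powr (-4)" by (intro mult_mono) auto
          have "Y (real n) \<le> 2 * (c * \<epsilon> / (real r * ?l))\<^sup>2 * m"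
          proof -
            have "Y (real n) \<le> 2 * (c * \<epsilon>)\<^sup>2 * (real q / real r) / ?l\<^sup>2"
              unfolding Y_def using eps_ge q r_le r7 c(1) \<epsilon> ln1
              by (intro divide_right_mono mult_mono power_mono frac_le mult_left_mono) auto
            also have "\<dots> = 2 * (c * \<epsilon> / (real r * ?l))\<^sup>2 * m"
              using r7 unfolding m by (simp add: power2_eq_square field_simps)
            finally show ?thesis .
          qed
          then have B: "exp (- 2 * (c * \<epsilon> / (real r * ?l))\<^sup>2 * m) \<le> exp (- Y (real n))" by simp
          have AB: "m * measure D {?l<..} + 2 * exp (- 2 * (c * \<epsilon> / (real r * ?l))\<^sup>2 * m)
            \<le> real n * real n powr (-4) + 2 * exp (- Y (real n))" using A B by linarith
          have "real r * (real n * (m * measure D {?l<..} + 2 * exp (- 2 * (c * \<epsilon> / (real r * ?l))\<^sup>2 * m)))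
            \<le> b * real n powr (1/3) * (real n * (real n * real n powr (-4) + 2 * exp (- Y (real n))))"
            using AB r_le \<open>b > 0\<close>
            by (intro mult_mono[OF _ mult_left_mono]) (auto simp: m_def intro!: mult_nonneg_nonneg add_nonneg_nonneg)
          also have "\<dots> \<le> 1 / ln (real n)" using g unfolding good_def by blast
          finally show ?thesis .
        qed
        have "m * measure D {(1 + \<epsilon>) * t<..} \<le> 2 / ln (real n)"
        proof -
          have "1 / ln m \<le> 1 / (ln (real n) / 2)" using lnm ln1 by (intro divide_left_mono) auto
          then show ?thesis using t(2) by simp
        qed
        moreover have "exp (- (measure D {t..} * (\<epsilon> * m / 2))) \<le> 1 / ln (real n)"
        proof -
          \<comment> \<open>Only about \<open>\<epsilon>\<close> m / 2 completions are good, and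
            \<open>\<epsilon>\<close> may be as small as 1 / ln n. The square in the tail property
            compensates for this and leaves an expected number of order ln n of good completions
            reaching t.\<close>
          have "ln (real n) / 8 = 1 / ln (real n) * (ln (real n) / 2)\<^sup>2 / 2" using ln1 by (simp add: power2_eq_square)
          also have "\<dots> \<le> \<epsilon> * (m * measure D {t..}) / 2"
          proof -
            have "(ln (real n) / 2)\<^sup>2 \<le> (ln m)\<^sup>2" using lnm ln1 by (intro power_mono) auto
            then have "(ln (real n) / 2)\<^sup>2 \<le> m * measure D {t..}" using t(3) by linarith
            then show ?thesis using eps_ge \<epsilon> by (intro divide_right_mono mult_mono) auto
          qed
          finally have "exp (- (measure D {t..} * (\<epsilon> * m / 2))) \<le> exp (- (ln (real n) / 8))" by (simp add: mult_ac)
          also have "\<dots> \<le> 1 / ln (real n)" using g unfolding good_def by blast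
          finally show ?thesis .
        qed
        \<comment> \<open>The failure probability splits into 1 for the greedy steps, 2 for a too
          large multiplier (through ln m >= ln n / 2) and 1 for no good completion reaching
          t.\<close>
        moreover have "4 / ln (real n) = 1 / ln (real n) + (2 / ln (real n) + 1 / ln (real n))"
          by (simp add: add_divide_distrib[symmetric])
        ultimately have total: "1 - 4 / ln (real n) \<le> 1 - (real r * (real n * (m * measure D {?l<..}
            + 2 * exp (- 2 * (c * \<epsilon> / (real r * ?l))\<^sup>2 * m)))
          + (m * measure D {(1 + \<epsilon>) * t<..} + exp (- (measure D {t..} * (\<epsilon> * m / 2)))))"
          using step by linarith
        have e1: "\<epsilon> \<le> 1" using e8 \<epsilon> by linarith
        have l0: "0 < ?l" using l1 by linarith
        from greedy_strategy_success[OF assms(1,2) fin H(1) f r2 rn rH \<epsilon> e1 t(1) l0 c(1) c(2)[OF l1]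
            large1[unfolded m_def] large2[unfolded m_def] \<open>a > 0\<close> r_ge C1(2)]
        show ?thesis using total unfolding n m_def by linarith
      qed
      show ?thesis
        using alg queries succ by (intro exI[of _ "return_pmf ?T"]) auto
    qed
  qed
qed

end
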